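(* Let $X$ be a finite topological space with dual space $\widehat X$. For any $F\in D(X)$, any $T\in D(\widehat X)$ and any complex $\mathcal{L}$ of locally constant abelian data on $X$ (and hence on $\widehat X$) one has a natural isomorphism $$\mathbb{R}\mathrm{Hom}^\bullet\bigl(T,\mathbb{L}\underline{\widehat{\mathrm{Hom}}}^\bullet(F,\mathcal{L})\bigr)=\mathbb{R}\mathrm{Hom}^\bullet\bigl(F,\mathbb{L}\underline{\widehat{\mathrm{Hom}}}^\bullet(T,\mathcal{L})\bigr).$$
   Context: A finite topological space $X$ is regarded as a preordered set: $p\le q$ iff $\overline{\{p\}}\subseteq\overline{\{q\}}$; open sets are the up-closed sets. The dual space $\widehat X$ is the same set with the opposite topology (opposite preorder); $\widehat x$ denotes $x\in X$ viewed in $\widehat X$, so $\widehat x\le\widehat y$ iff $x\ge y$, and $\widehat{\widehat X}=X$. An abelian data $F$ on $X$ is a functor from the preorder $X$ to abelian groups ($F_p$, with $r_{pq}\colon F_p\to F_q$ for $p\le q$). $D(X)$ is the (unbounded) derived category of abelian data on $X$. An abelian data $\mathcal{L}$ is locally constant iff all $r_{pq}\colon\mathcal{L}_p\to\mathcal{L}_q$ ($p\le q$) are isomorphisms. A locally constant $\mathcal{L}$ on $X$ is viewed as a locally constant abelian data on $\widehat X$ via $\mathcal{L}_{\widehat p}:=\mathcal{L}_p$, $r_{\widehat p\widehat q}:=r_{qp}^{-1}$; likewise for complexes. For a complex $F$ of abelian data and a complex $\mathcal{L}$ of locally constant abelian data on $X$, $\underline{\widehat{\mathrm{Hom}}}^\bullet(F,\mathcal{L})$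 is the complex of abelian data on $\widehat X$ with $\underline{\widehat{\mathrm{Hom}}}^\bullet(F,\mathcal{L})_{\widehat p}=\mathrm{Hom}^\bullet(F_p,\mathcal{L}_p)$, and for $\widehat p\le\widehat q$ (i.e. $q\le p$) restriction map the composite $\mathrm{Hom}^\bullet(F_p,\mathcal{L}_p)\to\mathrm{Hom}^\bullet(F_q,\mathcal{L}_p)\xleftarrow{\ \sim\ }\mathrm{Hom}^\bullet(F_q,\mathcal{L}_q)$, induced by $F_q\to F_p$ and the isomorphism $\mathcal{L}_q\cong\mathcal{L}_p$ (the second arrow being inverted). Its derived functor is $\mathbb{L}\underline{\widehat{\mathrm{Hom}}}^\bullet(F,\mathcal{L}):=\underline{\widehat{\mathrm{Hom}}}^\bullet(P,\mathcal{L})$, where $P\to F$ is a ($K$-)projective resolution. The same construction applies on $\widehat X$. *)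

theory Defs
  imports
    "HOL-Algebra.Coset"
    "HOL-Analysis.Abstract_Topology"
    "HOL-Library.Infinite_Typeclass"
begin

definition spec_le :: "'x topology \<Rightarrow> 'x \<Rightarrow> 'x \<Rightarrow> bool" where
  "spec_le X p q \<longleftrightarrow>
     p \<in> topspace X \<and> q \<in> topspace X \<and> X closure_of {p} \<subseteq> X closure_of {q}"

text \<open>The closed sets of a finite space form a topology; this is false for general spaces.\<close>

definition dual_space :: "'x topology \<Rightarrow> 'x topology" where
  "dual_space X = topology (closedin X)"

lemma openin_dual_space:
  assumes "finite (topspace X)"
  shows "openin (dual_space X) U \<longleftrightarrow> closedin X U"
proof -
  have "closedin X (\<Union>\<K>)" if "\<forall>K\<in>\<K>. closedin X K" for \<K>
  proof (rule closedin_Union)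
    have "\<K> \<subseteq> Pow (topspace X)"
      using that closedin_subset by blast
    then show "finite \<K>"
      using assms finite_subset by blast
  qed (use that in blast)
  then have "istopology (closedin X)"
    unfolding istopology_def by (auto simp: closedin_Int)
  then show ?thesis
    by (simp add: dual_space_def)
qed

lemma topspace_dual_space:
  assumes "finite (topspace X)"
  shows "topspace (dual_space X) = topspace X"
  by (metis assms closedin_subset closedin_topspace openin_dual_space openin_subset
      openin_topspace subset_antisym)

lemma dual_space_dual_space:
  assumes "finite (topspace X)"
  shows "dual_space (dual_space X) = X"
proof (rule topology_eq[THEN iffD2], rule allI)
  fix S
  show "openin (dual_space (dual_space X)) S \<longleftrightarrow> openin X S"
    using assms
    by (simp add: openin_dual_space topspace_dual_space closedin_def)
      (meson Diff_subset closedin_def double_diff openin_closedin_eq openin_subset subset_refl)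
qed

lemma openin_iff_up_closed:
  assumes "finite (topspace X)"
  shows "openin X U \<longleftrightarrow> U \<subseteq> topspace X \<and> (\<forall>p q. p \<in> U \<longrightarrow> spec_le X p q \<longrightarrow> q \<in> U)"
proof safe
  show "x \<in> topspace X" if "openin X U" "x \<in> U" for x
    using that openin_subset by blast
  show "q \<in> U" if U: "openin X U" "p \<in> U" "spec_le X p q" for p q
  proof -
    have "p \<in> X closure_of {q}"
      using U(3) closure_of_subset[of "{p}" X] by (auto simp: spec_le_def)
    then show ?thesis
      using U by (auto simp: in_closure_of)
  qed
next
  assume U: "U \<subseteq> topspace X" and up: "\<forall>p q. p \<in> U \<longrightarrow> spec_le X p q \<longrightarrow> q \<in> U"
  let ?C = "\<Union>q\<in>topspace X - U. X closure_of {q}"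
  have "closedin X ?C"
    using assms by (intro closedin_Union) auto
  moreover have "?C = topspace X - U"
  proof
    show "topspace X - U \<subseteq> ?C"
      using closure_of_subset[of "{_}" X] by fastforce
    have "p \<notin> U" if "q \<in> topspace X - U" "p \<in> X closure_of {q}" for p q
    proof -
      have "X closure_of {p} \<subseteq> X closure_of {q}"
        using that by (intro closure_of_minimal) auto
      then show ?thesis
        using that up closure_of_subset_topspace[of X "{q}"] by (auto simp: spec_le_def)
    qed
    then show "?C \<subseteq> topspace X - U"
      using closure_of_subset_topspace by fastforce
  qed
  ultimately show "openin X U"
    using U by (metis openin_closedin_eq)
qed

lemma spec_le_iff_openin:
  "spec_le X p q \<longleftrightarrow>
     p \<in> topspace X \<and> q \<in> topspace X \<and> (\<forall>U. openin X U \<longrightarrow> p \<in> U \<longrightarrow> q \<in> U)"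
proof -
  have "X closure_of {p} \<subseteq> X closure_of {q} \<longleftrightarrow> p \<in> X closure_of {q}" if "p \<in> topspace X"
    using that closure_of_minimal[of "{p}" "X closure_of {q}" X] closure_of_subset[of "{p}" X]
    by auto
  then show ?thesis
    by (auto simp: spec_le_def in_closure_of)
qed

lemma spec_le_dual_space:
  assumes "finite (topspace X)"
  shows "spec_le (dual_space X) p q \<longleftrightarrow> spec_le X q p"
proof -
  have "(\<forall>U. closedin X U \<longrightarrow> p \<in> U \<longrightarrow> q \<in> U) \<longleftrightarrow> (\<forall>U. openin X U \<longrightarrow> q \<in> U \<longrightarrow> p \<in> U)"
    if "p \<in> topspace X" "q \<in> topspace X"
  proof
    show "\<forall>U. openin X U \<longrightarrow> q \<in> U \<longrightarrow> p \<in> U" if "\<forall>U. closedin X U \<longrightarrow> p \<in> U \<longrightarrow> q \<in> U"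
      using that \<open>p \<in> _\<close> \<open>q \<in> _\<close>
      by (metis DiffD2 DiffI closedin_diff closedin_topspace)
    show "\<forall>U. closedin X U \<longrightarrow> p \<in> U \<longrightarrow> q \<in> U" if "\<forall>U. openin X U \<longrightarrow> q \<in> U \<longrightarrow> p \<in> U"
      using that \<open>p \<in> _\<close> \<open>q \<in> _\<close>
      by (metis DiffD2 DiffI closedin_def)
  qed
  then show ?thesis
    using assms
    by (auto simp: spec_le_iff_openin openin_dual_space topspace_dual_space)
qed

text \<open>
  Abelian groups are the \<open>comm_group\<close>s of HOL-Algebra, hence written multiplicatively.
  Only the values of a record at points of the space (and at elements of the carriers) matter.
\<close>

record ('x, 'a) ab_data =
  sec :: "'x \<Rightarrow> 'a monoid"
  res :: "'x \<Rightarrow> 'x \<Rightarrow> 'a \<Rightarrow> 'a"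

definition abelian_data :: "'x topology \<Rightarrow> ('x, 'a) ab_data \<Rightarrow> bool" where
  "abelian_data X F \<longleftrightarrow>
     (\<forall>p\<in>topspace X. comm_group (sec F p)) \<and>
     (\<forall>p q. spec_le X p q \<longrightarrow> res F p q \<in> hom (sec F p) (sec F q)) \<and>
     (\<forall>p\<in>topspace X. \<forall>x\<in>carrier (sec F p). res F p p x = x) \<and>
     (\<forall>p q r. spec_le X p q \<longrightarrow> spec_le X q r \<longrightarrow>
        (\<forall>x\<in>carrier (sec F p). res F q r (res F p q x) = res F p r x))"

definition data_hom :: "'x topology \<Rightarrow> ('x, 'a) ab_data \<Rightarrow> ('x, 'b) ab_data \<Rightarrow> ('x \<Rightarrow> 'a \<Rightarrow> 'b) set" where
  "data_hom X F G = {f.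
     (\<forall>p\<in>topspace X. f p \<in> hom (sec F p) (sec G p)) \<and>
     (\<forall>p q. spec_le X p q \<longrightarrow>
        (\<forall>x\<in>carrier (sec F p). f q (res F p q x) = res G p q (f p x)))}"

definition locally_constant :: "'x topology \<Rightarrow> ('x, 'a) ab_data \<Rightarrow> bool" where
  "locally_constant X L \<longleftrightarrow> abelian_data X L \<and>
     (\<forall>p q. spec_le X p q \<longrightarrow> res L p q \<in> iso (sec L p) (sec L q))"

definition dual_data :: "('x, 'a) ab_data \<Rightarrow> ('x, 'a) ab_data" where
  "dual_data L = \<lparr>sec = sec L, res = (\<lambda>p q. inv_into (carrier (sec L q)) (res L q p))\<rparr>"

record ('x, 'a) data_complex =
  deg :: "int \<Rightarrow> ('x, 'a) ab_data"
  diff :: "int \<Rightarrow> 'x \<Rightarrow> 'a \<Rightarrow> 'a"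

abbreviation grp :: "('x, 'a) data_complex \<Rightarrow> int \<Rightarrow> 'x \<Rightarrow> 'a monoid" where
  "grp K n p \<equiv> sec (deg K n) p"

definition complex_on :: "'x topology \<Rightarrow> ('x, 'a) data_complex \<Rightarrow> bool" where
  "complex_on X K \<longleftrightarrow>
     (\<forall>n. abelian_data X (deg K n)) \<and>
     (\<forall>n. diff K n \<in> data_hom X (deg K n) (deg K (n + 1))) \<and>
     (\<forall>n. \<forall>p\<in>topspace X. \<forall>x\<in>carrier (grp K n p).
        diff K (n + 1) p (diff K n p x) = \<one>\<^bsub>grp K (n + 1 + 1) p\<^esub>)"

definition locally_constant_complex :: "'x topology \<Rightarrow> ('x, 'a) data_complex \<Rightarrow> bool" where
  "locally_constant_complex X L \<longleftrightarrow> complex_on X L \<and> (\<forall>n. locally_constant X (deg L n))"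

definition dual_complex :: "('x, 'a) data_complex \<Rightarrow> ('x, 'a) data_complex" where
  "dual_complex L = \<lparr>deg = (\<lambda>n. dual_data (deg L n)), diff = diff L\<rparr>"

definition chain_maps ::
  "'x topology \<Rightarrow> ('x, 'a) data_complex \<Rightarrow> ('x, 'b) data_complex \<Rightarrow> (int \<Rightarrow> 'x \<Rightarrow> 'a \<Rightarrow> 'b) set" where
  "chain_maps X A B = {f.
     (\<forall>n. f n \<in> data_hom X (deg A n) (deg B n)) \<and>
     (\<forall>n. \<forall>p\<in>topspace X. \<forall>x\<in>carrier (grp A n p).
        f (n + 1) p (diff A n p x) = diff B n p (f n p x))}"

definition id_map :: "int \<Rightarrow> 'x \<Rightarrow> 'a \<Rightarrow> 'a" where
  "id_map = (\<lambda>n p x. x)"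

definition comp_map ::
  "(int \<Rightarrow> 'x \<Rightarrow> 'b \<Rightarrow> 'c) \<Rightarrow> (int \<Rightarrow> 'x \<Rightarrow> 'a \<Rightarrow> 'b) \<Rightarrow> int \<Rightarrow> 'x \<Rightarrow> 'a \<Rightarrow> 'c"  (infixl \<open>\<circ>\<^sub>c\<close> 55) where
  "g \<circ>\<^sub>c f = (\<lambda>n p x. g n p (f n p x))"

definition homotopic ::
  "'x topology \<Rightarrow> ('x, 'a) data_complex \<Rightarrow> ('x, 'b) data_complex \<Rightarrow>
     (int \<Rightarrow> 'x \<Rightarrow> 'a \<Rightarrow> 'b) \<Rightarrow> (int \<Rightarrow> 'x \<Rightarrow> 'a \<Rightarrow> 'b) \<Rightarrow> bool" where
  "homotopic X A B f g \<longleftrightarrow> (\<exists>h.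
     (\<forall>n. h n \<in> data_hom X (deg A n) (deg B (n - 1))) \<and>
     (\<forall>n. \<forall>p\<in>topspace X. \<forall>x\<in>carrier (grp A n p).
        f n p x = g n p x \<otimes>\<^bsub>grp B n p\<^esub>
          (diff B (n - 1) p (h n p x) \<otimes>\<^bsub>grp B n p\<^esub> h (n + 1) p (diff A n p x))))"

text \<open>
  Kernels, cokernels and exactness of abelian data are computed pointwise, so the cohomology
  data is given by its values at the points.
\<close>

definition cocycles :: "('x, 'a) data_complex \<Rightarrow> int \<Rightarrow> 'x \<Rightarrow> 'a set" where
  "cocycles K n p = kernel (grp K n p) (grp K (n + 1) p) (diff K n p)"

definition coboundaries :: "('x, 'a) data_complex \<Rightarrow> int \<Rightarrow> 'x \<Rightarrow> 'a set" where
  "coboundaries K n p = diff K (n - 1) p ` carrier (grp K (n - 1) p)"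

definition cohomology :: "('x, 'a) data_complex \<Rightarrow> int \<Rightarrow> 'x \<Rightarrow> 'a set monoid" where
  "cohomology K n p = (grp K n p)\<lparr>carrier := cocycles K n p\<rparr> Mod coboundaries K n p"

definition cohomology_map ::
  "('x, 'b) data_complex \<Rightarrow> (int \<Rightarrow> 'x \<Rightarrow> 'a \<Rightarrow> 'b) \<Rightarrow> int \<Rightarrow> 'x \<Rightarrow> 'a set \<Rightarrow> 'b set" where
  "cohomology_map B f n p C = coboundaries B n p <#>\<^bsub>grp B n p\<^esub> (f n p ` C)"

definition quasi_iso ::
  "'x topology \<Rightarrow> ('x, 'a) data_complex \<Rightarrow> ('x, 'b) data_complex \<Rightarrow> (int \<Rightarrow> 'x \<Rightarrow> 'a \<Rightarrow> 'b) \<Rightarrow> bool" where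
  "quasi_iso X A B f \<longleftrightarrow> f \<in> chain_maps X A B \<and>
     (\<forall>n. \<forall>p\<in>topspace X. cohomology_map B f n p \<in> iso (cohomology A n p) (cohomology B n p))"

definition acyclic_on :: "'x topology \<Rightarrow> ('x, 'a) data_complex \<Rightarrow> bool" where
  "acyclic_on X K \<longleftrightarrow> complex_on X K \<and> (\<forall>n. \<forall>p\<in>topspace X. cocycles K n p = coboundaries K n p)"

text \<open>
  A complex of abelian groups is a complex of abelian data on the one-point space; in this way
  a single construction gives both \<open>Hom\<^sup>\<bullet>\<close> of complexes of abelian data and \<open>Hom\<^sup>\<bullet>\<close> of the stalks.
\<close>

definition pt :: "unit topology" where
  "pt = discrete_topology UNIV"

definition stalk :: "('x, 'a) data_complex \<Rightarrow> 'x \<Rightarrow> (unit, 'a) data_complex" where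
  "stalk K p = \<lparr>deg = (\<lambda>n. \<lparr>sec = (\<lambda>_. grp K n p), res = (\<lambda>_ _ x. x)\<rparr>), diff = (\<lambda>n _. diff K n p)\<rparr>"

text \<open>
  \<open>Hom\<^sup>n(F, G) = \<Prod>i. Hom(F\<^sup>i, G\<^sup>i\<^sup>+\<^sup>n)\<close>. Since functions are total, the morphisms are made unique
  representatives by being \<open>undefined\<close> off the points of the space and off the carriers.
\<close>

definition Hom_group ::
  "'x topology \<Rightarrow> ('x, 'a) data_complex \<Rightarrow> ('x, 'b) data_complex \<Rightarrow> int \<Rightarrow> (int \<Rightarrow> 'x \<Rightarrow> 'a \<Rightarrow> 'b) monoid" where
  "Hom_group X F G n =
     \<lparr>carrier = {h. \<forall>i. h i \<in> data_hom X (deg F i) (deg G (i + n)) \<and>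
                       h i \<in> extensional (topspace X) \<and>
                       (\<forall>p\<in>topspace X. h i p \<in> extensional (carrier (grp F i p)))},
      mult = (\<lambda>h k i. \<lambda>p\<in>topspace X. \<lambda>x\<in>carrier (grp F i p). h i p x \<otimes>\<^bsub>grp G (i + n) p\<^esub> k i p x),
      one = (\<lambda>i. \<lambda>p\<in>topspace X. \<lambda>x\<in>carrier (grp F i p). \<one>\<^bsub>grp G (i + n) p\<^esub>)\<rparr>"

definition sign_pow :: "('a, 'm) monoid_scheme \<Rightarrow> int \<Rightarrow> 'a \<Rightarrow> 'a" where
  "sign_pow G n x = (if even n then x else inv\<^bsub>G\<^esub> x)"

text \<open>\<open>dh = d\<^sub>G \<circ> h - (-1)\<^sup>n h \<circ> d\<^sub>F\<close> for \<open>h\<close> of degree \<open>n\<close>.\<close>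

definition Hom_diff ::
  "'x topology \<Rightarrow> ('x, 'a) data_complex \<Rightarrow> ('x, 'b) data_complex \<Rightarrow> int \<Rightarrow>
     (int \<Rightarrow> 'x \<Rightarrow> 'a \<Rightarrow> 'b) \<Rightarrow> (int \<Rightarrow> 'x \<Rightarrow> 'a \<Rightarrow> 'b)" where
  "Hom_diff X F G n h = (\<lambda>i. \<lambda>p\<in>topspace X. \<lambda>x\<in>carrier (grp F i p).
     diff G (i + n) p (h i p x) \<otimes>\<^bsub>grp G (i + (n + 1)) p\<^esub>
     sign_pow (grp G (i + (n + 1)) p) (n + 1) (h (i + 1) p (diff F i p x)))"

definition Hom_complex ::
  "'x topology \<Rightarrow> ('x, 'a) data_complex \<Rightarrow> ('x, 'b) data_complex \<Rightarrow>
     (unit, int \<Rightarrow> 'x \<Rightarrow> 'a \<Rightarrow> 'b) data_complex" where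
  "Hom_complex X F G =
     \<lparr>deg = (\<lambda>n. \<lparr>sec = (\<lambda>_. Hom_group X F G n), res = (\<lambda>_ _ h. h)\<rparr>),
      diff = (\<lambda>n _. Hom_diff X F G n)\<rparr>"

text \<open>
  \<open>Hom_map X F a b\<close> is \<open>Hom\<^sup>\<bullet>(a, b): Hom\<^sup>\<bullet>(F', G) \<rightarrow> Hom\<^sup>\<bullet>(F, G')\<close> for \<open>a: F \<rightarrow> F'\<close> and \<open>b: G \<rightarrow> G'\<close>.
\<close>

definition Hom_map ::
  "'x topology \<Rightarrow> ('x, 'a) data_complex \<Rightarrow>
     (int \<Rightarrow> 'x \<Rightarrow> 'a \<Rightarrow> 'a2) \<Rightarrow> (int \<Rightarrow> 'x \<Rightarrow> 'b \<Rightarrow> 'b2) \<Rightarrow>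
     int \<Rightarrow> unit \<Rightarrow> (int \<Rightarrow> 'x \<Rightarrow> 'a2 \<Rightarrow> 'b) \<Rightarrow> (int \<Rightarrow> 'x \<Rightarrow> 'a \<Rightarrow> 'b2)" where
  "Hom_map X F a b = (\<lambda>n _ h i. \<lambda>p\<in>topspace X. \<lambda>x\<in>carrier (grp F i p).
     b (i + n) p (h i p (a i p x)))"

text \<open>
  For \<open>F\<close>, \<open>L\<close> on \<open>X\<close> the complex \<open>Hom_hat F L\<close> lives on the dual space: its restriction from
  \<open>p\<close> to \<open>q\<close> is used when \<open>q \<le> p\<close> in \<open>X\<close>, so that \<open>res F q p\<close> and \<open>res L q p\<close> are available.
\<close>

definition Hom_hat ::
  "('x, 'a) data_complex \<Rightarrow> ('x, 'c) data_complex \<Rightarrow> ('x, int \<Rightarrow> unit \<Rightarrow> 'a \<Rightarrow> 'c) data_complex" where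
  "Hom_hat F L =
     \<lparr>deg = (\<lambda>n.
        \<lparr>sec = (\<lambda>p. grp (Hom_complex pt (stalk F p) (stalk L p)) n ()),
         res = (\<lambda>p q h i u. \<lambda>x\<in>carrier (grp F i q).
           inv_into (carrier (grp L (i + n) q)) (res (deg L (i + n)) q p)
             (h i u (res (deg F i) q p x)))\<rparr>),
      diff = (\<lambda>n p. diff (Hom_complex pt (stalk F p) (stalk L p)) n ())\<rparr>"

definition Hom_hat_map ::
  "('x, 'a) data_complex \<Rightarrow> (int \<Rightarrow> 'x \<Rightarrow> 'a \<Rightarrow> 'a2) \<Rightarrow> (int \<Rightarrow> 'x \<Rightarrow> 'c \<Rightarrow> 'c2) \<Rightarrow>
     int \<Rightarrow> 'x \<Rightarrow> (int \<Rightarrow> unit \<Rightarrow> 'a2 \<Rightarrow> 'c) \<Rightarrow> (int \<Rightarrow> unit \<Rightarrow> 'a \<Rightarrow> 'c2)" where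
  "Hom_hat_map F a b = (\<lambda>n p. Hom_map pt (stalk F p) (\<lambda>i _. a i p) (\<lambda>i _. b i p) n ())"

text \<open>
  The morphisms \<open>A \<rightarrow> B\<close> in the derived category are the equivalence classes of roofs
  \<open>A \<leftarrow> C \<rightarrow> B\<close> whose left leg is a quasi-isomorphism. Complexes over different element types are
  allowed; the apex \<open>C\<close> is taken over the element type of the source \<open>A\<close>. For an infinite type and
  a finite space this is no restriction: every complex quasi-isomorphic to \<open>A\<close> receives a
  quasi-isomorphism from a K-projective resolution of \<open>A\<close>, and \<open>A\<close> has one of cardinality at most
  that of the type.
\<close>

type_synonym ('x, 'a, 'b) roof =
  "('x, 'a) data_complex \<times> (int \<Rightarrow> 'x \<Rightarrow> 'a \<Rightarrow> 'a) \<times> (int \<Rightarrow> 'x \<Rightarrow> 'a \<Rightarrow> 'b)"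

definition roofs ::
  "'x topology \<Rightarrow> ('x, 'a) data_complex \<Rightarrow> ('x, 'b) data_complex \<Rightarrow> ('x, 'a, 'b) roof set" where
  "roofs X A B = {(C, s, f). complex_on X C \<and> quasi_iso X C A s \<and> f \<in> chain_maps X C B}"

definition roof_rel ::
  "'x topology \<Rightarrow> ('x, 'a) data_complex \<Rightarrow> ('x, 'b) data_complex \<Rightarrow>
     (('x, 'a, 'b) roof \<times> ('x, 'a, 'b) roof) set" where
  "roof_rel X A B = {((C, s, f), (C', s', f')).
     (C, s, f) \<in> roofs X A B \<and> (C', s', f') \<in> roofs X A B \<and>
     (\<exists>(E :: ('x, 'a) data_complex) u v.
        complex_on X E \<and> u \<in> chain_maps X E C \<and> v \<in> chain_maps X E C' \<and>
        quasi_iso X E A (s \<circ>\<^sub>c u) \<and>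
        homotopic X E A (s \<circ>\<^sub>c u) (s' \<circ>\<^sub>c v) \<and> homotopic X E B (f \<circ>\<^sub>c u) (f' \<circ>\<^sub>c v))}"

definition D_class ::
  "'x topology \<Rightarrow> ('x, 'a) data_complex \<Rightarrow> ('x, 'b) data_complex \<Rightarrow>
     ('x, 'a, 'b) roof \<Rightarrow> ('x, 'a, 'b) roof set" where
  "D_class X A B r = roof_rel X A B `` {r}"

definition D_hom ::
  "'x topology \<Rightarrow> ('x, 'a) data_complex \<Rightarrow> ('x, 'b) data_complex \<Rightarrow> ('x, 'a, 'b) roof set set" where
  "D_hom X A B = roofs X A B // roof_rel X A B"

definition D_of_map ::
  "'x topology \<Rightarrow> ('x, 'a) data_complex \<Rightarrow> ('x, 'b) data_complex \<Rightarrow>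
     (int \<Rightarrow> 'x \<Rightarrow> 'a \<Rightarrow> 'b) \<Rightarrow> ('x, 'a, 'b) roof set" where
  "D_of_map X A B f = D_class X A B (A, id_map, f)"

text \<open>
  The composite of \<open>A \<leftarrow> K \<rightarrow> B\<close> and \<open>B \<leftarrow> K' \<rightarrow> C\<close> is the class of \<open>A \<leftarrow> H \<rightarrow> C\<close> for any
  \<open>K \<leftarrow> H \<rightarrow> K'\<close> with left leg a quasi-isomorphism that makes the square over \<open>B\<close> commute up to
  homotopy. As this class is the same for all representatives and all \<open>H\<close>, the union below is
  that class.
\<close>

definition D_comp ::
  "'x topology \<Rightarrow> ('x, 'a) data_complex \<Rightarrow> ('x, 'b) data_complex \<Rightarrow> ('x, 'c) data_complex \<Rightarrow>
     ('x, 'b, 'c) roof set \<Rightarrow> ('x, 'a, 'b) roof set \<Rightarrow> ('x, 'a, 'c) roof set" where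
  "D_comp X A B C \<psi> \<phi> = \<Union> {D_class X A C (H, s \<circ>\<^sub>c u, g \<circ>\<^sub>c v) | H u v s g.
     \<exists>K f K' t. (K, s, f) \<in> \<phi> \<and> (K', t, g) \<in> \<psi> \<and>
       complex_on X H \<and> quasi_iso X H K u \<and> v \<in> chain_maps X H K' \<and>
       homotopic X H B (f \<circ>\<^sub>c u) (t \<circ>\<^sub>c v)}"

definition D_iso ::
  "'x topology \<Rightarrow> ('x, 'a) data_complex \<Rightarrow> ('x, 'b) data_complex \<Rightarrow> ('x, 'a, 'b) roof set \<Rightarrow> bool" where
  "D_iso X A B \<phi> \<longleftrightarrow> \<phi> \<in> D_hom X A B \<and>
     (\<exists>\<psi>\<in>D_hom X B A. D_comp X A B A \<psi> \<phi> = D_of_map X A A id_map \<and>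
                    D_comp X B A B \<phi> \<psi> = D_of_map X B B id_map)"

text \<open>
  K-projectivity is tested on the acyclic complexes over the same element type. As this type is
  infinite (and in the applications the space is finite), this is the same as testing on all
  acyclic complexes: a morphism from \<open>P\<close> to an acyclic complex factors through an acyclic
  subcomplex of cardinality at most that of the type.
\<close>

definition K_projective :: "'x topology \<Rightarrow> ('x, 'a::infinite) data_complex \<Rightarrow> bool" where
  "K_projective X P \<longleftrightarrow> complex_on X P \<and>
     (\<forall>A :: ('x, 'a) data_complex. acyclic_on X A \<longrightarrow> acyclic_on pt (Hom_complex X P A))"

text \<open>A choice of a K-projective resolution \<open>snd (R F): fst (R F) \<rightarrow> F\<close> of every complex \<open>F\<close>.\<close>

type_synonym ('x, 'a) resolution =
  "('x, 'a) data_complex \<Rightarrow> ('x, 'a) data_complex \<times> (int \<Rightarrow> 'x \<Rightarrow> 'a \<Rightarrow> 'a)"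

definition K_projective_resolution :: "'x topology \<Rightarrow> ('x, 'a::infinite) resolution \<Rightarrow> bool" where
  "K_projective_resolution X R \<longleftrightarrow> (\<forall>F. complex_on X F \<longrightarrow>
     K_projective X (fst (R F)) \<and> quasi_iso X (fst (R F)) F (snd (R F)))"

definition RHom ::
  "'x topology \<Rightarrow> ('x, 'a) resolution \<Rightarrow> ('x, 'a) data_complex \<Rightarrow> ('x, 'b) data_complex \<Rightarrow>
     (unit, int \<Rightarrow> 'x \<Rightarrow> 'a \<Rightarrow> 'b) data_complex" where
  "RHom X R F G = Hom_complex X (fst (R F)) G"

definition LHom_hat ::
  "('x, 'a) resolution \<Rightarrow> ('x, 'a) data_complex \<Rightarrow> ('x, 'c) data_complex \<Rightarrow>
     ('x, int \<Rightarrow> unit \<Rightarrow> 'a \<Rightarrow> 'c) data_complex" where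
  "LHom_hat R F L = Hom_hat (fst (R F)) L"

text \<open>
  A morphism \<open>\<phi>: F \<rightarrow> F'\<close> of the derived category acts on \<open>RHom\<close> and \<open>LHom_hat\<close> through any
  chain map \<open>f\<close> between the chosen resolutions that represents it. Such an \<open>f\<close> exists and is
  unique up to homotopy.
\<close>

definition lifts ::
  "'x topology \<Rightarrow> ('x, 'a) resolution \<Rightarrow> ('x, 'a) data_complex \<Rightarrow> ('x, 'a) data_complex \<Rightarrow>
     ('x, 'a, 'a) roof set \<Rightarrow> (int \<Rightarrow> 'x \<Rightarrow> 'a \<Rightarrow> 'a) \<Rightarrow> bool" where
  "lifts X R F F' \<phi> f \<longleftrightarrow> f \<in> chain_maps X (fst (R F)) (fst (R F')) \<and>
     D_of_map X (fst (R F)) F' (snd (R F') \<circ>\<^sub>c f) =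
     D_comp X (fst (R F)) F F' \<phi> (D_of_map X (fst (R F)) F (snd (R F)))"

text \<open>
  \<open>RHom_map X R F a b\<close> is the morphism \<open>RHom(F', G) \<rightarrow> RHom(F, G')\<close>, and \<open>LHom_hat_map R F a b\<close>
  the morphism \<open>LHom_hat(F', L) \<rightarrow> LHom_hat(F, L')\<close>, induced by a lift \<open>a\<close> of a morphism \<open>F \<rightarrow> F'\<close>
  and a chain map \<open>b\<close> from \<open>G\<close> to \<open>G'\<close>, respectively from \<open>L\<close> to \<open>L'\<close>.
\<close>

definition RHom_map ::
  "'x topology \<Rightarrow> ('x, 'a) resolution \<Rightarrow> ('x, 'a) data_complex \<Rightarrow>
     (int \<Rightarrow> 'x \<Rightarrow> 'a \<Rightarrow> 'a) \<Rightarrow> (int \<Rightarrow> 'x \<Rightarrow> 'b \<Rightarrow> 'b2) \<Rightarrow>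
     int \<Rightarrow> unit \<Rightarrow> (int \<Rightarrow> 'x \<Rightarrow> 'a \<Rightarrow> 'b) \<Rightarrow> (int \<Rightarrow> 'x \<Rightarrow> 'a \<Rightarrow> 'b2)" where
  "RHom_map X R F a b = Hom_map X (fst (R F)) a b"

definition LHom_hat_map ::
  "('x, 'a) resolution \<Rightarrow> ('x, 'a) data_complex \<Rightarrow>
     (int \<Rightarrow> 'x \<Rightarrow> 'a \<Rightarrow> 'a) \<Rightarrow> (int \<Rightarrow> 'x \<Rightarrow> 'c \<Rightarrow> 'c2) \<Rightarrow>
     int \<Rightarrow> 'x \<Rightarrow> (int \<Rightarrow> unit \<Rightarrow> 'a \<Rightarrow> 'c) \<Rightarrow> (int \<Rightarrow> unit \<Rightarrow> 'a \<Rightarrow> 'c2)" where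
  "LHom_hat_map R F a b = Hom_hat_map (fst (R F)) a b"

end

theory Submission
  imports Defs "HOL-Library.Equipollence"
begin

text \<open>
  Write \<open>P\<close> and \<open>Q\<close> for the chosen resolutions of \<open>F\<close> and \<open>T\<close>. An element of degree \<open>n\<close> of either
  side is a family of biadditive maps \<open>Q\<^sup>i\<^sub>p \<times> P\<^sup>j\<^sub>p \<rightarrow> L\<^sup>i\<^sup>+\<^sup>j\<^sup>+\<^sup>n\<^sub>p\<close> with the same compatibility for
  \<open>p \<le> q\<close>, namely \<open>r(b(r x, y)) = b(x, r y)\<close> for \<open>x \<in> Q\<^sub>q\<close> and \<open>y \<in> P\<^sub>p\<close>. Exchanging the two arguments
  with the sign \<open>(-1)\<^sup>i\<^sup>j\<close> is therefore an isomorphism of complexes, strictly natural in \<open>P\<close>, \<open>Q\<close> and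
  \<open>L\<close>. That roofs compose as expected on honest chain maps is the calculus of fractions, where the
  Ore condition comes from homotopy pullbacks.
\<close>

section \<open>Abelian data and homotopies\<close>

text \<open>The restriction maps of the inner complex contain an inverse restriction of L, which
  hides the symmetry between the two arguments. Applying that restriction to both sides removes the
  inverse; this is where local constancy enters. The exponent i j is dictated by the differentials:
  passing from j to j + 1 has to change the sign by (-1)^i and passing from i to i + 1 by (-1)^j,
  and modulo 2 the solution vanishing at (0, 0) is i j.

  Two features of the encoding shape the rest. Total functions are controlled only at points and on
  carriers, so L agrees with its double dual only there, and naturality squares are checked only
  there; extensional representatives and \<open>D_of_map_cong\<close> turn this into equality of
  morphisms. Moreover a roof has its apex over the element type of its source, whereas a homotopy
  pullback lives over a product type. It is carried back along an injection, which is why infinite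
  types and comparisons of cardinality occur. For the two sides of the theorem that comparison is
  the exchange of function arguments.\<close>

lemma spec_le_in_topspace:
  "spec_le X p q \<Longrightarrow> p \<in> topspace X" "spec_le X p q \<Longrightarrow> q \<in> topspace X"
  by (auto simp: spec_le_def)

lemma abelian_data_comm_group:
  "abelian_data X F \<Longrightarrow> p \<in> topspace X \<Longrightarrow> comm_group (sec F p)"
  by (simp add: abelian_data_def)

lemma abelian_data_res_hom:
  "abelian_data X F \<Longrightarrow> spec_le X p q \<Longrightarrow> res F p q \<in> hom (sec F p) (sec F q)"
  by (simp add: abelian_data_def)

lemma abelian_data_res_closed:
  "abelian_data X F \<Longrightarrow> spec_le X p q \<Longrightarrow> x \<in> carrier (sec F p) \<Longrightarrow> res F p q x \<in> carrier (sec F q)"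
  by (auto simp: abelian_data_def hom_def)

lemma comm_group_hom_one:
  "comm_group G \<Longrightarrow> comm_group H \<Longrightarrow> h \<in> hom G H \<Longrightarrow> h \<one>\<^bsub>G\<^esub> = \<one>\<^bsub>H\<^esub>"
  by (simp add: comm_group_def hom_one)

lemma comm_group_hom_inv:
  assumes "comm_group G" "comm_group H" "h \<in> hom G H" "x \<in> carrier G"
  shows "h (inv\<^bsub>G\<^esub> x) = inv\<^bsub>H\<^esub> (h x)"
proof -
  interpret group_hom G H h
    using assms by (simp add: group_hom_def group_hom_axioms_def comm_group_def)
  show ?thesis
    using assms(4) by simp
qed

lemma data_homI:
  assumes "\<And>p. p \<in> topspace X \<Longrightarrow> f p \<in> hom (sec F p) (sec G p)"
    and "\<And>p q x. spec_le X p q \<Longrightarrow> x \<in> carrier (sec F p) \<Longrightarrow> f q (res F p q x) = res G p q (f p x)"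
  shows "f \<in> data_hom X F G"
  using assms by (simp add: data_hom_def)

lemma data_hom_hom: "f \<in> data_hom X F G \<Longrightarrow> p \<in> topspace X \<Longrightarrow> f p \<in> hom (sec F p) (sec G p)"
  by (simp add: data_hom_def)

lemma data_hom_res:
  "f \<in> data_hom X F G \<Longrightarrow> spec_le X p q \<Longrightarrow> x \<in> carrier (sec F p) \<Longrightarrow> f q (res F p q x) = res G p q (f p x)"
  by (simp add: data_hom_def)

lemma data_hom_closed:
  "f \<in> data_hom X F G \<Longrightarrow> p \<in> topspace X \<Longrightarrow> x \<in> carrier (sec F p) \<Longrightarrow> f p x \<in> carrier (sec G p)"
  by (auto simp: data_hom_def hom_def)

lemma data_hom_mult:
  "f \<in> data_hom X F G \<Longrightarrow> p \<in> topspace X \<Longrightarrow> x \<in> carrier (sec F p) \<Longrightarrow> y \<in> carrier (sec F p) \<Longrightarrow>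
     f p (x \<otimes>\<^bsub>sec F p\<^esub> y) = f p x \<otimes>\<^bsub>sec G p\<^esub> f p y"
  by (auto simp: data_hom_def hom_def)

lemma data_hom_one_eq:
  "abelian_data X F \<Longrightarrow> abelian_data X G \<Longrightarrow> f \<in> data_hom X F G \<Longrightarrow> p \<in> topspace X \<Longrightarrow>
     f p \<one>\<^bsub>sec F p\<^esub> = \<one>\<^bsub>sec G p\<^esub>"
  by (meson abelian_data_comm_group comm_group_hom_one data_hom_hom)

lemma data_hom_inv_eq:
  "abelian_data X F \<Longrightarrow> abelian_data X G \<Longrightarrow> f \<in> data_hom X F G \<Longrightarrow> p \<in> topspace X \<Longrightarrow>
     x \<in> carrier (sec F p) \<Longrightarrow> f p (inv\<^bsub>sec F p\<^esub> x) = inv\<^bsub>sec G p\<^esub> (f p x)"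
  by (meson abelian_data_comm_group comm_group_hom_inv data_hom_hom)

text \<open>Products and restrictions of elements of \<open>F\<close> stay in the carriers, where
  the two families agree. This is how representatives cut off outside the carriers are recognised as
  morphisms.\<close>

lemma data_hom_cong:
  assumes F: "abelian_data X F" and f: "f \<in> data_hom X F G"
    and eq: "\<And>p x. p \<in> topspace X \<Longrightarrow> x \<in> carrier (sec F p) \<Longrightarrow> g p x = f p x"
  shows "g \<in> data_hom X F G"
proof (rule data_homI)
  fix p assume p: "p \<in> topspace X"
  interpret comm_group "sec F p"
    using F p by (rule abelian_data_comm_group)
  show "g p \<in> hom (sec F p) (sec G p)"
    using data_hom_hom[OF f p] eq[OF p] by (auto simp: hom_def)
next
  fix p q x assume "spec_le X p q" "x \<in> carrier (sec F p)"
  then show "g q (res F p q x) = res G p q (g p x)"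
    using data_hom_res[OF f, of p q x] eq F
    by (simp add: spec_le_in_topspace abelian_data_res_closed)
qed

lemma data_hom_mult_hom:
  assumes G: "abelian_data X G" and f: "f \<in> data_hom X F G" and g: "g \<in> data_hom X F G"
  shows "(\<lambda>p x. f p x \<otimes>\<^bsub>sec G p\<^esub> g p x) \<in> data_hom X F G"
proof (rule data_homI)
  fix p assume p: "p \<in> topspace X"
  interpret comm_group "sec G p"
    using G p by (rule abelian_data_comm_group)
  show "(\<lambda>x. f p x \<otimes>\<^bsub>sec G p\<^esub> g p x) \<in> hom (sec F p) (sec G p)"
    using data_hom_closed[OF f p] data_hom_closed[OF g p]
    by (auto simp: hom_def data_hom_mult[OF f p] data_hom_mult[OF g p] m_ac)
next
  fix p q x assume pq: "spec_le X p q" and x: "x \<in> carrier (sec F p)"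
  show "f q (res F p q x) \<otimes>\<^bsub>sec G q\<^esub> g q (res F p q x) = res G p q (f p x \<otimes>\<^bsub>sec G p\<^esub> g p x)"
    using abelian_data_res_hom[OF G pq] data_hom_closed[OF f _ x] data_hom_closed[OF g _ x]
      spec_le_in_topspace(1)[OF pq]
    by (simp add: data_hom_res[OF f pq x] data_hom_res[OF g pq x] hom_mult)
qed

lemma data_hom_inv_hom:
  assumes G: "abelian_data X G" and f: "f \<in> data_hom X F G"
  shows "(\<lambda>p x. inv\<^bsub>sec G p\<^esub> f p x) \<in> data_hom X F G"
proof (rule data_homI)
  fix p assume p: "p \<in> topspace X"
  interpret comm_group "sec G p"
    using G p by (rule abelian_data_comm_group)
  show "(\<lambda>x. inv\<^bsub>sec G p\<^esub> f p x) \<in> hom (sec F p) (sec G p)"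
    using data_hom_closed[OF f p]
    by (auto simp: hom_def data_hom_mult[OF f p] inv_mult)
next
  fix p q x assume pq: "spec_le X p q" and x: "x \<in> carrier (sec F p)"
  show "inv\<^bsub>sec G q\<^esub> f q (res F p q x) = res G p q (inv\<^bsub>sec G p\<^esub> f p x)"
    using comm_group_hom_inv[OF _ _ abelian_data_res_hom[OF G pq]] abelian_data_comm_group[OF G]
      data_hom_closed[OF f _ x] spec_le_in_topspace[OF pq]
    by (simp add: data_hom_res[OF f pq x])
qed

lemma data_hom_trivial:
  assumes F: "abelian_data X F" and G: "abelian_data X G"
  shows "(\<lambda>p x. \<one>\<^bsub>sec G p\<^esub>) \<in> data_hom X F G"
proof (rule data_homI)
  fix p assume p: "p \<in> topspace X"
  interpret comm_group "sec G p"
    using G p by (rule abelian_data_comm_group)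
  show "(\<lambda>x. \<one>\<^bsub>sec G p\<^esub>) \<in> hom (sec F p) (sec G p)"
    by (auto simp: hom_def)
next
  fix p q x assume pq: "spec_le X p q"
  show "\<one>\<^bsub>sec G q\<^esub> = res G p q \<one>\<^bsub>sec G p\<^esub>"
    using comm_group_hom_one[OF _ _ abelian_data_res_hom[OF G pq]] abelian_data_comm_group[OF G]
      spec_le_in_topspace[OF pq] by simp
qed

lemma data_hom_compose:
  assumes f: "f \<in> data_hom X F G" and g: "g \<in> data_hom X G H"
  shows "(\<lambda>p x. g p (f p x)) \<in> data_hom X F H"
proof (rule data_homI)
  fix p assume p: "p \<in> topspace X"
  show "(\<lambda>x. g p (f p x)) \<in> hom (sec F p) (sec H p)"
    using hom_compose[OF data_hom_hom[OF f p] data_hom_hom[OF g p]] by (simp add: comp_def)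
next
  fix p q x assume pq: "spec_le X p q" and x: "x \<in> carrier (sec F p)"
  show "g q (f q (res F p q x)) = res H p q (g p (f p x))"
    using data_hom_res[OF f pq x] data_hom_res[OF g pq] data_hom_closed[OF f _ x]
      spec_le_in_topspace[OF pq] by simp
qed

lemma data_hom_id: "(\<lambda>p x. x) \<in> data_hom X F F"
  by (rule data_homI) (auto simp: hom_def)

section \<open>Complexes of abelian data\<close>

lemma complex_on_abelian_data: "complex_on X K \<Longrightarrow> abelian_data X (deg K n)"
  by (simp add: complex_on_def)

lemma complex_on_comm_group: "complex_on X K \<Longrightarrow> p \<in> topspace X \<Longrightarrow> comm_group (grp K n p)"
  by (rule abelian_data_comm_group[OF complex_on_abelian_data])

text \<open>The target degree is a variable tied by an equation, because degrees such as
  \<open>n - 1 + 1\<close> and \<open>n\<close> are equal without being syntactically the same.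
  Later rules about degrees follow this pattern.\<close>

lemma complex_on_diff_hom:
  "complex_on X K \<Longrightarrow> m = n + 1 \<Longrightarrow> diff K n \<in> data_hom X (deg K n) (deg K m)"
  by (simp add: complex_on_def)

lemma complex_on_diff_closed:
  "complex_on X K \<Longrightarrow> p \<in> topspace X \<Longrightarrow> m = n + 1 \<Longrightarrow> x \<in> carrier (grp K n p) \<Longrightarrow>
     diff K n p x \<in> carrier (grp K m p)"
  using complex_on_diff_hom data_hom_closed by fastforce

lemma complex_on_diff_mult:
  "complex_on X K \<Longrightarrow> p \<in> topspace X \<Longrightarrow> m = n \<Longrightarrow> x \<in> carrier (grp K n p) \<Longrightarrow>
     y \<in> carrier (grp K n p) \<Longrightarrow>
     diff K n p (x \<otimes>\<^bsub>grp K m p\<^esub> y) = diff K n p x \<otimes>\<^bsub>grp K (n + 1) p\<^esub> diff K n p y"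
  by (metis complex_on_diff_hom data_hom_mult)

lemma complex_on_diff_one:
  "complex_on X K \<Longrightarrow> p \<in> topspace X \<Longrightarrow> m = n \<Longrightarrow>
     diff K n p \<one>\<^bsub>grp K m p\<^esub> = \<one>\<^bsub>grp K (n + 1) p\<^esub>"
  by (metis complex_on_abelian_data complex_on_diff_hom data_hom_one_eq)

lemma complex_on_diff_inv:
  "complex_on X K \<Longrightarrow> p \<in> topspace X \<Longrightarrow> m = n \<Longrightarrow> x \<in> carrier (grp K n p) \<Longrightarrow>
     diff K n p (inv\<^bsub>grp K m p\<^esub> x) = inv\<^bsub>grp K (n + 1) p\<^esub> diff K n p x"
  by (metis complex_on_abelian_data complex_on_diff_hom data_hom_inv_eq)

lemma complex_on_diff_diff:
  "complex_on X K \<Longrightarrow> p \<in> topspace X \<Longrightarrow> m = n + 1 \<Longrightarrow> x \<in> carrier (grp K n p) \<Longrightarrow>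
     diff K m p (diff K n p x) = \<one>\<^bsub>grp K (m + 1) p\<^esub>"
  by (simp add: complex_on_def)

lemmas complex_on_diff_simps = complex_on_diff_closed complex_on_diff_mult complex_on_diff_one
  complex_on_diff_inv complex_on_diff_diff

section \<open>Chain maps\<close>

lemma chain_mapsI:
  assumes "\<And>n. f n \<in> data_hom X (deg A n) (deg B n)"
    and "\<And>n p x. p \<in> topspace X \<Longrightarrow> x \<in> carrier (grp A n p) \<Longrightarrow>
           f (n + 1) p (diff A n p x) = diff B n p (f n p x)"
  shows "f \<in> chain_maps X A B"
  using assms by (simp add: chain_maps_def)

lemma chain_maps_data_hom: "f \<in> chain_maps X A B \<Longrightarrow> f n \<in> data_hom X (deg A n) (deg B n)"
  by (simp add: chain_maps_def)

lemma chain_maps_diff: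
  "f \<in> chain_maps X A B \<Longrightarrow> p \<in> topspace X \<Longrightarrow> m = n + 1 \<Longrightarrow> x \<in> carrier (grp A n p) \<Longrightarrow>
     f m p (diff A n p x) = diff B n p (f n p x)"
  by (simp add: chain_maps_def)

lemma chain_maps_closed:
  "f \<in> chain_maps X A B \<Longrightarrow> p \<in> topspace X \<Longrightarrow> x \<in> carrier (grp A n p) \<Longrightarrow>
     f n p x \<in> carrier (grp B n p)"
  by (meson chain_maps_data_hom data_hom_closed)

lemma chain_maps_mult:
  "f \<in> chain_maps X A B \<Longrightarrow> p \<in> topspace X \<Longrightarrow> x \<in> carrier (grp A n p) \<Longrightarrow> y \<in> carrier (grp A n p) \<Longrightarrow>
     f n p (x \<otimes>\<^bsub>grp A n p\<^esub> y) = f n p x \<otimes>\<^bsub>grp B n p\<^esub> f n p y"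
  by (meson chain_maps_data_hom data_hom_mult)

lemma chain_maps_one:
  "complex_on X A \<Longrightarrow> complex_on X B \<Longrightarrow> f \<in> chain_maps X A B \<Longrightarrow> p \<in> topspace X \<Longrightarrow>
     f n p \<one>\<^bsub>grp A n p\<^esub> = \<one>\<^bsub>grp B n p\<^esub>"
  by (meson chain_maps_data_hom complex_on_abelian_data data_hom_one_eq)

lemma chain_maps_inv:
  "complex_on X A \<Longrightarrow> complex_on X B \<Longrightarrow> f \<in> chain_maps X A B \<Longrightarrow> p \<in> topspace X \<Longrightarrow>
     x \<in> carrier (grp A n p) \<Longrightarrow> f n p (inv\<^bsub>grp A n p\<^esub> x) = inv\<^bsub>grp B n p\<^esub> (f n p x)"
  by (meson chain_maps_data_hom complex_on_abelian_data data_hom_inv_eq)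

lemma chain_maps_comp:
  assumes "f \<in> chain_maps X A B" "g \<in> chain_maps X B C"
  shows "g \<circ>\<^sub>c f \<in> chain_maps X A C"
  unfolding comp_map_def using assms
  by (intro chain_mapsI data_hom_compose[OF chain_maps_data_hom[OF assms(1)] chain_maps_data_hom])
    (simp_all add: chain_maps_data_hom chain_maps_diff chain_maps_closed)

lemma chain_maps_id: "id_map \<in> chain_maps X A A"
  by (rule chain_mapsI) (auto simp: id_map_def data_hom_id)

lemma id_comp_map [simp]: "id_map \<circ>\<^sub>c f = f" and comp_map_id [simp]: "f \<circ>\<^sub>c id_map = f"
  by (simp_all add: comp_map_def id_map_def)

lemma comp_map_assoc: "(h \<circ>\<^sub>c g) \<circ>\<^sub>c f = h \<circ>\<^sub>c (g \<circ>\<^sub>c f)"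
  by (simp add: comp_map_def)

section \<open>Chain homotopies\<close>

lemma homotopicI:
  assumes "\<And>n. h n \<in> data_hom X (deg A n) (deg B (n - 1))"
    and "\<And>n p x. p \<in> topspace X \<Longrightarrow> x \<in> carrier (grp A n p) \<Longrightarrow>
        f n p x = g n p x \<otimes>\<^bsub>grp B n p\<^esub>
          (diff B (n - 1) p (h n p x) \<otimes>\<^bsub>grp B n p\<^esub> h (n + 1) p (diff A n p x))"
  shows "homotopic X A B f g"
  using assms unfolding homotopic_def by blast

lemma homotopicE:
  assumes "homotopic X A B f g"
  obtains h where "\<And>n. h n \<in> data_hom X (deg A n) (deg B (n - 1))"
    and "\<And>n p x. p \<in> topspace X \<Longrightarrow> x \<in> carrier (grp A n p) \<Longrightarrow>
        f n p x = g n p x \<otimes>\<^bsub>grp B n p\<^esub>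
          (diff B (n - 1) p (h n p x) \<otimes>\<^bsub>grp B n p\<^esub> h (n + 1) p (diff A n p x))"
  using assms unfolding homotopic_def by blast

text \<open>The zero homotopy does it. Agreement is asked for on carriers only, so maps that differ
  as total functions are covered.\<close>

lemma homotopic_of_eq:
  assumes A: "complex_on X A" and B: "complex_on X B" and g: "g \<in> chain_maps X A B"
    and eq: "\<And>n p x. p \<in> topspace X \<Longrightarrow> x \<in> carrier (grp A n p) \<Longrightarrow> f n p x = g n p x"
  shows "homotopic X A B f g"
proof (rule homotopicI)
  show "(\<lambda>p x. \<one>\<^bsub>grp B (n - 1) p\<^esub>) \<in> data_hom X (deg A n) (deg B (n - 1))" for n
    using A B by (intro data_hom_trivial complex_on_abelian_data)
  fix n p x assume p: "p \<in> topspace X" and x: "x \<in> carrier (grp A n p)"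
  interpret comm_group "grp B n p"
    using B p by (rule complex_on_comm_group)
  show "f n p x = g n p x \<otimes>\<^bsub>grp B n p\<^esub>
     (diff B (n - 1) p \<one>\<^bsub>grp B (n - 1) p\<^esub> \<otimes>\<^bsub>grp B n p\<^esub> \<one>\<^bsub>grp B (n + 1 - 1) p\<^esub>)"
    using eq[OF p x] chain_maps_closed[OF g p x] complex_on_diff_one[OF B p refl, of "n - 1"] by simp
qed

lemmas homotopic_refl = homotopic_of_eq[OF _ _ _ refl]

lemma homotopic_sym:
  assumes A: "complex_on X A" and B: "complex_on X B" and g: "g \<in> chain_maps X A B"
    and fg: "homotopic X A B f g"
  shows "homotopic X A B g f"
proof -
  obtain h where h: "\<And>n. h n \<in> data_hom X (deg A n) (deg B (n - 1))"
    and eq: "\<And>n p x. p \<in> topspace X \<Longrightarrow> x \<in> carrier (grp A n p) \<Longrightarrow>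
        f n p x = g n p x \<otimes>\<^bsub>grp B n p\<^esub>
          (diff B (n - 1) p (h n p x) \<otimes>\<^bsub>grp B n p\<^esub> h (n + 1) p (diff A n p x))"
    by (rule homotopicE[OF fg]) (rule that)
  show ?thesis
  proof (rule homotopicI)
    show "(\<lambda>p x. inv\<^bsub>grp B (n - 1) p\<^esub> h n p x) \<in> data_hom X (deg A n) (deg B (n - 1))" for n
      using B h by (intro data_hom_inv_hom complex_on_abelian_data)
    fix n p x assume p: "p \<in> topspace X" and x: "x \<in> carrier (grp A n p)"
    interpret comm_group "grp B n p"
      using B p by (rule complex_on_comm_group)
    have c: "g n p x \<in> carrier (grp B n p)" "h n p x \<in> carrier (grp B (n - 1) p)"
      "diff B (n - 1) p (h n p x) \<in> carrier (grp B n p)"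
      "h (n + 1) p (diff A n p x) \<in> carrier (grp B n p)"
      using p x A B g data_hom_closed[OF h p, of _ n] data_hom_closed[OF h p, of _ "n + 1"]
      by (auto simp: chain_maps_closed complex_on_diff_closed)
    show "g n p x = f n p x \<otimes>\<^bsub>grp B n p\<^esub>
     (diff B (n - 1) p (inv\<^bsub>grp B (n - 1) p\<^esub> h n p x) \<otimes>\<^bsub>grp B n p\<^esub>
        inv\<^bsub>grp B (n + 1 - 1) p\<^esub> h (n + 1) p (diff A n p x))"
      using c p x B by (simp add: eq complex_on_diff_inv inv_mult[symmetric] m_assoc)
  qed
qed

lemma homotopic_trans:
  assumes A: "complex_on X A" and B: "complex_on X B" and k: "k \<in> chain_maps X A B"
    and fg: "homotopic X A B f g" and gk: "homotopic X A B g k"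
  shows "homotopic X A B f k"
proof -
  obtain h where h: "\<And>n. h n \<in> data_hom X (deg A n) (deg B (n - 1))"
    and eq: "\<And>n p x. p \<in> topspace X \<Longrightarrow> x \<in> carrier (grp A n p) \<Longrightarrow>
        f n p x = g n p x \<otimes>\<^bsub>grp B n p\<^esub>
          (diff B (n - 1) p (h n p x) \<otimes>\<^bsub>grp B n p\<^esub> h (n + 1) p (diff A n p x))"
    by (rule homotopicE[OF fg]) (rule that)
  obtain h' where h': "\<And>n. h' n \<in> data_hom X (deg A n) (deg B (n - 1))"
    and eq': "\<And>n p x. p \<in> topspace X \<Longrightarrow> x \<in> carrier (grp A n p) \<Longrightarrow>
        g n p x = k n p x \<otimes>\<^bsub>grp B n p\<^esub>
          (diff B (n - 1) p (h' n p x) \<otimes>\<^bsub>grp B n p\<^esub> h' (n + 1) p (diff A n p x))"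
    by (rule homotopicE[OF gk]) (rule that)
  show ?thesis
  proof (rule homotopicI)
    show "(\<lambda>p x. h n p x \<otimes>\<^bsub>grp B (n - 1) p\<^esub> h' n p x) \<in> data_hom X (deg A n) (deg B (n - 1))" for n
      using B h h' by (intro data_hom_mult_hom complex_on_abelian_data)
    fix n p x assume p: "p \<in> topspace X" and x: "x \<in> carrier (grp A n p)"
    interpret comm_group "grp B n p"
      using B p by (rule complex_on_comm_group)
    have c: "k n p x \<in> carrier (grp B n p)" "h n p x \<in> carrier (grp B (n - 1) p)"
      "diff B (n - 1) p (h n p x) \<in> carrier (grp B n p)"
      "h (n + 1) p (diff A n p x) \<in> carrier (grp B n p)"
      "h' n p x \<in> carrier (grp B (n - 1) p)" "diff B (n - 1) p (h' n p x) \<in> carrier (grp B n p)"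
      "h' (n + 1) p (diff A n p x) \<in> carrier (grp B n p)"
      using p x A B k data_hom_closed[OF h p, of _ n] data_hom_closed[OF h p, of _ "n + 1"]
        data_hom_closed[OF h' p, of _ n] data_hom_closed[OF h' p, of _ "n + 1"]
      by (auto simp: chain_maps_closed complex_on_diff_closed)
    show "f n p x = k n p x \<otimes>\<^bsub>grp B n p\<^esub>
     (diff B (n - 1) p (h n p x \<otimes>\<^bsub>grp B (n - 1) p\<^esub> h' n p x) \<otimes>\<^bsub>grp B n p\<^esub>
       (h (n + 1) p (diff A n p x) \<otimes>\<^bsub>grp B (n + 1 - 1) p\<^esub> h' (n + 1) p (diff A n p x)))"
      using c p x B by (simp add: eq eq' complex_on_diff_mult m_ac)
  qed
qed

lemma homotopic_comp_left:
  assumes A: "complex_on X A" and B: "complex_on X B" and g: "g \<in> chain_maps X A B"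
    and k: "k \<in> chain_maps X B C" and fg: "homotopic X A B f g"
  shows "homotopic X A C (k \<circ>\<^sub>c f) (k \<circ>\<^sub>c g)"
proof -
  obtain h where h: "\<And>n. h n \<in> data_hom X (deg A n) (deg B (n - 1))"
    and eq: "\<And>n p x. p \<in> topspace X \<Longrightarrow> x \<in> carrier (grp A n p) \<Longrightarrow>
        f n p x = g n p x \<otimes>\<^bsub>grp B n p\<^esub>
          (diff B (n - 1) p (h n p x) \<otimes>\<^bsub>grp B n p\<^esub> h (n + 1) p (diff A n p x))"
    by (rule homotopicE[OF fg]) (rule that)
  show ?thesis
  proof (rule homotopicI)
    show "(\<lambda>p x. k (n - 1) p (h n p x)) \<in> data_hom X (deg A n) (deg C (n - 1))" for n
      using data_hom_compose[OF h chain_maps_data_hom[OF k]] .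
    fix n p x assume p: "p \<in> topspace X" and x: "x \<in> carrier (grp A n p)"
    interpret comm_group "grp B n p"
      using B p by (rule complex_on_comm_group)
    have c: "g n p x \<in> carrier (grp B n p)" "h n p x \<in> carrier (grp B (n - 1) p)"
      "diff B (n - 1) p (h n p x) \<in> carrier (grp B n p)"
      "h (n + 1) p (diff A n p x) \<in> carrier (grp B n p)"
      using p x A B g data_hom_closed[OF h p, of _ n] data_hom_closed[OF h p, of _ "n + 1"]
      by (auto simp: chain_maps_closed complex_on_diff_closed)
    show "(k \<circ>\<^sub>c f) n p x = (k \<circ>\<^sub>c g) n p x \<otimes>\<^bsub>grp C n p\<^esub>
     (diff C (n - 1) p (k (n - 1) p (h n p x)) \<otimes>\<^bsub>grp C n p\<^esub>
        k (n + 1 - 1) p (h (n + 1) p (diff A n p x)))"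
      using c p x B k by (simp add: eq comp_map_def chain_maps_mult chain_maps_diff[symmetric, of _ _ _ _ _ n])
  qed
qed

lemma homotopic_comp_right:
  assumes k: "k \<in> chain_maps X A' A" and fg: "homotopic X A B f g"
  shows "homotopic X A' B (f \<circ>\<^sub>c k) (g \<circ>\<^sub>c k)"
proof -
  obtain h where h: "\<And>n. h n \<in> data_hom X (deg A n) (deg B (n - 1))"
    and eq: "\<And>n p x. p \<in> topspace X \<Longrightarrow> x \<in> carrier (grp A n p) \<Longrightarrow>
        f n p x = g n p x \<otimes>\<^bsub>grp B n p\<^esub>
          (diff B (n - 1) p (h n p x) \<otimes>\<^bsub>grp B n p\<^esub> h (n + 1) p (diff A n p x))"
    by (rule homotopicE[OF fg]) (rule that)
  show ?thesis
  proof (rule homotopicI)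
    show "(\<lambda>p x. h n p (k n p x)) \<in> data_hom X (deg A' n) (deg B (n - 1))" for n
      using data_hom_compose[OF chain_maps_data_hom[OF k] h] .
    fix n p x assume p: "p \<in> topspace X" and x: "x \<in> carrier (grp A' n p)"
    show "(f \<circ>\<^sub>c k) n p x = (g \<circ>\<^sub>c k) n p x \<otimes>\<^bsub>grp B n p\<^esub>
     (diff B (n - 1) p (h n p (k n p x)) \<otimes>\<^bsub>grp B n p\<^esub>
        h (n + 1) p (k (n + 1) p (diff A' n p x)))"
      using p x k by (simp add: eq comp_map_def chain_maps_closed chain_maps_diff)
  qed
qed

section \<open>Quasi-isomorphisms\<close>

lemma (in group) r_coset_eq_iff:
  assumes "subgroup H G" "a \<in> carrier G" "b \<in> carrier G"
  shows "H #> a = H #> b \<longleftrightarrow> a \<otimes> inv b \<in> H"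
proof -
  have "H #> a = H #> b \<longleftrightarrow> a \<in> H #> b"
    using assms rcos_self repr_independence by metis
  also have "\<dots> \<longleftrightarrow> a \<otimes> inv b \<in> H"
    using assms subgroup.rcos_module[OF assms(1) is_group] by blast
  finally show ?thesis .
qed

lemma (in comm_group) comm_group_subgroup:
  assumes "subgroup H G"
  shows "comm_group (G\<lparr>carrier := H\<rparr>)"
  using subgroup.subgroup_is_group[OF assms is_group] subgroup.mem_carrier[OF assms]
  by (intro group.group_comm_groupI) (simp_all add: m_comm)

text \<open>Since \<open>f\<close> carries \<open>N\<close> into \<open>M\<close>, the map sends the
  coset of \<open>x\<close> to the coset of \<open>f x\<close>; the two conjuncts are then
  injectivity and surjectivity, expressed without cosets.\<close>

lemma FactGroup_map_iso_iff:
  assumes G: "comm_group G" and H: "comm_group H" and N: "subgroup N G" and M: "subgroup M H"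
    and f: "f \<in> hom G H" and fN: "f ` N \<subseteq> M"
  shows "(\<lambda>C. M <#>\<^bsub>H\<^esub> f ` C) \<in> iso (G Mod N) (H Mod M) \<longleftrightarrow>
    (\<forall>x\<in>carrier G. f x \<in> M \<longrightarrow> x \<in> N) \<and>
    (\<forall>y\<in>carrier H. \<exists>x\<in>carrier G. \<exists>m\<in>M. y = m \<otimes>\<^bsub>H\<^esub> f x)"
proof -
  interpret G: comm_group G by (rule G)
  interpret H: comm_group H by (rule H)
  interpret group_hom G H f
    using f by unfold_locales
  interpret N: normal N G
    using N by (rule G.subgroup_imp_normal)
  interpret M: normal M H
    using M by (rule H.subgroup_imp_normal)
  let ?\<phi> = "\<lambda>C. M <#>\<^bsub>H\<^esub> f ` C"
  have val: "?\<phi> (N #>\<^bsub>G\<^esub> x) = M #>\<^bsub>H\<^esub> f x" if x: "x \<in> carrier G" for x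
  proof
    show "?\<phi> (N #>\<^bsub>G\<^esub> x) \<subseteq> M #>\<^bsub>H\<^esub> f x"
    proof
      fix y assume "y \<in> ?\<phi> (N #>\<^bsub>G\<^esub> x)"
      then obtain m n where mn: "m \<in> M" "n \<in> N" "y = m \<otimes>\<^bsub>H\<^esub> f (n \<otimes>\<^bsub>G\<^esub> x)"
        by (auto simp: set_mult_def r_coset_def)
      then have "y = (m \<otimes>\<^bsub>H\<^esub> f n) \<otimes>\<^bsub>H\<^esub> f x"
        using x N.subset M.subset by (simp add: H.m_assoc subsetD)
      moreover have "m \<otimes>\<^bsub>H\<^esub> f n \<in> M"
        using mn fN by blast
      ultimately show "y \<in> M #>\<^bsub>H\<^esub> f x"
        by (auto simp: r_coset_def)
    qed
    show "M #>\<^bsub>H\<^esub> f x \<subseteq> ?\<phi> (N #>\<^bsub>G\<^esub> x)"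
    proof
      fix y assume "y \<in> M #>\<^bsub>H\<^esub> f x"
      then obtain m where "m \<in> M" "y = m \<otimes>\<^bsub>H\<^esub> f x"
        by (auto simp: r_coset_def)
      then show "y \<in> ?\<phi> (N #>\<^bsub>G\<^esub> x)"
        using G.rcos_self[OF x N] by (auto simp: set_mult_def)
    qed
  qed
  have cG: "carrier (G Mod N) = (\<lambda>x. N #>\<^bsub>G\<^esub> x) ` carrier G"
    and cH: "carrier (H Mod M) = (\<lambda>x. M #>\<^bsub>H\<^esub> x) ` carrier H"
    by (simp_all add: carrier_FactGroup)
  have hom: "?\<phi> \<in> hom (G Mod N) (H Mod M)"
    unfolding hom_def cG cH
    by (auto simp: val FactGroup_def N.rcos_sum M.rcos_sum)
  have inj: "inj_on ?\<phi> (carrier (G Mod N)) \<longleftrightarrow> (\<forall>x\<in>carrier G. f x \<in> M \<longrightarrow> x \<in> N)"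
  proof
    assume inj: "inj_on ?\<phi> (carrier (G Mod N))"
    show "\<forall>x\<in>carrier G. f x \<in> M \<longrightarrow> x \<in> N"
    proof (intro ballI impI)
      fix x assume x: "x \<in> carrier G" and fx: "f x \<in> M"
      \<comment> \<open>The trivial cosets are kept as cosets of the unit so that
        \<open>r_coset_eq_iff\<close> can compare them; the deleted rule would collapse them to the
        subgroups.\<close>
      have "?\<phi> (N #>\<^bsub>G\<^esub> x) = ?\<phi> (N #>\<^bsub>G\<^esub> \<one>\<^bsub>G\<^esub>)"
        using x fx by (simp add: val H.r_coset_eq_iff[OF M] del: H.coset_mult_one)
      then have "N #>\<^bsub>G\<^esub> x = N #>\<^bsub>G\<^esub> \<one>\<^bsub>G\<^esub>"
        using x inj unfolding cG by (simp add: inj_on_def del: G.coset_mult_one)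
      then show "x \<in> N"
        using x by (simp add: G.r_coset_eq_iff[OF N] del: G.coset_mult_one)
    qed
  next
    assume *: "\<forall>x\<in>carrier G. f x \<in> M \<longrightarrow> x \<in> N"
    show "inj_on ?\<phi> (carrier (G Mod N))"
      unfolding inj_on_def cG
    proof clarify
      fix x y assume xy: "x \<in> carrier G" "y \<in> carrier G"
        and "?\<phi> (N #>\<^bsub>G\<^esub> x) = ?\<phi> (N #>\<^bsub>G\<^esub> y)"
      then have "f (x \<otimes>\<^bsub>G\<^esub> inv\<^bsub>G\<^esub> y) \<in> M"
        by (simp add: val H.r_coset_eq_iff[OF M])
      then show "N #>\<^bsub>G\<^esub> x = N #>\<^bsub>G\<^esub> y"
        using xy * by (simp add: G.r_coset_eq_iff[OF N])
    qed
  qed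
  have surj: "?\<phi> ` carrier (G Mod N) = carrier (H Mod M) \<longleftrightarrow>
      (\<forall>y\<in>carrier H. \<exists>x\<in>carrier G. \<exists>m\<in>M. y = m \<otimes>\<^bsub>H\<^esub> f x)"
  proof -
    have "?\<phi> ` carrier (G Mod N) = (\<lambda>x. M #>\<^bsub>H\<^esub> f x) ` carrier G"
      unfolding cG image_image by (intro image_cong refl val)
    moreover have "\<dots> \<subseteq> carrier (H Mod M)"
      unfolding cH by auto
    ultimately have "?\<phi> ` carrier (G Mod N) = carrier (H Mod M) \<longleftrightarrow>
      (\<forall>y\<in>carrier H. \<exists>x\<in>carrier G. M #>\<^bsub>H\<^esub> y = M #>\<^bsub>H\<^esub> f x)"
      unfolding cH by (auto simp: subset_antisym image_iff subset_iff set_eq_iff[of "_ ` _"])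
    also have "\<dots> \<longleftrightarrow> (\<forall>y\<in>carrier H. \<exists>x\<in>carrier G. y \<in> M #>\<^bsub>H\<^esub> f x)"
      using H.rcos_self[OF _ M] H.repr_independence[OF _ _ M] by (metis hom_closed)
    finally show ?thesis
      by (simp add: r_coset_def)
  qed
  show ?thesis
    using hom inj surj by (simp add: iso_def bij_betw_def)
qed

section \<open>Elementwise criterion for quasi-isomorphisms\<close>

lemma mem_cocycles_iff:
  "x \<in> cocycles K n p \<longleftrightarrow> x \<in> carrier (grp K n p) \<and> diff K n p x = \<one>\<^bsub>grp K (n + 1) p\<^esub>"
  by (simp add: cocycles_def kernel_def)

lemma diff_group_hom:
  assumes "complex_on X K" "p \<in> topspace X"
  shows "group_hom (grp K n p) (grp K (n + 1) p) (diff K n p)"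
  using complex_on_comm_group[OF assms] data_hom_hom[OF complex_on_diff_hom[OF assms(1) refl] assms(2)]
  by (simp add: group_hom_def group_hom_axioms_def comm_group_def)

lemma subgroup_cocycles:
  assumes "complex_on X K" "p \<in> topspace X"
  shows "subgroup (cocycles K n p) (grp K n p)"
  unfolding cocycles_def using assms by (intro group_hom.subgroup_kernel diff_group_hom)

lemma subgroup_coboundaries:
  assumes "complex_on X K" "p \<in> topspace X"
  shows "subgroup (coboundaries K n p) (grp K n p)"
  using group_hom.img_is_subgroup[OF diff_group_hom[OF assms, of "n - 1"]]
  by (simp add: coboundaries_def)

lemma coboundaries_subset_cocycles:
  assumes "complex_on X K" "p \<in> topspace X"
  shows "coboundaries K n p \<subseteq> cocycles K n p"
  using complex_on_diff_closed[OF assms, of n "n - 1"] complex_on_diff_diff[OF assms, of n "n - 1"]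
  by (auto simp: coboundaries_def mem_cocycles_iff)

text \<open>The quotient criterion \<open>FactGroup_map_iso_iff\<close> applied to cocycles modulo
  coboundaries.\<close>

lemma quasi_iso_iff:
  assumes A: "complex_on X A" and B: "complex_on X B"
  shows "quasi_iso X A B f \<longleftrightarrow> f \<in> chain_maps X A B \<and>
    (\<forall>n. \<forall>p\<in>topspace X.
      (\<forall>x\<in>cocycles A n p. f n p x \<in> coboundaries B n p \<longrightarrow> x \<in> coboundaries A n p) \<and>
      (\<forall>y\<in>cocycles B n p. \<exists>x\<in>cocycles A n p. \<exists>b\<in>coboundaries B n p. y = b \<otimes>\<^bsub>grp B n p\<^esub> f n p x))"
proof -
  have "cohomology_map B f n p \<in> iso (cohomology A n p) (cohomology B n p) \<longleftrightarrow>
      (\<forall>x\<in>cocycles A n p. f n p x \<in> coboundaries B n p \<longrightarrow> x \<in> coboundaries A n p) \<and>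
      (\<forall>y\<in>cocycles B n p. \<exists>x\<in>cocycles A n p. \<exists>b\<in>coboundaries B n p. y = b \<otimes>\<^bsub>grp B n p\<^esub> f n p x)"
    if f: "f \<in> chain_maps X A B" and p: "p \<in> topspace X" for n p
  proof -
    interpret A: comm_group "grp A n p" using A p by (rule complex_on_comm_group)
    interpret B: comm_group "grp B n p" using B p by (rule complex_on_comm_group)
    have fZ: "f n p x \<in> cocycles B n p" if "x \<in> cocycles A n p" for x
      using that f p chain_maps_diff[OF f p refl, of x n] chain_maps_one[OF A B f p]
      by (simp add: mem_cocycles_iff chain_maps_closed)
    have fB: "f n p ` coboundaries A n p \<subseteq> coboundaries B n p"
      using chain_maps_diff[OF f p, of n "n - 1"] chain_maps_closed[OF f p, of _ "n - 1"]
      by (auto simp: coboundaries_def)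
    let ?G = "(grp A n p)\<lparr>carrier := cocycles A n p\<rparr>"
    let ?H = "(grp B n p)\<lparr>carrier := cocycles B n p\<rparr>"
    have G: "comm_group ?G"
      by (intro A.comm_group_subgroup subgroup_cocycles[OF A p])
    have H: "comm_group ?H"
      by (intro B.comm_group_subgroup subgroup_cocycles[OF B p])
    have N: "subgroup (coboundaries A n p) ?G"
      using A.subgroup_incl coboundaries_subset_cocycles[OF A p] subgroup_coboundaries[OF A p] subgroup_cocycles[OF A p] by blast
    have M: "subgroup (coboundaries B n p) ?H"
      using B.subgroup_incl coboundaries_subset_cocycles[OF B p] subgroup_coboundaries[OF B p] subgroup_cocycles[OF B p] by blast
    have hom: "f n p \<in> hom ?G ?H"
      using fZ f p by (auto simp: hom_def mem_cocycles_iff chain_maps_mult)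
    \<comment> \<open>\<open>set_mult\<close> sees only the multiplication, which is unchanged when
      the carrier is cut down to the cocycles.\<close>
    have "cohomology_map B f n p = (\<lambda>C. coboundaries B n p <#>\<^bsub>?H\<^esub> f n p ` C)"
      by (simp add: cohomology_map_def set_mult_def fun_eq_iff)
    then show ?thesis
      using FactGroup_map_iso_iff[OF G H N M hom fB] by (simp add: cohomology_def)
  qed
  then show ?thesis
    unfolding quasi_iso_def by blast
qed

text \<open>The criterion in the form used for diagram chases: coboundaries come with explicit
  preimages and the correction term stands on the right.\<close>

lemma quasi_isoI:
  assumes A: "complex_on X A" and B: "complex_on X B" and f: "f \<in> chain_maps X A B"
    and inj: "\<And>n p x y. p \<in> topspace X \<Longrightarrow> x \<in> carrier (grp A n p) \<Longrightarrow>
      diff A n p x = \<one>\<^bsub>grp A (n + 1) p\<^esub> \<Longrightarrow> y \<in> carrier (grp B (n - 1) p) \<Longrightarrow>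
      f n p x = diff B (n - 1) p y \<Longrightarrow> \<exists>z\<in>carrier (grp A (n - 1) p). x = diff A (n - 1) p z"
    and surj: "\<And>n p y. p \<in> topspace X \<Longrightarrow> y \<in> carrier (grp B n p) \<Longrightarrow>
      diff B n p y = \<one>\<^bsub>grp B (n + 1) p\<^esub> \<Longrightarrow>
      \<exists>x\<in>carrier (grp A n p). \<exists>b\<in>carrier (grp B (n - 1) p). diff A n p x = \<one>\<^bsub>grp A (n + 1) p\<^esub> \<and>
        y = f n p x \<otimes>\<^bsub>grp B n p\<^esub> diff B (n - 1) p b"
  shows "quasi_iso X A B f"
  unfolding quasi_iso_iff[OF A B]
proof (intro conjI allI ballI f impI)
  fix n p x assume "p \<in> topspace X" "x \<in> cocycles A n p" "f n p x \<in> coboundaries B n p"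
  then show "x \<in> coboundaries A n p"
    using inj by (fastforce simp: coboundaries_def mem_cocycles_iff)
next
  fix n p y assume p: "p \<in> topspace X" and "y \<in> cocycles B n p"
  then obtain x b where xb: "x\<in>carrier (grp A n p)" "b\<in>carrier (grp B (n - 1) p)"
      "diff A n p x = \<one>\<^bsub>grp A (n + 1) p\<^esub>" "y = f n p x \<otimes>\<^bsub>grp B n p\<^esub> diff B (n - 1) p b"
    using surj by (metis mem_cocycles_iff)
  interpret B: comm_group "grp B n p"
    using B p by (rule complex_on_comm_group)
  show "\<exists>x\<in>cocycles A n p. \<exists>b\<in>coboundaries B n p. y = b \<otimes>\<^bsub>grp B n p\<^esub> f n p x"
    using xb p f complex_on_diff_closed[OF B p, of n "n - 1"]
    by (intro bexI[of _ x] bexI[of _ "diff B (n - 1) p b"])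
      (auto simp: coboundaries_def mem_cocycles_iff B.m_comm chain_maps_closed)
qed

lemma quasi_iso_chain_maps: "quasi_iso X A B f \<Longrightarrow> f \<in> chain_maps X A B"
  by (simp add: quasi_iso_def)

lemma quasi_iso_injE:
  assumes A: "complex_on X A" and B: "complex_on X B" and f: "quasi_iso X A B f"
    and p: "p \<in> topspace X" and x: "x \<in> carrier (grp A n p)" "diff A n p x = \<one>\<^bsub>grp A (n + 1) p\<^esub>"
    and y: "y \<in> carrier (grp B (n - 1) p)" "f n p x = diff B (n - 1) p y"
  obtains z where "z \<in> carrier (grp A (n - 1) p)" "x = diff A (n - 1) p z"
proof -
  have "x \<in> cocycles A n p" "f n p x \<in> coboundaries B n p"
    using x y by (auto simp: mem_cocycles_iff coboundaries_def)
  then have "x \<in> coboundaries A n p"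
    using f p unfolding quasi_iso_iff[OF A B] by blast
  then show ?thesis
    using that by (auto simp: coboundaries_def)
qed

lemma quasi_iso_surjE:
  assumes A: "complex_on X A" and B: "complex_on X B" and f: "quasi_iso X A B f"
    and p: "p \<in> topspace X" and y: "y \<in> carrier (grp B n p)" "diff B n p y = \<one>\<^bsub>grp B (n + 1) p\<^esub>"
  obtains x b where "x \<in> carrier (grp A n p)" "b \<in> carrier (grp B (n - 1) p)"
    "diff A n p x = \<one>\<^bsub>grp A (n + 1) p\<^esub>" "y = f n p x \<otimes>\<^bsub>grp B n p\<^esub> diff B (n - 1) p b"
proof -
  have "y \<in> cocycles B n p"
    using y by (simp add: mem_cocycles_iff)
  then obtain x b where xb: "x \<in> cocycles A n p" "b \<in> coboundaries B n p" "y = b \<otimes>\<^bsub>grp B n p\<^esub> f n p x"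
    using f p unfolding quasi_iso_iff[OF A B] by blast
  interpret B: comm_group "grp B n p"
    using B p by (rule complex_on_comm_group)
  have "b \<in> carrier (grp B n p)" "f n p x \<in> carrier (grp B n p)"
    using xb p subgroup.mem_carrier[OF subgroup_coboundaries[OF B p]] quasi_iso_chain_maps[OF f]
    by (auto simp: mem_cocycles_iff chain_maps_closed)
  then show ?thesis
    using xb that[of x] by (auto simp: mem_cocycles_iff coboundaries_def B.m_comm)
qed

lemma quasi_iso_id:
  assumes A: "complex_on X A"
  shows "quasi_iso X A A id_map"
proof (rule quasi_isoI[OF A A chain_maps_id])
  fix n p assume p: "p \<in> topspace X"
  interpret comm_group "grp A n p" using A p by (rule complex_on_comm_group)
  interpret A': comm_group "grp A (n - 1) p" using A p by (rule complex_on_comm_group)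
  show "\<exists>z\<in>carrier (grp A (n - 1) p). x = diff A (n - 1) p z"
    if "y \<in> carrier (grp A (n - 1) p)" "id_map n p x = diff A (n - 1) p y" for x y
    using that by (auto simp: id_map_def)
  show "\<exists>x\<in>carrier (grp A n p). \<exists>b\<in>carrier (grp A (n - 1) p). diff A n p x = \<one>\<^bsub>grp A (n + 1) p\<^esub> \<and>
        y = id_map n p x \<otimes>\<^bsub>grp A n p\<^esub> diff A (n - 1) p b"
    if "y \<in> carrier (grp A n p)" "diff A n p y = \<one>\<^bsub>grp A (n + 1) p\<^esub>" for y
    using that complex_on_diff_one[OF A p refl, of "n - 1"]
    by (intro bexI[of _ y] bexI[of _ "\<one>\<^bsub>grp A (n - 1) p\<^esub>"]) (simp_all add: id_map_def)
qed

lemma quasi_iso_comp: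
  assumes A: "complex_on X A" and B: "complex_on X B" and C: "complex_on X C"
    and f: "quasi_iso X A B f" and g: "quasi_iso X B C g"
  shows "quasi_iso X A C (g \<circ>\<^sub>c f)"
proof (rule quasi_isoI[OF A C])
  note cf = quasi_iso_chain_maps[OF f] and cg = quasi_iso_chain_maps[OF g]
  show "g \<circ>\<^sub>c f \<in> chain_maps X A C"
    using cf cg by (rule chain_maps_comp)
  fix n p assume p: "p \<in> topspace X"
  show "\<exists>z\<in>carrier (grp A (n - 1) p). x = diff A (n - 1) p z"
    if x: "x \<in> carrier (grp A n p)" "diff A n p x = \<one>\<^bsub>grp A (n + 1) p\<^esub>"
      and y: "y \<in> carrier (grp C (n - 1) p)" "(g \<circ>\<^sub>c f) n p x = diff C (n - 1) p y" for x y
  proof -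
    have "diff B n p (f n p x) = \<one>\<^bsub>grp B (n + 1) p\<^esub>"
      using chain_maps_diff[OF cf p refl x(1)] x(2) chain_maps_one[OF A B cf p] by simp
    then obtain w where w: "w \<in> carrier (grp B (n - 1) p)" "f n p x = diff B (n - 1) p w"
      using quasi_iso_injE[OF B C g p chain_maps_closed[OF cf p x(1)] _ y(1)] y(2)
      by (auto simp: comp_map_def)
    then show ?thesis
      using quasi_iso_injE[OF A B f p x w] by blast
  qed
  show "\<exists>x\<in>carrier (grp A n p). \<exists>b\<in>carrier (grp C (n - 1) p). diff A n p x = \<one>\<^bsub>grp A (n + 1) p\<^esub> \<and>
        z = (g \<circ>\<^sub>c f) n p x \<otimes>\<^bsub>grp C n p\<^esub> diff C (n - 1) p b"
    if z: "z \<in> carrier (grp C n p)" "diff C n p z = \<one>\<^bsub>grp C (n + 1) p\<^esub>" for z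
  proof -
    interpret comm_group "grp C n p" using C p by (rule complex_on_comm_group)
    interpret C': comm_group "grp C (n - 1) p" using C p by (rule complex_on_comm_group)
    obtain y b where y: "y \<in> carrier (grp B n p)" "diff B n p y = \<one>\<^bsub>grp B (n + 1) p\<^esub>"
      and b: "b \<in> carrier (grp C (n - 1) p)" and eq: "z = g n p y \<otimes>\<^bsub>grp C n p\<^esub> diff C (n - 1) p b"
      using quasi_iso_surjE[OF B C g p z] .
    obtain x b' where x: "x \<in> carrier (grp A n p)" "diff A n p x = \<one>\<^bsub>grp A (n + 1) p\<^esub>"
      and b': "b' \<in> carrier (grp B (n - 1) p)" and eq': "y = f n p x \<otimes>\<^bsub>grp B n p\<^esub> diff B (n - 1) p b'"
      using quasi_iso_surjE[OF A B f p y] .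
    \<comment> \<open>Written additively, z = g y + d b and y = f x + d b' give z = g (f x) + d (g
      b' + b), whence the witness.\<close>
    show ?thesis
      using x b b' p cf cg B C
      by (intro bexI[of _ x] bexI[of _ "g (n - 1) p b' \<otimes>\<^bsub>grp C (n - 1) p\<^esub> b"])
        (auto simp: eq eq' comp_map_def chain_maps_mult complex_on_diff_simps chain_maps_closed
          chain_maps_diff[of g _ _ _ _ n "n - 1"] m_assoc)
  qed
qed

text \<open>Injectivity on cohomology is inherited from the composite; for surjectivity a class of
  \<open>B\<close> is compared in \<open>C\<close>, where the composite reaches it. This is the half
  of two-out-of-three that the calculus of roofs uses.\<close>

lemma quasi_iso_cancel_left:
  assumes A: "complex_on X A" and B: "complex_on X B" and C: "complex_on X C"
    and f: "f \<in> chain_maps X A B" and g: "quasi_iso X B C g" and gf: "quasi_iso X A C (g \<circ>\<^sub>c f)"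
  shows "quasi_iso X A B f"
proof (rule quasi_isoI[OF A B f])
  note cg = quasi_iso_chain_maps[OF g]
  fix n p assume p: "p \<in> topspace X"
  show "\<exists>z\<in>carrier (grp A (n - 1) p). x = diff A (n - 1) p z"
    if x: "x \<in> carrier (grp A n p)" "diff A n p x = \<one>\<^bsub>grp A (n + 1) p\<^esub>"
      and y: "y \<in> carrier (grp B (n - 1) p)" "f n p x = diff B (n - 1) p y" for x y
  proof -
    have "(g \<circ>\<^sub>c f) n p x = diff C (n - 1) p (g (n - 1) p y)"
      using chain_maps_diff[OF cg p _ y(1), of n] y(2) by (simp add: comp_map_def)
    then show ?thesis
      using quasi_iso_injE[OF A C gf p x chain_maps_closed[OF cg p y(1)]] by blast
  qed
  show "\<exists>x\<in>carrier (grp A n p). \<exists>b\<in>carrier (grp B (n - 1) p). diff A n p x = \<one>\<^bsub>grp A (n + 1) p\<^esub> \<and>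
        y = f n p x \<otimes>\<^bsub>grp B n p\<^esub> diff B (n - 1) p b"
    if y: "y \<in> carrier (grp B n p)" "diff B n p y = \<one>\<^bsub>grp B (n + 1) p\<^esub>" for y
  proof -
    interpret B: comm_group "grp B n p" using B p by (rule complex_on_comm_group)
    interpret C: comm_group "grp C n p" using C p by (rule complex_on_comm_group)
    interpret B1: comm_group "grp B (n + 1) p" using B p by (rule complex_on_comm_group)
    have "diff C n p (g n p y) = \<one>\<^bsub>grp C (n + 1) p\<^esub>"
      using chain_maps_diff[OF cg p refl y(1)] y(2) chain_maps_one[OF B C cg p] by simp
    then obtain x b where x: "x \<in> carrier (grp A n p)" "diff A n p x = \<one>\<^bsub>grp A (n + 1) p\<^esub>"
      and b: "b \<in> carrier (grp C (n - 1) p)"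
      and eq: "g n p y = g n p (f n p x) \<otimes>\<^bsub>grp C n p\<^esub> diff C (n - 1) p b"
      using quasi_iso_surjE[OF A C gf p chain_maps_closed[OF cg p y(1)]] unfolding comp_map_def by metis
    have c: "f n p x \<in> carrier (grp B n p)" "g n p (f n p x) \<in> carrier (grp C n p)"
      "diff C (n - 1) p b \<in> carrier (grp C n p)"
      using x b p f cg C by (simp_all add: chain_maps_closed complex_on_diff_closed)
    have df: "diff B n p (f n p x) = \<one>\<^bsub>grp B (n + 1) p\<^esub>"
      using chain_maps_diff[OF f p refl x(1)] x(2) chain_maps_one[OF A B f p] by simp
    \<comment> \<open>The defect y - f x is a cocycle that \<open>g\<close> maps to the coboundary d
      b. Injectivity of \<open>g\<close> on cohomology makes it a coboundary.\<close>
    have z: "y \<otimes>\<^bsub>grp B n p\<^esub> inv\<^bsub>grp B n p\<^esub> f n p x \<in> carrier (grp B n p)"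
      "diff B n p (y \<otimes>\<^bsub>grp B n p\<^esub> inv\<^bsub>grp B n p\<^esub> f n p x) = \<one>\<^bsub>grp B (n + 1) p\<^esub>"
      using y c p B df by (simp_all add: complex_on_diff_mult complex_on_diff_inv)
    have gz: "g n p (y \<otimes>\<^bsub>grp B n p\<^esub> inv\<^bsub>grp B n p\<^esub> f n p x) = diff C (n - 1) p b"
      using y c p cg B C by (simp add: chain_maps_mult chain_maps_inv[OF B C] eq C.m_ac)
    obtain w where w: "w \<in> carrier (grp B (n - 1) p)"
      "y \<otimes>\<^bsub>grp B n p\<^esub> inv\<^bsub>grp B n p\<^esub> f n p x = diff B (n - 1) p w"
      using quasi_iso_injE[OF B C g p z b gz] .
    have "y = f n p x \<otimes>\<^bsub>grp B n p\<^esub> diff B (n - 1) p w"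
      unfolding w(2)[symmetric] using y c by (simp add: B.m_ac)
    then show ?thesis
      using x w by blast
  qed
qed

lemma quasi_iso_homotopic:
  assumes A: "complex_on X A" and B: "complex_on X B" and f: "quasi_iso X A B f"
    and g: "g \<in> chain_maps X A B" and fg: "homotopic X A B f g"
  shows "quasi_iso X A B g"
proof (rule quasi_isoI[OF A B g])
  obtain h where h: "\<And>n. h n \<in> data_hom X (deg A n) (deg B (n - 1))"
    and eq: "\<And>n p x. p \<in> topspace X \<Longrightarrow> x \<in> carrier (grp A n p) \<Longrightarrow>
        f n p x = g n p x \<otimes>\<^bsub>grp B n p\<^esub>
          (diff B (n - 1) p (h n p x) \<otimes>\<^bsub>grp B n p\<^esub> h (n + 1) p (diff A n p x))"
    by (rule homotopicE[OF fg]) (rule that)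
  fix n p assume p: "p \<in> topspace X"
  interpret B: comm_group "grp B n p" using B p by (rule complex_on_comm_group)
  interpret B': comm_group "grp B (n - 1) p" using B p by (rule complex_on_comm_group)
  have hx: "h n p x \<in> carrier (grp B (n - 1) p)" if "x \<in> carrier (grp A n p)" for x
    using data_hom_closed[OF h p that] .
  \<comment> \<open>On cocycles the second term of the homotopy disappears, so \<open>f\<close> and
    \<open>g\<close> differ by a coboundary; both halves of the criterion follow from this.\<close>
  have eq': "f n p x = g n p x \<otimes>\<^bsub>grp B n p\<^esub> diff B (n - 1) p (h n p x)"
    if x: "x \<in> carrier (grp A n p)" "diff A n p x = \<one>\<^bsub>grp A (n + 1) p\<^esub>" for x
  proof -
    have "h (n + 1) p \<one>\<^bsub>grp A (n + 1) p\<^esub> = \<one>\<^bsub>grp B n p\<^esub>"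
      using data_hom_one_eq[OF complex_on_abelian_data[OF A] complex_on_abelian_data[OF B] h p, of "n + 1"]
      by simp
    then show ?thesis
      using eq[OF p x(1)] x(2) complex_on_diff_closed[OF B p _ hx[OF x(1)], of n] by simp
  qed
  show "\<exists>z\<in>carrier (grp A (n - 1) p). x = diff A (n - 1) p z"
    if x: "x \<in> carrier (grp A n p)" "diff A n p x = \<one>\<^bsub>grp A (n + 1) p\<^esub>"
      and y: "y \<in> carrier (grp B (n - 1) p)" "g n p x = diff B (n - 1) p y" for x y
  proof -
    have "f n p x = diff B (n - 1) p (y \<otimes>\<^bsub>grp B (n - 1) p\<^esub> h n p x)"
      using x y p hx B by (simp add: eq' complex_on_diff_mult)
    then show ?thesis
      using quasi_iso_injE[OF A B f p x] y hx[OF x(1)] by (metis B'.m_closed)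
  qed
  show "\<exists>x\<in>carrier (grp A n p). \<exists>b\<in>carrier (grp B (n - 1) p). diff A n p x = \<one>\<^bsub>grp A (n + 1) p\<^esub> \<and>
        y = g n p x \<otimes>\<^bsub>grp B n p\<^esub> diff B (n - 1) p b"
    if y: "y \<in> carrier (grp B n p)" "diff B n p y = \<one>\<^bsub>grp B (n + 1) p\<^esub>" for y
  proof -
    obtain x b where x: "x \<in> carrier (grp A n p)" "diff A n p x = \<one>\<^bsub>grp A (n + 1) p\<^esub>"
      and b: "b \<in> carrier (grp B (n - 1) p)" and eqy: "y = f n p x \<otimes>\<^bsub>grp B n p\<^esub> diff B (n - 1) p b"
      using quasi_iso_surjE[OF A B f p y] .
    show ?thesis
      using x b p g B hx[OF x(1)]
      by (intro bexI[of _ x] bexI[of _ "h n p x \<otimes>\<^bsub>grp B (n - 1) p\<^esub> b"])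
        (auto simp: eqy eq' chain_maps_closed complex_on_diff_simps B.m_assoc)
  qed
qed

section \<open>Homotopy pullbacks and calculus of fractions\<close>

definition prod_data :: "('x, 'a) ab_data \<Rightarrow> ('x, 'b) ab_data \<Rightarrow> ('x, 'a \<times> 'b) ab_data" where
  "prod_data F G = \<lparr>sec = (\<lambda>p. sec F p \<times>\<times> sec G p),
     res = (\<lambda>p q x. (res F p q (fst x), res G p q (snd x)))\<rparr>"

text \<open>The right-nested form of (x + y) - (x + y) = 0, the shape in which the third coordinate
  of the homotopy pullback is written.\<close>

lemma (in comm_group) mult_mult_inv_inv:
  assumes "x \<in> carrier G" "y \<in> carrier G"
  shows "x \<otimes> (y \<otimes> (inv x \<otimes> inv y)) = \<one>"
  using assms r_inv[of "x \<otimes> y"] by (simp add: inv_mult m_assoc)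

lemma comm_group_DirProd:
  assumes "comm_group G" "comm_group H"
  shows "comm_group (G \<times>\<times> H)"
proof -
  interpret G: comm_group G by fact
  interpret H: comm_group H by fact
  show ?thesis
    by (intro group.group_comm_groupI DirProd_group)
      (auto simp: G.m_comm H.m_comm G.is_group H.is_group)
qed

lemma sec_prod_data [simp]: "sec (prod_data F G) p = sec F p \<times>\<times> sec G p"
  by (simp add: prod_data_def)

lemma abelian_data_prod_data:
  assumes F: "abelian_data X F" and G: "abelian_data X G"
  shows "abelian_data X (prod_data F G)"
  unfolding abelian_data_def
proof (intro conjI allI ballI impI)
  fix p q assume pq: "spec_le X p q"
  show "res (prod_data F G) p q \<in> hom (sec (prod_data F G) p) (sec (prod_data F G) q)"
    using abelian_data_res_hom[OF F pq] abelian_data_res_hom[OF G pq]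
    by (auto simp: prod_data_def hom_def)
qed (use assms in \<open>auto simp: abelian_data_def prod_data_def comm_group_DirProd\<close>)

lemma data_hom_fst: "(\<lambda>p. fst) \<in> data_hom X (prod_data F G) F"
  by (rule data_homI) (auto simp: prod_data_def hom_def)

lemma data_hom_snd: "(\<lambda>p. snd) \<in> data_hom X (prod_data F G) G"
  by (rule data_homI) (auto simp: prod_data_def hom_def)

lemma data_hom_pair:
  assumes f: "f \<in> data_hom X E F" and g: "g \<in> data_hom X E G"
  shows "(\<lambda>p x. (f p x, g p x)) \<in> data_hom X E (prod_data F G)"
proof (rule data_homI)
  fix p assume p: "p \<in> topspace X"
  show "(\<lambda>x. (f p x, g p x)) \<in> hom (sec E p) (sec (prod_data F G) p)"
    using data_hom_hom[OF f p] data_hom_hom[OF g p] by (auto simp: prod_data_def hom_def)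
next
  fix p q x assume pq: "spec_le X p q" and x: "x \<in> carrier (sec E p)"
  then show "(f q (res E p q x), g q (res E p q x)) = res (prod_data F G) p q (f p x, g p x)"
    using data_hom_res[OF f pq x] data_hom_res[OF g pq x] by (simp add: prod_data_def)
qed

text \<open>The shifted mapping cone of \<open>(f, - g): A \<oplus> B \<rightarrow> C\<close>, up to signs.\<close>

definition homotopy_pullback ::
  "('x, 'a) data_complex \<Rightarrow> ('x, 'b) data_complex \<Rightarrow> ('x, 'c) data_complex \<Rightarrow>
     (int \<Rightarrow> 'x \<Rightarrow> 'a \<Rightarrow> 'c) \<Rightarrow> (int \<Rightarrow> 'x \<Rightarrow> 'b \<Rightarrow> 'c) \<Rightarrow> ('x, 'a \<times> 'b \<times> 'c) data_complex" where
  "homotopy_pullback A B C f g =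
     \<lparr>deg = (\<lambda>n. prod_data (deg A n) (prod_data (deg B n) (deg C (n - 1)))),
      diff = (\<lambda>n p x. (diff A n p (fst x), diff B n p (fst (snd x)),
        f n p (fst x) \<otimes>\<^bsub>grp C n p\<^esub> (inv\<^bsub>grp C n p\<^esub> (g n p (fst (snd x))) \<otimes>\<^bsub>grp C n p\<^esub>
          inv\<^bsub>grp C n p\<^esub> (diff C (n - 1) p (snd (snd x))))))\<rparr>"

lemma deg_homotopy_pullback [simp]:
  "deg (homotopy_pullback A B C f g) n = prod_data (deg A n) (prod_data (deg B n) (deg C (n - 1)))"
  by (simp add: homotopy_pullback_def)

lemma diff_homotopy_pullback [simp]:
  "diff (homotopy_pullback A B C f g) n p (a, b, c) = (diff A n p a, diff B n p b,
        f n p a \<otimes>\<^bsub>grp C n p\<^esub> (inv\<^bsub>grp C n p\<^esub> (g n p b) \<otimes>\<^bsub>grp C n p\<^esub>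
          inv\<^bsub>grp C n p\<^esub> (diff C (n - 1) p c)))"
  by (simp add: homotopy_pullback_def)

context
  fixes X :: "'x topology" and A :: "('x, 'a) data_complex" and B :: "('x, 'b) data_complex"
    and C :: "('x, 'c) data_complex" and f g
  assumes A: "complex_on X A" and B: "complex_on X B" and C: "complex_on X C"
    and f: "f \<in> chain_maps X A C" and g: "g \<in> chain_maps X B C"
begin

lemma complex_on_homotopy_pullback: "complex_on X (homotopy_pullback A B C f g)"
  unfolding complex_on_def
proof (intro conjI allI ballI)
  let ?E = "homotopy_pullback A B C f g"
  note ab = complex_on_abelian_data
  show "abelian_data X (deg ?E n)" for n
    using ab[OF A] ab[OF B] ab[OF C] by (simp add: abelian_data_prod_data)
  show "diff ?E n \<in> data_hom X (deg ?E n) (deg ?E (n + 1))" for n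
  proof -
    have pr: "(\<lambda>p x. fst x) \<in> data_hom X (deg ?E n) (deg A n)"
      "(\<lambda>p x. fst (snd x)) \<in> data_hom X (deg ?E n) (deg B n)"
      "(\<lambda>p x. snd (snd x)) \<in> data_hom X (deg ?E n) (deg C (n - 1))"
      using data_hom_fst data_hom_compose[OF data_hom_snd data_hom_fst]
        data_hom_compose[OF data_hom_snd data_hom_snd] by auto
    have dC: "diff C (n - 1) \<in> data_hom X (deg C (n - 1)) (deg C n)"
      using complex_on_diff_hom[OF C, of n "n - 1"] by simp
    have "diff ?E n \<in> data_hom X (deg ?E n) (prod_data (deg A (n + 1)) (prod_data (deg B (n + 1)) (deg C n)))"
      unfolding homotopy_pullback_def data_complex.select_convs
      using pr
      by (intro data_hom_pair data_hom_mult_hom data_hom_inv_hom ab[OF C]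
          data_hom_compose[OF _ complex_on_diff_hom[OF A refl]]
          data_hom_compose[OF _ complex_on_diff_hom[OF B refl]]
          data_hom_compose[OF _ chain_maps_data_hom[OF f]]
          data_hom_compose[OF _ chain_maps_data_hom[OF g]]
          data_hom_compose[OF _ dC]) simp_all
    then show ?thesis
      by simp
  qed
  fix n p x assume p: "p \<in> topspace X" and "x \<in> carrier (grp ?E n p)"
  then obtain a b c where x: "x = (a, b, c)" and a: "a \<in> carrier (grp A n p)"
    and b: "b \<in> carrier (grp B n p)" and c: "c \<in> carrier (grp C (n - 1) p)"
    by auto
  interpret C0: comm_group "grp C n p" using C p by (rule complex_on_comm_group)
  interpret C1: comm_group "grp C (n + 1) p" using C p by (rule complex_on_comm_group)
  have cl: "f n p a \<in> carrier (grp C n p)" "g n p b \<in> carrier (grp C n p)"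
    "diff C (n - 1) p c \<in> carrier (grp C n p)"
    using a b c p f g C by (simp_all add: chain_maps_closed complex_on_diff_closed)
  have "diff C n p (diff C (n - 1) p c) = \<one>\<^bsub>grp C (n + 1) p\<^esub>"
    using complex_on_diff_diff[OF C p _ c, of n] by simp
  moreover have "f (n + 1) p (diff A n p a) = diff C n p (f n p a)"
    "g (n + 1) p (diff B n p b) = diff C n p (g n p b)"
    using chain_maps_diff[OF f p refl a] chain_maps_diff[OF g p refl b] by simp_all
  moreover have "diff C n p (f n p a) \<in> carrier (grp C (n + 1) p)"
    "diff C n p (g n p b) \<in> carrier (grp C (n + 1) p)"
    using complex_on_diff_closed[OF C p refl] cl by simp_all
  \<comment> \<open>The third coordinate of the double differential is f (d a) - g (d b) - d (f a -
    g b - d c), which cancels because \<open>f\<close> and \<open>g\<close> are chain maps and d d c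
    = 0.\<close>
  ultimately show "diff ?E (n + 1) p (diff ?E n p x) = \<one>\<^bsub>grp ?E (n + 1 + 1) p\<^esub>"
    using a b cl p A B C
    by (simp add: x complex_on_diff_diff complex_on_diff_mult complex_on_diff_inv)
      (simp add: C1.m_assoc[symmetric] add.commute[of 1 n])
qed

lemma homotopy_pullback_fst:
  "(\<lambda>n p. fst) \<in> chain_maps X (homotopy_pullback A B C f g) A"
  by (rule chain_mapsI) (auto simp: data_hom_fst)

lemma homotopy_pullback_snd:
  "(\<lambda>n p x. fst (snd x)) \<in> chain_maps X (homotopy_pullback A B C f g) B"
  by (rule chain_mapsI) (auto intro: data_hom_compose[OF data_hom_snd data_hom_fst])

text \<open>The third coordinate is itself the homotopy: f a = g b + (d c + (f a - g b - d c)), and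
  the bracketed difference is the third coordinate of the differential.\<close>

lemma homotopy_pullback_homotopic:
  "homotopic X (homotopy_pullback A B C f g) C (f \<circ>\<^sub>c (\<lambda>n p. fst)) (g \<circ>\<^sub>c (\<lambda>n p x. fst (snd x)))"
proof (rule homotopicI)
  let ?E = "homotopy_pullback A B C f g"
  show "(\<lambda>p x. snd (snd x)) \<in> data_hom X (deg ?E n) (deg C (n - 1))" for n
    using data_hom_compose[OF data_hom_snd data_hom_snd] by simp
  fix n p x assume p: "p \<in> topspace X" and "x \<in> carrier (grp ?E n p)"
  then obtain a b c where x: "x = (a, b, c)" and a: "a \<in> carrier (grp A n p)"
    and b: "b \<in> carrier (grp B n p)" and c: "c \<in> carrier (grp C (n - 1) p)"
    by auto
  interpret C0: comm_group "grp C n p" using C p by (rule complex_on_comm_group)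
  have cl: "f n p a \<in> carrier (grp C n p)" "g n p b \<in> carrier (grp C n p)"
    "diff C (n - 1) p c \<in> carrier (grp C n p)"
    using a b c p f g C by (simp_all add: chain_maps_closed complex_on_diff_closed)
  show "(f \<circ>\<^sub>c (\<lambda>n p. fst)) n p x = (g \<circ>\<^sub>c (\<lambda>n p x. fst (snd x))) n p x \<otimes>\<^bsub>grp C n p\<^esub>
     (diff C (n - 1) p (snd (snd x)) \<otimes>\<^bsub>grp C n p\<^esub> snd (snd (diff ?E n p x)))"
    using cl by (simp add: x comp_map_def C0.m_ac C0.inv_solve_left' C0.mult_mult_inv_inv)
qed

text \<open>The heart of the Ore condition: the kernel of the projection is the shifted cone of
  \<open>g\<close>, up to signs, which is acyclic when \<open>g\<close> is a quasi-isomorphism. The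
  proof is the corresponding chase on elements.\<close>

lemma homotopy_pullback_quasi_iso:
  assumes "quasi_iso X B C g"
  shows "quasi_iso X (homotopy_pullback A B C f g) A (\<lambda>n p. fst)"
proof (rule quasi_isoI[OF complex_on_homotopy_pullback A homotopy_pullback_fst])
  let ?E = "homotopy_pullback A B C f g"
  fix n p assume p: "p \<in> topspace X"
  interpret C0: comm_group "grp C n p" using C p by (rule complex_on_comm_group)
  interpret C1: comm_group "grp C (n - 1) p" using C p by (rule complex_on_comm_group)
  interpret B1: comm_group "grp B (n - 1) p" using B p by (rule complex_on_comm_group)
  interpret B0: comm_group "grp B n p" using B p by (rule complex_on_comm_group)
  interpret A1: comm_group "grp A (n - 1) p" using A p by (rule complex_on_comm_group)
  interpret A0: comm_group "grp A n p" using A p by (rule complex_on_comm_group)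
  show "\<exists>z\<in>carrier (grp ?E (n - 1) p). x = diff ?E (n - 1) p z"
    if "x \<in> carrier (grp ?E n p)" and dx: "diff ?E n p x = \<one>\<^bsub>grp ?E (n + 1) p\<^esub>"
      and a': "a' \<in> carrier (grp A (n - 1) p)" and xa': "fst x = diff A (n - 1) p a'" for x a'
  proof -
    obtain a b c where x: "x = (a, b, c)" and a: "a \<in> carrier (grp A n p)"
      and b: "b \<in> carrier (grp B n p)" and c: "c \<in> carrier (grp C (n - 1) p)"
      using \<open>x \<in> _\<close> by auto
    have aa': "a = diff A (n - 1) p a'"
      using xa' x by simp
    have fa: "f n p a = diff C (n - 1) p (f (n - 1) p a')"
      using chain_maps_diff[OF f p _ a', of n] aa' by simp
    have fa': "f (n - 1) p a' \<in> carrier (grp C (n - 1) p)"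
      using f p a' by (rule chain_maps_closed)
    have cl: "f n p a \<in> carrier (grp C n p)" "g n p b \<in> carrier (grp C n p)"
      "diff C (n - 1) p c \<in> carrier (grp C n p)"
      "diff C (n - 1) p (f (n - 1) p a') \<in> carrier (grp C n p)"
      using a b c fa' p f g C by (simp_all add: chain_maps_closed complex_on_diff_closed)
    have db: "diff B n p b = \<one>\<^bsub>grp B (n + 1) p\<^esub>"
      and eq: "f n p a \<otimes>\<^bsub>grp C n p\<^esub> (inv\<^bsub>grp C n p\<^esub> (g n p b) \<otimes>\<^bsub>grp C n p\<^esub>
          inv\<^bsub>grp C n p\<^esub> (diff C (n - 1) p c)) = \<one>\<^bsub>grp C n p\<^esub>"
      using dx by (simp_all add: x)
    have "g n p b = f n p a \<otimes>\<^bsub>grp C n p\<^esub> inv\<^bsub>grp C n p\<^esub> (diff C (n - 1) p c)"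
      using eq cl by (metis C0.inv_closed C0.inv_inv C0.inv_unique C0.m_closed C0.m_comm C0.m_lcomm
          C0.inv_equality)
    \<comment> \<open>As x is a cocycle and a = d a', its third coordinate gives g b = d (f a' - c).
      Injectivity of \<open>g\<close> on cohomology then makes b a coboundary d b'.\<close>
    then have gb: "g n p b = diff C (n - 1) p (f (n - 1) p a' \<otimes>\<^bsub>grp C (n - 1) p\<^esub> inv\<^bsub>grp C (n - 1) p\<^esub> c)"
      using C p c fa' by (simp add: fa complex_on_diff_mult complex_on_diff_inv)
    obtain b' where b': "b' \<in> carrier (grp B (n - 1) p)" and bb': "b = diff B (n - 1) p b'"
      using quasi_iso_injE[OF B C assms p b db _ gb] fa' c by blast
    have gb': "g (n - 1) p b' \<in> carrier (grp C (n - 1) p)"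
      "diff C (n - 1) p (g (n - 1) p b') = g n p b"
      using g p b' chain_maps_diff[OF g p _ b', of n] bb' by (simp_all add: chain_maps_closed)
    \<comment> \<open>The amount by which (a', b', 0) fails to reproduce c. It is a cocycle, hence g
      b'' + d c'' for a cocycle b''; replacing b' by b' + b'' does not change d b' and absorbs it,
      with c'' as third coordinate.\<close>
    let ?c = "f (n - 1) p a' \<otimes>\<^bsub>grp C (n - 1) p\<^esub>
      (inv\<^bsub>grp C (n - 1) p\<^esub> g (n - 1) p b' \<otimes>\<^bsub>grp C (n - 1) p\<^esub> inv\<^bsub>grp C (n - 1) p\<^esub> c)"
    have cc: "?c \<in> carrier (grp C (n - 1) p)"
      using fa' gb' c by simp
    have "diff C (n - 1) p ?c = \<one>\<^bsub>grp C (n - 1 + 1) p\<^esub>"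
      using eq C p fa' gb' c by (simp add: complex_on_diff_mult complex_on_diff_inv fa)
    then obtain b'' c'' where b'': "b'' \<in> carrier (grp B (n - 1) p)"
      and c'': "c'' \<in> carrier (grp C (n - 1 - 1) p)"
      and db'': "diff B (n - 1) p b'' = \<one>\<^bsub>grp B (n - 1 + 1) p\<^esub>"
      and eq'': "?c = g (n - 1) p b'' \<otimes>\<^bsub>grp C (n - 1) p\<^esub> diff C (n - 1 - 1) p c''"
      using quasi_iso_surjE[OF B C assms p cc] by metis
    have gb'': "g (n - 1) p b'' \<in> carrier (grp C (n - 1) p)"
      "diff C (n - 1 - 1) p c'' \<in> carrier (grp C (n - 1) p)"
      using g p b'' c'' C by (simp_all add: chain_maps_closed complex_on_diff_closed)
    have "c = f (n - 1) p a' \<otimes>\<^bsub>grp C (n - 1) p\<^esub>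
      (inv\<^bsub>grp C (n - 1) p\<^esub> g (n - 1) p b' \<otimes>\<^bsub>grp C (n - 1) p\<^esub> inv\<^bsub>grp C (n - 1) p\<^esub> ?c)"
      using fa' gb' c by (simp add: C1.inv_mult C1.m_ac C1.inv_solve_left' C1.mult_mult_inv_inv)
    also have "\<dots> = f (n - 1) p a' \<otimes>\<^bsub>grp C (n - 1) p\<^esub>
      (inv\<^bsub>grp C (n - 1) p\<^esub> (g (n - 1) p (b' \<otimes>\<^bsub>grp B (n - 1) p\<^esub> b'')) \<otimes>\<^bsub>grp C (n - 1) p\<^esub>
        inv\<^bsub>grp C (n - 1) p\<^esub> diff C (n - 1 - 1) p c'')"
      unfolding eq'' using fa' gb' gb'' g p b' b''
      by (simp add: C1.inv_mult C1.m_ac chain_maps_mult)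
    finally have "x = diff ?E (n - 1) p (a', b' \<otimes>\<^bsub>grp B (n - 1) p\<^esub> b'', c'')"
      using aa' bb' db'' b b' b'' B p by (simp add: x complex_on_diff_mult)
    then show ?thesis
      using a' b' b'' c'' by (intro bexI[of _ "(a', b' \<otimes>\<^bsub>grp B (n - 1) p\<^esub> b'', c'')"]) auto
  qed
  show "\<exists>x\<in>carrier (grp ?E n p). \<exists>a'\<in>carrier (grp A (n - 1) p).
      diff ?E n p x = \<one>\<^bsub>grp ?E (n + 1) p\<^esub> \<and> a = fst x \<otimes>\<^bsub>grp A n p\<^esub> diff A (n - 1) p a'"
    if a: "a \<in> carrier (grp A n p)" "diff A n p a = \<one>\<^bsub>grp A (n + 1) p\<^esub>" for a
  proof -
    have fa: "f n p a \<in> carrier (grp C n p)"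
      using f p a(1) by (rule chain_maps_closed)
    have "diff C n p (f n p a) = \<one>\<^bsub>grp C (n + 1) p\<^esub>"
      using chain_maps_diff[OF f p refl a(1)] a(2) chain_maps_one[OF A C f p] by simp
    then obtain b c where b: "b \<in> carrier (grp B n p)" "diff B n p b = \<one>\<^bsub>grp B (n + 1) p\<^esub>"
      and c: "c \<in> carrier (grp C (n - 1) p)" and eq: "f n p a = g n p b \<otimes>\<^bsub>grp C n p\<^esub> diff C (n - 1) p c"
      using quasi_iso_surjE[OF B C assms p fa] by metis
    have cl: "g n p b \<in> carrier (grp C n p)" "diff C (n - 1) p c \<in> carrier (grp C n p)"
      using g b c p C by (simp_all add: chain_maps_closed complex_on_diff_closed)
    \<comment> \<open>The third coordinate f a - g b - d c vanishes by the choice of b and c, so a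
      lifts to a cocycle and needs no correction.\<close>
    have "diff ?E n p (a, b, c) = \<one>\<^bsub>grp ?E (n + 1) p\<^esub>"
      using a b cl by (simp add: eq C0.inv_mult[symmetric])
    moreover have "a = fst (a, b, c) \<otimes>\<^bsub>grp A n p\<^esub> diff A (n - 1) p \<one>\<^bsub>grp A (n - 1) p\<^esub>"
      using a complex_on_diff_one[OF A p refl, of "n - 1"] by simp
    ultimately show ?thesis
      using a b c by (intro bexI[of _ "(a, b, c)"] bexI[of _ "\<one>\<^bsub>grp A (n - 1) p\<^esub>"]) auto
  qed
qed

end

text \<open>\<open>k\<close> is a left inverse of \<open>j\<close>.\<close>

definition transport_data :: "('a \<Rightarrow> 'b) \<Rightarrow> ('b \<Rightarrow> 'a) \<Rightarrow> ('x, 'a) ab_data \<Rightarrow> ('x, 'b) ab_data" where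
  "transport_data j k F =
     \<lparr>sec = (\<lambda>p. \<lparr>carrier = j ` carrier (sec F p),
        mult = (\<lambda>x y. j (k x \<otimes>\<^bsub>sec F p\<^esub> k y)), one = j \<one>\<^bsub>sec F p\<^esub>\<rparr>),
      res = (\<lambda>p q x. j (res F p q (k x)))\<rparr>"

definition transport_complex ::
  "('a \<Rightarrow> 'b) \<Rightarrow> ('b \<Rightarrow> 'a) \<Rightarrow> ('x, 'a) data_complex \<Rightarrow> ('x, 'b) data_complex" where
  "transport_complex j k A =
     \<lparr>deg = (\<lambda>n. transport_data j k (deg A n)), diff = (\<lambda>n p x. j (diff A n p (k x)))\<rparr>"

context
  fixes X :: "'x topology" and A :: "('x, 'a) data_complex" and j :: "'a \<Rightarrow> 'b" and k :: "'b \<Rightarrow> 'a"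
  assumes kj [simp]: "\<And>x. k (j x) = x" and A: "complex_on X A"
begin

lemma complex_on_transport_complex: "complex_on X (transport_complex j k A)"
proof -
  have comm: "comm_group (grp (transport_complex j k A) n p)" if p: "p \<in> topspace X" for n p
  proof -
    interpret A: comm_group "grp A n p" using A p by (rule complex_on_comm_group)
    show ?thesis
      unfolding transport_complex_def transport_data_def
      by (rule comm_groupI) (auto simp: A.m_ac intro: rev_bexI[OF A.inv_closed])
  qed
  have "abelian_data X (deg (transport_complex j k A) n)" for n
    using complex_on_abelian_data[OF A, of n] comm
    unfolding abelian_data_def
    by (auto simp: transport_complex_def transport_data_def hom_def Pi_iff)
  moreover have "diff (transport_complex j k A) n
      \<in> data_hom X (deg (transport_complex j k A) n) (deg (transport_complex j k A) (n + 1))" for n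
    using complex_on_diff_hom[OF A refl, of n]
    by (auto simp: transport_complex_def transport_data_def hom_def data_hom_def Pi_iff)
  ultimately show ?thesis
    using complex_on_diff_diff[OF A _ refl]
    by (auto simp: complex_on_def transport_complex_def transport_data_def)
qed

text \<open>On the image of \<open>j\<close> the map \<open>k\<close> is a degreewise bijection with
  inverse \<open>j\<close>, so lifts are given by \<open>j\<close> and the correction is the
  unit.\<close>

lemma transport_complex_quasi_iso: "quasi_iso X (transport_complex j k A) A (\<lambda>n p. k)"
proof (rule quasi_isoI[OF complex_on_transport_complex A])
  show "(\<lambda>n p. k) \<in> chain_maps X (transport_complex j k A) A"
    by (rule chain_mapsI) (auto simp: transport_complex_def transport_data_def data_hom_def hom_def)
next
  fix n p y assume p: "p \<in> topspace X" and y: "y \<in> carrier (grp A n p)"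
    "diff A n p y = \<one>\<^bsub>grp A (n + 1) p\<^esub>"
  interpret comm_group "grp A n p" using A p by (rule complex_on_comm_group)
  interpret A': comm_group "grp A (n - 1) p" using A p by (rule complex_on_comm_group)
  show "\<exists>x\<in>carrier (grp (transport_complex j k A) n p). \<exists>b\<in>carrier (grp A (n - 1) p).
      diff (transport_complex j k A) n p x = \<one>\<^bsub>grp (transport_complex j k A) (n + 1) p\<^esub> \<and>
      y = k x \<otimes>\<^bsub>grp A n p\<^esub> diff A (n - 1) p b"
    using y complex_on_diff_one[OF A p refl, of "n - 1"]
    by (intro bexI[of _ "j y"] bexI[of _ "\<one>\<^bsub>grp A (n - 1) p\<^esub>"])
      (auto simp: transport_complex_def transport_data_def)
qed (auto simp: transport_complex_def transport_data_def)

end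

text \<open>
  The Ore condition. The pullback lives over \<open>'a \<times> 'b \<times> 'c\<close>, which embeds into the infinite
  type \<open>'a\<close>.
\<close>

lemma homotopy_pullbackE:
  fixes A :: "('x, 'a::infinite) data_complex" and B :: "('x, 'b) data_complex"
    and C :: "('x, 'c) data_complex"
  assumes b: "(UNIV :: 'b set) \<lesssim> (UNIV :: 'a set)" and c: "(UNIV :: 'c set) \<lesssim> (UNIV :: 'a set)"
    and A: "complex_on X A" and B: "complex_on X B" and C: "complex_on X C"
    and f: "f \<in> chain_maps X A C" and g: "quasi_iso X B C g"
  obtains E :: "('x, 'a) data_complex" and u v where
    "complex_on X E" "quasi_iso X E A u" "v \<in> chain_maps X E B"
    "homotopic X E C (f \<circ>\<^sub>c u) (g \<circ>\<^sub>c v)"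
proof -
  have sq: "(UNIV :: 'a set) \<times> (UNIV :: 'a set) \<lesssim> (UNIV :: 'a set)"
    using card_of_Times_same_infinite[OF infinite_UNIV] eqpoll_iff_card_of_ordIso eqpoll_imp_lepoll
    by blast
  have "(UNIV :: 'a set) \<times> ((UNIV :: 'b set) \<times> (UNIV :: 'c set)) \<lesssim>
      (UNIV :: 'a set) \<times> ((UNIV :: 'a set) \<times> (UNIV :: 'a set))"
    using b c by (intro times_lepoll_mono lepoll_refl)
  also have "\<dots> \<lesssim> (UNIV :: 'a set) \<times> (UNIV :: 'a set)"
    using sq by (intro times_lepoll_mono lepoll_refl)
  also have "\<dots> \<lesssim> (UNIV :: 'a set)"
    by (rule sq)
  finally obtain j :: "'a \<times> 'b \<times> 'c \<Rightarrow> 'a" where "inj j"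
    by (auto simp: lepoll_def)
  define k where "k = the_inv j"
  have kj: "k (j x) = x" for x
    using \<open>inj j\<close> by (simp add: k_def the_inv_f_f)
  note cg = quasi_iso_chain_maps[OF g]
  let ?P = "homotopy_pullback A B C f g"
  let ?E = "transport_complex j k ?P"
  note P = complex_on_homotopy_pullback[OF A B C f cg]
  have E: "complex_on X ?E" and k: "quasi_iso X ?E ?P (\<lambda>n p. k)"
    using complex_on_transport_complex[where j = j and k = k, OF kj P]
      transport_complex_quasi_iso[where j = j and k = k, OF kj P] by auto
  note ck = quasi_iso_chain_maps[OF k]
  show ?thesis
  proof (rule that[OF E])
    show "quasi_iso X ?E A ((\<lambda>n p. fst) \<circ>\<^sub>c (\<lambda>n p. k))"
      using quasi_iso_comp[OF E P A k homotopy_pullback_quasi_iso[OF A B C f cg g]] .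
    show "(\<lambda>n p x. fst (snd x)) \<circ>\<^sub>c (\<lambda>n p. k) \<in> chain_maps X ?E B"
      using chain_maps_comp[OF ck homotopy_pullback_snd[OF A B C f cg]] .
    show "homotopic X ?E C (f \<circ>\<^sub>c ((\<lambda>n p. fst) \<circ>\<^sub>c (\<lambda>n p. k)))
        (g \<circ>\<^sub>c ((\<lambda>n p x. fst (snd x)) \<circ>\<^sub>c (\<lambda>n p. k)))"
      using homotopic_comp_right[OF ck homotopy_pullback_homotopic[OF A B C f cg]]
      by (simp add: comp_map_assoc)
  qed
qed


text \<open>Equality of \<open>f\<close> and \<open>g\<close> as morphisms of the derived category.\<close>

definition D_eq ::
  "'x topology \<Rightarrow> ('x, 'a) data_complex \<Rightarrow> ('x, 'b) data_complex \<Rightarrow>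
     (int \<Rightarrow> 'x \<Rightarrow> 'a \<Rightarrow> 'b) \<Rightarrow> (int \<Rightarrow> 'x \<Rightarrow> 'a \<Rightarrow> 'b) \<Rightarrow> bool" where
  "D_eq X A B f g \<longleftrightarrow> (\<exists>(E :: ('x, 'a) data_complex) v.
     complex_on X E \<and> quasi_iso X E A v \<and> homotopic X E B (f \<circ>\<^sub>c v) (g \<circ>\<^sub>c v))"

lemma D_eq_of_homotopic:
  assumes "complex_on X A" "homotopic X A B f g"
  shows "D_eq X A B f g"
  unfolding D_eq_def using assms quasi_iso_id[OF assms(1)] by (intro exI[of _ A] exI[of _ id_map]) simp

lemma D_eq_sym:
  assumes "complex_on X B" "g \<in> chain_maps X A B" "D_eq X A B f g"
  shows "D_eq X A B g f"
  using assms homotopic_sym chain_maps_comp quasi_iso_chain_maps unfolding D_eq_def by metis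

lemma D_eq_comp_left:
  fixes A :: "('x, 'a) data_complex"
  assumes B: "complex_on X B" and g: "g \<in> chain_maps X A B" and k: "k \<in> chain_maps X B C"
    and eq: "D_eq X A B f g"
  shows "D_eq X A C (k \<circ>\<^sub>c f) (k \<circ>\<^sub>c g)"
proof -
  obtain E :: "('x, 'a) data_complex" and v where E: "complex_on X E" and v: "quasi_iso X E A v"
    and h: "homotopic X E B (f \<circ>\<^sub>c v) (g \<circ>\<^sub>c v)"
    using eq unfolding D_eq_def by blast
  have "homotopic X E C (k \<circ>\<^sub>c (f \<circ>\<^sub>c v)) (k \<circ>\<^sub>c (g \<circ>\<^sub>c v))"
    using homotopic_comp_left[OF E B chain_maps_comp[OF quasi_iso_chain_maps[OF v] g] k h] .
  then show ?thesis
    using E v unfolding D_eq_def comp_map_assoc by blast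
qed

text \<open>A witness for the composites, followed by \<open>u\<close>, is a witness for the maps
  themselves: quasi-isomorphisms can be cancelled on the right.\<close>

lemma D_eq_cancel_quasi_iso:
  fixes A A' :: "('x, 'a) data_complex"
  assumes A: "complex_on X A" and A': "complex_on X A'" and u: "quasi_iso X A' A u"
    and eq: "D_eq X A' B (f \<circ>\<^sub>c u) (g \<circ>\<^sub>c u)"
  shows "D_eq X A B f g"
proof -
  obtain E :: "('x, 'a) data_complex" and v where E: "complex_on X E" and v: "quasi_iso X E A' v"
    and h: "homotopic X E B (f \<circ>\<^sub>c (u \<circ>\<^sub>c v)) (g \<circ>\<^sub>c (u \<circ>\<^sub>c v))"
    using eq unfolding D_eq_def comp_map_assoc by blast
  then show ?thesis
    using quasi_iso_comp[OF E A' A v u] unfolding D_eq_def by blast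
qed

text \<open>The witness of equality lies over \<open>A\<close> and has to be moved to
  \<open>A'\<close>; this is done by the Ore condition for \<open>u\<close> and the witnessing
  quasi-isomorphism. The bound on cardinalities lets the new apex live over the element type of
  \<open>A'\<close>.\<close>

lemma D_eq_comp_right:
  fixes A' :: "('x, 'a::infinite) data_complex" and A :: "('x, 'b) data_complex"
  assumes card: "(UNIV :: 'b set) \<lesssim> (UNIV :: 'a set)"
    and A': "complex_on X A'" and A: "complex_on X A" and B: "complex_on X B"
    and f: "f \<in> chain_maps X A B" and g: "g \<in> chain_maps X A B" and u: "u \<in> chain_maps X A' A"
    and eq: "D_eq X A B f g"
  shows "D_eq X A' B (f \<circ>\<^sub>c u) (g \<circ>\<^sub>c u)"
proof -
  obtain E :: "('x, 'b) data_complex" and v where E: "complex_on X E" and v: "quasi_iso X E A v"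
    and h: "homotopic X E B (f \<circ>\<^sub>c v) (g \<circ>\<^sub>c v)"
    using eq unfolding D_eq_def by blast
  obtain P :: "('x, 'a) data_complex" and w w' where P: "complex_on X P"
    and w: "quasi_iso X P A' w" and w': "w' \<in> chain_maps X P E"
    and hw: "homotopic X P A (u \<circ>\<^sub>c w) (v \<circ>\<^sub>c w')"
    using homotopy_pullbackE[OF card card A' E A u v] .
  note cw = quasi_iso_chain_maps[OF w] and cv = quasi_iso_chain_maps[OF v]
  have vw': "v \<circ>\<^sub>c w' \<in> chain_maps X P A" and uw: "u \<circ>\<^sub>c w \<in> chain_maps X P A"
    using chain_maps_comp[OF w' cv] chain_maps_comp[OF cw u] .
  have "homotopic X P B (f \<circ>\<^sub>c (u \<circ>\<^sub>c w)) (f \<circ>\<^sub>c (v \<circ>\<^sub>c w'))"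
    using homotopic_comp_left[OF P A vw' f hw] .
  moreover have "homotopic X P B (f \<circ>\<^sub>c (v \<circ>\<^sub>c w')) (g \<circ>\<^sub>c (v \<circ>\<^sub>c w'))"
    using homotopic_comp_right[OF w' h] by (simp add: comp_map_assoc)
  moreover have "homotopic X P B (g \<circ>\<^sub>c (v \<circ>\<^sub>c w')) (g \<circ>\<^sub>c (u \<circ>\<^sub>c w))"
    using homotopic_comp_left[OF P A uw g homotopic_sym[OF P A vw' hw]] .
  ultimately have "homotopic X P B (f \<circ>\<^sub>c (u \<circ>\<^sub>c w)) (g \<circ>\<^sub>c (u \<circ>\<^sub>c w))"
    using homotopic_trans[OF P B] chain_maps_comp[OF vw' g] chain_maps_comp[OF uw g] by blast
  then show ?thesis
    using P w unfolding D_eq_def comp_map_assoc by blast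
qed

text \<open>The second equality is restricted along the witness of the first, so that one common
  refinement witnesses both.\<close>

lemma D_eq_trans:
  fixes A :: "('x, 'a::infinite) data_complex"
  assumes A: "complex_on X A" and B: "complex_on X B" and f: "f \<in> chain_maps X A B"
    and g: "g \<in> chain_maps X A B" and h: "h \<in> chain_maps X A B"
    and fg: "D_eq X A B f g" and gh: "D_eq X A B g h"
  shows "D_eq X A B f h"
proof -
  obtain E :: "('x, 'a) data_complex" and v where E: "complex_on X E" and v: "quasi_iso X E A v"
    and hv: "homotopic X E B (f \<circ>\<^sub>c v) (g \<circ>\<^sub>c v)"
    using fg unfolding D_eq_def by blast
  note cv = quasi_iso_chain_maps[OF v]
  have "D_eq X E B (g \<circ>\<^sub>c v) (h \<circ>\<^sub>c v)"
    using D_eq_comp_right[OF lepoll_refl E A B g h cv gh] .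
  then obtain P :: "('x, 'a) data_complex" and w where P: "complex_on X P" and w: "quasi_iso X P E w"
    and hw: "homotopic X P B (g \<circ>\<^sub>c v \<circ>\<^sub>c w) (h \<circ>\<^sub>c v \<circ>\<^sub>c w)"
    unfolding D_eq_def by blast
  have "homotopic X P B (f \<circ>\<^sub>c v \<circ>\<^sub>c w) (h \<circ>\<^sub>c v \<circ>\<^sub>c w)"
    using homotopic_trans[OF P B _ homotopic_comp_right[OF quasi_iso_chain_maps[OF w] hv] hw]
      chain_maps_comp[OF quasi_iso_chain_maps[OF w] chain_maps_comp[OF cv h]] by simp
  then have "D_eq X E B (f \<circ>\<^sub>c v) (h \<circ>\<^sub>c v)"
    using P w unfolding D_eq_def by blast
  then show ?thesis
    by (rule D_eq_cancel_quasi_iso[OF A E v])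
qed

section \<open>Classes of roofs given by chain maps\<close>

lemma mem_roofs_iff:
  "(C, s, f) \<in> roofs X A B \<longleftrightarrow> complex_on X C \<and> quasi_iso X C A s \<and> f \<in> chain_maps X C B"
  by (simp add: roofs_def)

text \<open>Replaces the equivalence of roofs by \<open>D_eq\<close>: a roof represents
  \<open>h\<close> exactly when its right leg is \<open>h\<close> after its left leg, up to a
  quasi-isomorphism into its apex. Composites of classes then become a computation with
  \<open>D_eq\<close>.\<close>

lemma D_of_map_eq:
  fixes A :: "('x, 'a::infinite) data_complex"
  assumes A: "complex_on X A" and B: "complex_on X B" and h: "h \<in> chain_maps X A B"
  shows "D_of_map X A B h = {(C, s, f). (C, s, f) \<in> roofs X A B \<and> D_eq X C B f (h \<circ>\<^sub>c s)}"
proof -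
  have "((A, id_map, h), (C, s, f)) \<in> roof_rel X A B \<longleftrightarrow>
      (C, s, f) \<in> roofs X A B \<and> D_eq X C B f (h \<circ>\<^sub>c s)" for C :: "('x, 'a) data_complex" and s f
  proof
    assume "((A, id_map, h), (C, s, f)) \<in> roof_rel X A B"
    then obtain E :: "('x, 'a) data_complex" and u v where roof: "(C, s, f) \<in> roofs X A B"
      and E: "complex_on X E" and u: "quasi_iso X E A u" and v: "v \<in> chain_maps X E C"
      and usv: "homotopic X E A u (s \<circ>\<^sub>c v)" and hufv: "homotopic X E B (h \<circ>\<^sub>c u) (f \<circ>\<^sub>c v)"
      unfolding roof_rel_def by auto
    have C: "complex_on X C" and s: "quasi_iso X C A s" and f: "f \<in> chain_maps X C B"
      using roof by (auto simp: mem_roofs_iff)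
    have sv: "s \<circ>\<^sub>c v \<in> chain_maps X E A"
      using chain_maps_comp[OF v quasi_iso_chain_maps[OF s]] .
    \<comment> \<open>\<open>u\<close> is a quasi-isomorphism homotopic to s v, so s v is one too,
      and s cancels. Hence the dominating roof is itself a witness for \<open>D_eq\<close>.\<close>
    have v': "quasi_iso X E C v"
      using quasi_iso_cancel_left[OF E C A v s] quasi_iso_homotopic[OF E A u sv usv] .
    have "homotopic X E B (f \<circ>\<^sub>c v) (h \<circ>\<^sub>c u)"
      using homotopic_sym[OF E B chain_maps_comp[OF v f] hufv] .
    moreover have "homotopic X E B (h \<circ>\<^sub>c u) (h \<circ>\<^sub>c (s \<circ>\<^sub>c v))"
      using homotopic_comp_left[OF E A sv h usv] .
    ultimately have "homotopic X E B (f \<circ>\<^sub>c v) (h \<circ>\<^sub>c (s \<circ>\<^sub>c v))"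
      using homotopic_trans[OF E B chain_maps_comp[OF sv h]] by blast
    then show "(C, s, f) \<in> roofs X A B \<and> D_eq X C B f (h \<circ>\<^sub>c s)"
      using roof E v' unfolding D_eq_def comp_map_assoc by blast
  next
    assume *: "(C, s, f) \<in> roofs X A B \<and> D_eq X C B f (h \<circ>\<^sub>c s)"
    then have C: "complex_on X C" and s: "quasi_iso X C A s" and f: "f \<in> chain_maps X C B"
      by (auto simp: mem_roofs_iff)
    obtain E :: "('x, 'a) data_complex" and v where E: "complex_on X E" and v: "quasi_iso X E C v"
      and fv: "homotopic X E B (f \<circ>\<^sub>c v) (h \<circ>\<^sub>c (s \<circ>\<^sub>c v))"
      using * unfolding D_eq_def comp_map_assoc by blast
    note cv = quasi_iso_chain_maps[OF v]
    \<comment> \<open>The witness \<open>E\<close> dominates both roofs when s v is taken as its map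
      to \<open>A\<close> and v as its map to \<open>C\<close>.\<close>
    have sv: "quasi_iso X E A (s \<circ>\<^sub>c v)"
      using quasi_iso_comp[OF E C A v s] .
    note csv = quasi_iso_chain_maps[OF sv]
    have "homotopic X E B (h \<circ>\<^sub>c (s \<circ>\<^sub>c v)) (f \<circ>\<^sub>c v)"
      using homotopic_sym[OF E B chain_maps_comp[OF csv h] fv] .
    moreover have "(A, id_map, h) \<in> roofs X A B"
      using A h quasi_iso_id[OF A] by (simp add: mem_roofs_iff)
    ultimately show "((A, id_map, h), (C, s, f)) \<in> roof_rel X A B"
      unfolding roof_rel_def mem_Collect_eq prod.case id_comp_map
      using * E sv csv cv homotopic_refl[OF E A csv] by blast
  qed
  then show ?thesis
    unfolding D_of_map_def D_class_def by auto
qed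

lemma D_of_map_in_D_hom:
  assumes A: "complex_on X A" and h: "h \<in> chain_maps X A B"
  shows "D_of_map X A B h \<in> D_hom X A B"
  unfolding D_of_map_def D_class_def D_hom_def
  using A h quasi_iso_id[OF A] by (intro quotientI) (simp add: mem_roofs_iff)

text \<open>Makes equality at points and on carriers sufficient, as needed for maps that are total
  functions with arbitrary values elsewhere.\<close>

lemma D_of_map_cong:
  fixes A :: "('x, 'a::infinite) data_complex"
  assumes A: "complex_on X A" and B: "complex_on X B" and g: "g \<in> chain_maps X A B"
    and eq: "\<And>n p x. p \<in> topspace X \<Longrightarrow> x \<in> carrier (grp A n p) \<Longrightarrow> f n p x = g n p x"
  shows "D_of_map X A B f = D_of_map X A B g"
proof -
  have f: "f \<in> chain_maps X A B"
  proof (rule chain_mapsI)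
    show "f n \<in> data_hom X (deg A n) (deg B n)" for n
      using data_hom_cong[OF complex_on_abelian_data[OF A] chain_maps_data_hom[OF g]] eq by blast
  qed (use eq chain_maps_diff[OF g _ refl] complex_on_diff_closed[OF A _ refl] in auto)
  have "D_eq X C B k (f \<circ>\<^sub>c s) \<longleftrightarrow> D_eq X C B k (g \<circ>\<^sub>c s)" if "(C, s, k) \<in> roofs X A B"
    for C :: "('x, 'a) data_complex" and s k
  proof -
    have C: "complex_on X C" and s: "s \<in> chain_maps X C A" and k: "k \<in> chain_maps X C B"
      using that quasi_iso_chain_maps by (auto simp: mem_roofs_iff)
    have fs: "f \<circ>\<^sub>c s \<in> chain_maps X C B" and gs: "g \<circ>\<^sub>c s \<in> chain_maps X C B"
      using chain_maps_comp[OF s f] chain_maps_comp[OF s g] .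
    have "D_eq X C B (f \<circ>\<^sub>c s) (g \<circ>\<^sub>c s)"
      using homotopic_of_eq[OF C B gs] eq chain_maps_closed[OF s]
      by (intro D_eq_of_homotopic C) (simp add: comp_map_def)
    then show ?thesis
      using D_eq_trans[OF C B k] D_eq_sym[OF B gs] fs gs by metis
  qed
  then show ?thesis
    unfolding D_of_map_eq[OF A B f] D_of_map_eq[OF A B g] by blast
qed

text \<open>As \<open>D_comp\<close> is a union over all representatives and all completing squares,
  each of these has to be shown to contribute only roofs representing the composite map. The bound
  on cardinalities is used to pull an equality over a complex of the second type back to the apex of
  the square.\<close>

lemma D_comp_D_of_map:
  fixes A :: "('x, 'a::infinite) data_complex" and B :: "('x, 'b::infinite) data_complex"
    and C :: "('x, 'c) data_complex"
  assumes card: "(UNIV :: 'b set) \<lesssim> (UNIV :: 'a set)"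
    and A: "complex_on X A" and B: "complex_on X B" and C: "complex_on X C"
    and f: "f \<in> chain_maps X A B" and g: "g \<in> chain_maps X B C"
  shows "D_comp X A B C (D_of_map X B C g) (D_of_map X A B f) = D_of_map X A C (g \<circ>\<^sub>c f)"
proof
  note gf = chain_maps_comp[OF f g]
  have refl_mem: "(K, id_map, h) \<in> D_of_map X K M h"
    if K: "complex_on X K" and M: "complex_on X M" and h: "h \<in> chain_maps X K M"
    for K :: "('x, 'k::infinite) data_complex" and M :: "('x, 'm) data_complex" and h
    using K h quasi_iso_id[OF K] D_eq_of_homotopic[OF K homotopic_refl[OF K M h]]
    by (simp add: D_of_map_eq[OF K M h] mem_roofs_iff)
  show "D_of_map X A C (g \<circ>\<^sub>c f) \<subseteq> D_comp X A B C (D_of_map X B C g) (D_of_map X A B f)"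
  proof -
    \<comment> \<open>The square with apex \<open>A\<close>, identity on the left and
      \<open>f\<close> on the right contributes the whole class of the composite.\<close>
    have "D_class X A C (A, id_map \<circ>\<^sub>c id_map, g \<circ>\<^sub>c f)
        \<subseteq> D_comp X A B C (D_of_map X B C g) (D_of_map X A B f)"
      unfolding D_comp_def
      by (intro Union_upper CollectI exI[of _ A] exI[of _ id_map] exI[of _ f] exI[of _ g] conjI refl
          refl_mem[OF A B f] exI[of _ B] refl_mem[OF B C g] A quasi_iso_id f)
        (simp add: homotopic_refl[OF A B f])
    then show ?thesis
      by (simp add: D_of_map_def)
  qed
  show "D_comp X A B C (D_of_map X B C g) (D_of_map X A B f) \<subseteq> D_of_map X A C (g \<circ>\<^sub>c f)"
  proof
    fix r assume "r \<in> D_comp X A B C (D_of_map X B C g) (D_of_map X A B f)"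
    then obtain H :: "('x, 'a) data_complex" and u v s g' and K :: "('x, 'a) data_complex" and f'
        and K' :: "('x, 'b) data_complex" and t where r: "r \<in> D_class X A C (H, s \<circ>\<^sub>c u, g' \<circ>\<^sub>c v)"
      and Kf: "(K, s, f') \<in> D_of_map X A B f" and Kg: "(K', t, g') \<in> D_of_map X B C g"
      and H: "complex_on X H" and u: "quasi_iso X H K u" and v: "v \<in> chain_maps X H K'"
      and hom: "homotopic X H B (f' \<circ>\<^sub>c u) (t \<circ>\<^sub>c v)"
      unfolding D_comp_def by blast
    have K: "complex_on X K" and s: "quasi_iso X K A s" and f': "f' \<in> chain_maps X K B"
      and ff': "D_eq X K B f' (f \<circ>\<^sub>c s)"
      using Kf by (simp_all add: D_of_map_eq[OF A B f] mem_roofs_iff)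
    have K': "complex_on X K'" and t: "quasi_iso X K' B t" and g': "g' \<in> chain_maps X K' C"
      and gg': "D_eq X K' C g' (g \<circ>\<^sub>c t)"
      using Kg by (simp_all add: D_of_map_eq[OF B C g] mem_roofs_iff)
    note cs = quasi_iso_chain_maps[OF s] and ct = quasi_iso_chain_maps[OF t]
      and cu = quasi_iso_chain_maps[OF u]
    note su = quasi_iso_comp[OF H K A u s]
    note csu = quasi_iso_chain_maps[OF su]
    note tv = chain_maps_comp[OF v ct]
    note fsu = chain_maps_comp[OF csu f]
    note f'u = chain_maps_comp[OF cu f']
    \<comment> \<open>The next three steps rewrite the right leg of the composed roof as g' v = g t
      v = g f' u = g f s u: by the second representative, by the square, and by the first
      representative.\<close>
    have 1: "D_eq X H C (g' \<circ>\<^sub>c v) (g \<circ>\<^sub>c (t \<circ>\<^sub>c v))"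
      using D_eq_comp_right[OF card H K' C g' chain_maps_comp[OF ct g] v gg']
      by (simp add: comp_map_assoc)
    have 2: "D_eq X H C (g \<circ>\<^sub>c (t \<circ>\<^sub>c v)) (g \<circ>\<^sub>c (f' \<circ>\<^sub>c u))"
      using D_eq_comp_left[OF B f'u g] D_eq_of_homotopic[OF H homotopic_sym[OF H B tv hom]] by blast
    have 3: "D_eq X H C (g \<circ>\<^sub>c (f' \<circ>\<^sub>c u)) (g \<circ>\<^sub>c (f \<circ>\<^sub>c (s \<circ>\<^sub>c u)))"
      using D_eq_comp_left[OF B fsu g]
        D_eq_comp_right[OF lepoll_refl H K B f' chain_maps_comp[OF cs f] cu ff']
      by (simp add: comp_map_assoc)
    have c: "g' \<circ>\<^sub>c v \<in> chain_maps X H C" "g \<circ>\<^sub>c (t \<circ>\<^sub>c v) \<in> chain_maps X H C"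
      "g \<circ>\<^sub>c (f' \<circ>\<^sub>c u) \<in> chain_maps X H C" "g \<circ>\<^sub>c (f \<circ>\<^sub>c (s \<circ>\<^sub>c u)) \<in> chain_maps X H C"
      using chain_maps_comp[OF v g'] chain_maps_comp[OF tv g] chain_maps_comp[OF f'u g]
        chain_maps_comp[OF fsu g] .
    have eq: "D_eq X H C (g' \<circ>\<^sub>c v) (g \<circ>\<^sub>c f \<circ>\<^sub>c (s \<circ>\<^sub>c u))"
      using D_eq_trans[OF H C c(1,3,4) D_eq_trans[OF H C c(1-3) 1 2] 3] by (simp add: comp_map_assoc)
    obtain D :: "('x, 'a) data_complex" and s' k where rD: "r = (D, s', k)"
      by (cases r) auto
    obtain E :: "('x, 'a) data_complex" and a b where D: "complex_on X D" and s': "quasi_iso X D A s'" and k: "k \<in> chain_maps X D C"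
      and E: "complex_on X E" and a: "a \<in> chain_maps X E H" and b: "b \<in> chain_maps X E D"
      and sa: "quasi_iso X E A (s \<circ>\<^sub>c u \<circ>\<^sub>c a)" and hs: "homotopic X E A (s \<circ>\<^sub>c u \<circ>\<^sub>c a) (s' \<circ>\<^sub>c b)"
      and hk: "homotopic X E C (g' \<circ>\<^sub>c v \<circ>\<^sub>c a) (k \<circ>\<^sub>c b)"
      using r unfolding rD D_class_def roof_rel_def Image_singleton_iff mem_Collect_eq prod.case
        mem_roofs_iff by blast
    note cs' = quasi_iso_chain_maps[OF s']
    note s'b = chain_maps_comp[OF b cs']
    \<comment> \<open>An arbitrary member \<open>r\<close> of the class is compared on the common
      apex \<open>E\<close>. As \<open>b\<close> is a quasi-isomorphism, an equality after
      \<open>b\<close> descends to \<open>D\<close>.\<close>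
    have b': "quasi_iso X E D b"
      using quasi_iso_cancel_left[OF E D A b s' quasi_iso_homotopic[OF E A sa s'b hs]] .
    have 4: "D_eq X E C (k \<circ>\<^sub>c b) (g' \<circ>\<^sub>c v \<circ>\<^sub>c a)"
      using D_eq_of_homotopic[OF E homotopic_sym[OF E C chain_maps_comp[OF b k] hk]] .
    have 5: "D_eq X E C (g' \<circ>\<^sub>c v \<circ>\<^sub>c a) (g \<circ>\<^sub>c f \<circ>\<^sub>c (s \<circ>\<^sub>c u) \<circ>\<^sub>c a)"
      using D_eq_comp_right[OF lepoll_refl E H C c(1) chain_maps_comp[OF csu gf] a eq] .
    have 6: "D_eq X E C (g \<circ>\<^sub>c f \<circ>\<^sub>c (s \<circ>\<^sub>c u) \<circ>\<^sub>c a) (g \<circ>\<^sub>c f \<circ>\<^sub>c s' \<circ>\<^sub>c b)"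
      using D_eq_comp_left[OF A s'b gf D_eq_of_homotopic[OF E hs]] by (simp add: comp_map_assoc)
    have c': "k \<circ>\<^sub>c b \<in> chain_maps X E C" "g' \<circ>\<^sub>c v \<circ>\<^sub>c a \<in> chain_maps X E C"
      "g \<circ>\<^sub>c f \<circ>\<^sub>c (s \<circ>\<^sub>c u) \<circ>\<^sub>c a \<in> chain_maps X E C" "g \<circ>\<^sub>c f \<circ>\<^sub>c s' \<circ>\<^sub>c b \<in> chain_maps X E C"
      using chain_maps_comp[OF b k] chain_maps_comp[OF a c(1)]
        chain_maps_comp[OF a chain_maps_comp[OF csu gf]] chain_maps_comp[OF b chain_maps_comp[OF cs' gf]] .
    have "D_eq X E C (k \<circ>\<^sub>c b) (g \<circ>\<^sub>c f \<circ>\<^sub>c s' \<circ>\<^sub>c b)"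
      using D_eq_trans[OF E C c'(1,3,4) D_eq_trans[OF E C c'(1-3) 4 5] 6] .
    then have "D_eq X D C k (g \<circ>\<^sub>c f \<circ>\<^sub>c s')"
      by (rule D_eq_cancel_quasi_iso[OF D E b'])
    then show "r \<in> D_of_map X A C (g \<circ>\<^sub>c f)"
      using D s' k by (simp add: rD D_of_map_eq[OF A C gf] mem_roofs_iff)
  qed
qed

text \<open>One bound on cardinalities serves each of the two composites. The maps need to be
  mutually inverse on carriers only, thanks to \<open>D_of_map_cong\<close>.\<close>

lemma D_iso_D_of_map:
  fixes A :: "('x, 'a::infinite) data_complex" and B :: "('x, 'b::infinite) data_complex"
  assumes card: "(UNIV :: 'b set) \<lesssim> (UNIV :: 'a set)" "(UNIV :: 'a set) \<lesssim> (UNIV :: 'b set)"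
    and A: "complex_on X A" and B: "complex_on X B"
    and f: "f \<in> chain_maps X A B" and g: "g \<in> chain_maps X B A"
    and gf: "\<And>n p x. p \<in> topspace X \<Longrightarrow> x \<in> carrier (grp A n p) \<Longrightarrow> g n p (f n p x) = x"
    and fg: "\<And>n p y. p \<in> topspace X \<Longrightarrow> y \<in> carrier (grp B n p) \<Longrightarrow> f n p (g n p y) = y"
  shows "D_iso X A B (D_of_map X A B f)"
  unfolding D_iso_def
proof (intro conjI bexI)
  show "D_of_map X A B f \<in> D_hom X A B" "D_of_map X B A g \<in> D_hom X B A"
    using A B f g by (simp_all add: D_of_map_in_D_hom)
  show "D_comp X A B A (D_of_map X B A g) (D_of_map X A B f) = D_of_map X A A id_map"
    unfolding D_comp_D_of_map[OF card(1) A B A f g]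
    using gf by (intro D_of_map_cong A chain_maps_id) (simp add: comp_map_def id_map_def)
  show "D_comp X B A B (D_of_map X A B f) (D_of_map X B A g) = D_of_map X B B id_map"
    unfolding D_comp_D_of_map[OF card(2) B A B g f]
    using fg by (intro D_of_map_cong B chain_maps_id) (simp add: comp_map_def id_map_def)
qed

section \<open>Hom complexes\<close>

lemma topspace_pt [simp]: "topspace pt = UNIV"
  by (simp add: pt_def)

lemma spec_le_pt [simp]: "spec_le pt p q"
  by (simp add: spec_le_def)

context comm_group
begin

lemma sign_pow_closed: "x \<in> carrier G \<Longrightarrow> sign_pow G m x \<in> carrier G"
  by (simp add: sign_pow_def)

lemma sign_pow_mult:
  "x \<in> carrier G \<Longrightarrow> y \<in> carrier G \<Longrightarrow> sign_pow G m (x \<otimes> y) = sign_pow G m x \<otimes> sign_pow G m y"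
  by (simp add: sign_pow_def inv_mult)

lemma sign_pow_one: "sign_pow G m \<one> = \<one>"
  by (simp add: sign_pow_def)

lemma sign_pow_sign_pow:
  "x \<in> carrier G \<Longrightarrow> sign_pow G m (sign_pow G n x) = sign_pow G (m + n) x"
  by (simp add: sign_pow_def)

lemma sign_pow_cancel: "x \<in> carrier G \<Longrightarrow> sign_pow G m x \<otimes> sign_pow G (m + 1) x = \<one>"
  by (simp add: sign_pow_def)

end

lemma sign_pow_cong: "even (m + n) \<Longrightarrow> sign_pow G m x = sign_pow G n x"
  by (simp add: sign_pow_def)

lemma hom_sign_pow:
  assumes "comm_group G" "comm_group H" "h \<in> hom G H" "x \<in> carrier G"
  shows "h (sign_pow G m x) = sign_pow H m (h x)"
  using comm_group_hom_inv[OF assms] by (simp add: sign_pow_def)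

lemma data_hom_sign_pow:
  assumes "abelian_data X G" "f \<in> data_hom X F G"
  shows "(\<lambda>p x. sign_pow (sec G p) m (f p x)) \<in> data_hom X F G"
  using assms data_hom_inv_hom[OF assms] by (cases "even m") (simp_all add: sign_pow_def)

lemma complex_on_sign_pow_closed:
  "complex_on X K \<Longrightarrow> p \<in> topspace X \<Longrightarrow> x \<in> carrier (grp K n p) \<Longrightarrow>
     sign_pow (grp K n p) m x \<in> carrier (grp K n p)"
  using comm_group.sign_pow_closed complex_on_comm_group by metis

lemma complex_on_diff_sign_pow:
  "complex_on X K \<Longrightarrow> p \<in> topspace X \<Longrightarrow> k = n \<Longrightarrow> x \<in> carrier (grp K n p) \<Longrightarrow>
     diff K n p (sign_pow (grp K k p) m x) = sign_pow (grp K (n + 1) p) m (diff K n p x)"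
  by (simp add: sign_pow_def complex_on_diff_inv)

lemma chain_maps_sign_pow:
  "complex_on X A \<Longrightarrow> complex_on X B \<Longrightarrow> f \<in> chain_maps X A B \<Longrightarrow> p \<in> topspace X \<Longrightarrow>
     x \<in> carrier (grp A n p) \<Longrightarrow> f n p (sign_pow (grp A n p) m x) = sign_pow (grp B n p) m (f n p x)"
  by (simp add: sign_pow_def chain_maps_inv)

section \<open>The group of morphisms of a given degree and its differential\<close>

lemma Hom_group_closed:
  "h \<in> carrier (Hom_group X F G n) \<Longrightarrow> m = i + n \<Longrightarrow> p \<in> topspace X \<Longrightarrow> x \<in> carrier (grp F i p) \<Longrightarrow>
     h i p x \<in> carrier (grp G m p)"
  using data_hom_closed by (fastforce simp: Hom_group_def)

lemma Hom_group_data_hom: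
  "h \<in> carrier (Hom_group X F G n) \<Longrightarrow> h i \<in> data_hom X (deg F i) (deg G (i + n))"
  by (simp add: Hom_group_def)

text \<open>The extensionality conditions in \<open>Hom_group\<close> fix all other values, so
  identities between its elements may be checked on elements of the stalks.\<close>

lemma Hom_group_eqI:
  assumes "h \<in> carrier (Hom_group X F G n)" "k \<in> carrier (Hom_group X F G n)"
    and "\<And>i p x. p \<in> topspace X \<Longrightarrow> x \<in> carrier (grp F i p) \<Longrightarrow> h i p x = k i p x"
  shows "h = k"
proof
  fix i show "h i = k i"
  proof (rule extensionalityI[where A = "topspace X"])
    fix p assume "p \<in> topspace X"
    then show "h i p = k i p"
      using assms by (intro extensionalityI[where A = "carrier (grp F i p)"]) (auto simp: Hom_group_def)
  qed (use assms in \<open>auto simp: Hom_group_def\<close>)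
qed

text \<open>The shape shared by the product, the unit, the differential and \<open>Hom_map\<close>;
  being a mere abbreviation, it lets \<open>Hom_restrict_in_Hom_group\<close> apply to each of them
  once its definition is unfolded.\<close>

abbreviation (input) Hom_restrict ::
  "'x topology \<Rightarrow> ('x, 'a) data_complex \<Rightarrow> (int \<Rightarrow> 'x \<Rightarrow> 'a \<Rightarrow> 'b) \<Rightarrow> int \<Rightarrow> 'x \<Rightarrow> 'a \<Rightarrow> 'b" where
  "Hom_restrict X F h \<equiv> (\<lambda>i. \<lambda>p\<in>topspace X. \<lambda>x\<in>carrier (grp F i p). h i p x)"

lemma Hom_restrict_in_Hom_group:
  assumes F: "complex_on X F" and h: "\<And>i. h i \<in> data_hom X (deg F i) (deg G (i + n))"
  shows "Hom_restrict X F h \<in> carrier (Hom_group X F G n)"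
proof -
  have "Hom_restrict X F h i \<in> data_hom X (deg F i) (deg G (i + n))" for i
    by (rule data_hom_cong[OF complex_on_abelian_data[OF F] h]) simp
  then show ?thesis
    by (simp add: Hom_group_def)
qed

lemma mult_Hom_group:
  "h \<otimes>\<^bsub>Hom_group X F G n\<^esub> k = Hom_restrict X F (\<lambda>i p x. h i p x \<otimes>\<^bsub>grp G (i + n) p\<^esub> k i p x)"
  by (simp add: Hom_group_def)

lemma one_Hom_group:
  "\<one>\<^bsub>Hom_group X F G n\<^esub> = Hom_restrict X F (\<lambda>i p x. \<one>\<^bsub>grp G (i + n) p\<^esub>)"
  by (simp add: Hom_group_def)

lemma Hom_diff_apply:
  "p \<in> topspace X \<Longrightarrow> x \<in> carrier (grp F i p) \<Longrightarrow> Hom_diff X F G n h i p x =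
     diff G (i + n) p (h i p x) \<otimes>\<^bsub>grp G (i + (n + 1)) p\<^esub>
       sign_pow (grp G (i + (n + 1)) p) (n + 1) (h (i + 1) p (diff F i p x))"
  by (simp add: Hom_diff_def)

context
  fixes X :: "'x topology" and F :: "('x, 'a) data_complex" and G :: "('x, 'b) data_complex"
  assumes F: "complex_on X F" and G: "complex_on X G"
begin

lemma Hom_group_mult_closed:
  "h \<in> carrier (Hom_group X F G n) \<Longrightarrow> k \<in> carrier (Hom_group X F G n) \<Longrightarrow>
     h \<otimes>\<^bsub>Hom_group X F G n\<^esub> k \<in> carrier (Hom_group X F G n)"
  unfolding mult_Hom_group
  by (intro Hom_restrict_in_Hom_group F data_hom_mult_hom complex_on_abelian_data[OF G] Hom_group_data_hom)

lemma Hom_group_one_closed: "\<one>\<^bsub>Hom_group X F G n\<^esub> \<in> carrier (Hom_group X F G n)"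
  unfolding one_Hom_group
  by (intro Hom_restrict_in_Hom_group F data_hom_trivial complex_on_abelian_data[OF F] complex_on_abelian_data[OF G])

lemma Hom_group_inv_closed:
  assumes "h \<in> carrier (Hom_group X F G n)"
  shows "Hom_restrict X F (\<lambda>i p x. inv\<^bsub>grp G (i + n) p\<^esub> h i p x) \<in> carrier (Hom_group X F G n)"
  using Hom_group_data_hom[OF assms]
  by (intro Hom_restrict_in_Hom_group F data_hom_inv_hom complex_on_abelian_data[OF G])

lemma Hom_group_l_inv:
  assumes "h \<in> carrier (Hom_group X F G n)"
  shows "Hom_restrict X F (\<lambda>i p x. inv\<^bsub>grp G (i + n) p\<^esub> h i p x) \<otimes>\<^bsub>Hom_group X F G n\<^esub> h = \<one>\<^bsub>Hom_group X F G n\<^esub>"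
proof (rule Hom_group_eqI[where G = G and n = n])
  fix i p x assume p: "p \<in> topspace X" and x: "x \<in> carrier (grp F i p)"
  interpret comm_group "grp G (i + n) p" using G p by (rule complex_on_comm_group)
  show "(Hom_restrict X F (\<lambda>i p x. inv\<^bsub>grp G (i + n) p\<^esub> h i p x) \<otimes>\<^bsub>Hom_group X F G n\<^esub> h) i p x
      = \<one>\<^bsub>Hom_group X F G n\<^esub> i p x"
    using p x Hom_group_closed[OF assms refl p x] by (simp add: mult_Hom_group one_Hom_group)
qed (use assms in \<open>simp_all add: Hom_group_mult_closed Hom_group_one_closed Hom_group_inv_closed\<close>)

lemma comm_group_Hom_group: "comm_group (Hom_group X F G n)"
proof (rule comm_groupI)
  fix h k assume h: "h \<in> carrier (Hom_group X F G n)" and k: "k \<in> carrier (Hom_group X F G n)"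
  show "h \<otimes>\<^bsub>Hom_group X F G n\<^esub> k = k \<otimes>\<^bsub>Hom_group X F G n\<^esub> h"
  proof (rule Hom_group_eqI[where G = G and n = n])
    fix i p x assume p: "p \<in> topspace X" and x: "x \<in> carrier (grp F i p)"
    interpret comm_group "grp G (i + n) p" using G p by (rule complex_on_comm_group)
    show "(h \<otimes>\<^bsub>Hom_group X F G n\<^esub> k) i p x = (k \<otimes>\<^bsub>Hom_group X F G n\<^esub> h) i p x"
      using p x Hom_group_closed[OF h refl p x] Hom_group_closed[OF k refl p x]
      by (simp add: mult_Hom_group m_comm)
  qed (use h k in \<open>simp_all add: Hom_group_mult_closed\<close>)
  fix l assume l: "l \<in> carrier (Hom_group X F G n)"
  show "(h \<otimes>\<^bsub>Hom_group X F G n\<^esub> k) \<otimes>\<^bsub>Hom_group X F G n\<^esub> l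
      = h \<otimes>\<^bsub>Hom_group X F G n\<^esub> (k \<otimes>\<^bsub>Hom_group X F G n\<^esub> l)"
  proof (rule Hom_group_eqI[where G = G and n = n])
    fix i p x assume p: "p \<in> topspace X" and x: "x \<in> carrier (grp F i p)"
    interpret comm_group "grp G (i + n) p" using G p by (rule complex_on_comm_group)
    show "((h \<otimes>\<^bsub>Hom_group X F G n\<^esub> k) \<otimes>\<^bsub>Hom_group X F G n\<^esub> l) i p x
      = (h \<otimes>\<^bsub>Hom_group X F G n\<^esub> (k \<otimes>\<^bsub>Hom_group X F G n\<^esub> l)) i p x"
      using p x Hom_group_closed[OF h refl p x] Hom_group_closed[OF k refl p x] Hom_group_closed[OF l refl p x]
      by (simp add: mult_Hom_group m_assoc)
  qed (use h k l in \<open>simp_all add: Hom_group_mult_closed\<close>)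
next
  fix h assume h: "h \<in> carrier (Hom_group X F G n)"
  show "\<one>\<^bsub>Hom_group X F G n\<^esub> \<otimes>\<^bsub>Hom_group X F G n\<^esub> h = h"
  proof (rule Hom_group_eqI[where G = G and n = n])
    fix i p x assume p: "p \<in> topspace X" and x: "x \<in> carrier (grp F i p)"
    interpret comm_group "grp G (i + n) p" using G p by (rule complex_on_comm_group)
    show "(\<one>\<^bsub>Hom_group X F G n\<^esub> \<otimes>\<^bsub>Hom_group X F G n\<^esub> h) i p x = h i p x"
      using p x Hom_group_closed[OF h refl p x] by (simp add: mult_Hom_group one_Hom_group)
  qed (use h in \<open>simp_all add: Hom_group_mult_closed Hom_group_one_closed\<close>)
  show "\<exists>k\<in>carrier (Hom_group X F G n). k \<otimes>\<^bsub>Hom_group X F G n\<^esub> h = \<one>\<^bsub>Hom_group X F G n\<^esub>"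
    using Hom_group_inv_closed[OF h] Hom_group_l_inv[OF h] by blast
qed (simp_all add: Hom_group_mult_closed Hom_group_one_closed)

text \<open>In an iterated Hom complex the outer differential puts a sign on an element of an inner
  Hom group; this moves the sign to the values.\<close>

lemma sign_pow_Hom_group:
  assumes h: "h \<in> carrier (Hom_group X F G n)" and p: "p \<in> topspace X" and x: "x \<in> carrier (grp F i p)"
  shows "sign_pow (Hom_group X F G n) m h i p x = sign_pow (grp G (i + n) p) m (h i p x)"
proof -
  interpret comm_group "Hom_group X F G n" by (rule comm_group_Hom_group)
  have "inv\<^bsub>Hom_group X F G n\<^esub> h = Hom_restrict X F (\<lambda>i p x. inv\<^bsub>grp G (i + n) p\<^esub> h i p x)"
    using Hom_group_l_inv[OF h] h Hom_group_inv_closed[OF h] by (rule inv_equality)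
  then show ?thesis
    using p x by (simp add: sign_pow_def)
qed

lemma Hom_diff_closed:
  assumes h: "h \<in> carrier (Hom_group X F G n)"
  shows "Hom_diff X F G n h \<in> carrier (Hom_group X F G (n + 1))"
  unfolding Hom_diff_def
proof (intro Hom_restrict_in_Hom_group F data_hom_mult_hom data_hom_sign_pow complex_on_abelian_data[OF G])
  fix i
  show "(\<lambda>p x. diff G (i + n) p (h i p x)) \<in> data_hom X (deg F i) (deg G (i + (n + 1)))"
    using data_hom_compose[OF Hom_group_data_hom[OF h] complex_on_diff_hom[OF G, of "i + (n + 1)" "i + n"]]
    by simp
  show "(\<lambda>p x. h (i + 1) p (diff F i p x)) \<in> data_hom X (deg F i) (deg G (i + (n + 1)))"
    using data_hom_compose[OF complex_on_diff_hom[OF F refl] Hom_group_data_hom[OF h, of "i + 1"]]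
    by (simp add: add_ac)
qed

lemma Hom_diff_hom: "Hom_diff X F G n \<in> hom (Hom_group X F G n) (Hom_group X F G (n + 1))"
proof (rule homI)
  fix h k assume h: "h \<in> carrier (Hom_group X F G n)" and k: "k \<in> carrier (Hom_group X F G n)"
  show "Hom_diff X F G n (h \<otimes>\<^bsub>Hom_group X F G n\<^esub> k) =
      Hom_diff X F G n h \<otimes>\<^bsub>Hom_group X F G (n + 1)\<^esub> Hom_diff X F G n k"
  proof (rule Hom_group_eqI[where G = G and n = "n + 1"])
    fix i p x assume p: "p \<in> topspace X" and x: "x \<in> carrier (grp F i p)"
    interpret comm_group "grp G (i + (n + 1)) p" using G p by (rule complex_on_comm_group)
    have dx: "diff F i p x \<in> carrier (grp F (i + 1) p)"
      using F p x by (simp add: complex_on_diff_closed)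
    have cl: "h i p x \<in> carrier (grp G (i + n) p)" "k i p x \<in> carrier (grp G (i + n) p)"
      "h (i + 1) p (diff F i p x) \<in> carrier (grp G (i + (n + 1)) p)"
      "k (i + 1) p (diff F i p x) \<in> carrier (grp G (i + (n + 1)) p)"
      using p x dx by (auto intro: Hom_group_closed[OF h] Hom_group_closed[OF k])
    have dcl: "diff G (i + n) p (h i p x) \<in> carrier (grp G (i + (n + 1)) p)"
      "diff G (i + n) p (k i p x) \<in> carrier (grp G (i + (n + 1)) p)"
      using cl p G by (auto intro: complex_on_diff_closed)
    have 1: "diff G (i + n) p (h i p x \<otimes>\<^bsub>grp G (i + n) p\<^esub> k i p x) =
      diff G (i + n) p (h i p x) \<otimes>\<^bsub>grp G (i + (n + 1)) p\<^esub> diff G (i + n) p (k i p x)"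
      using complex_on_diff_mult[OF G p refl cl(1,2)] by (simp add: add.assoc)
    have 2: "i + 1 + n = i + (n + 1)"
      by simp
    show "Hom_diff X F G n (h \<otimes>\<^bsub>Hom_group X F G n\<^esub> k) i p x =
      (Hom_diff X F G n h \<otimes>\<^bsub>Hom_group X F G (n + 1)\<^esub> Hom_diff X F G n k) i p x"
      using p x dx cl dcl
      by (simp add: mult_Hom_group Hom_diff_apply 1 2 sign_pow_mult sign_pow_closed m_ac del: add.assoc)
  qed (use h k in \<open>simp_all add: Hom_group_mult_closed Hom_diff_closed\<close>)
qed (rule Hom_diff_closed)

text \<open>The terms d d h and h d d vanish, and d h d occurs with the consecutive exponents n + 1
  and n + 2 of the sign, so that it cancels.\<close>

lemma Hom_diff_Hom_diff:
  assumes h: "h \<in> carrier (Hom_group X F G n)"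
  shows "Hom_diff X F G (n + 1) (Hom_diff X F G n h) = \<one>\<^bsub>Hom_group X F G (n + 1 + 1)\<^esub>"
proof (rule Hom_group_eqI[where G = G and n = "n + 1 + 1"])
  fix i p x assume p: "p \<in> topspace X" and x: "x \<in> carrier (grp F i p)"
  \<comment> \<open>Names for the two groups keep their degree expressions fixed while the equations
    are rewritten.\<close>
  define K1 K2 where "K1 = grp G (i + (n + 1)) p" and "K2 = grp G (i + (n + 1 + 1)) p"
  interpret K1: comm_group K1 unfolding K1_def using G p by (rule complex_on_comm_group)
  interpret K2: comm_group K2 unfolding K2_def using G p by (rule complex_on_comm_group)
  define y where "y = diff F i p x"
  have y: "y \<in> carrier (grp F (i + 1) p)"
    using F p x by (simp add: complex_on_diff_closed y_def)
  have dy: "diff F (i + 1) p y = \<one>\<^bsub>grp F (i + 1 + 1) p\<^esub>"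
    using complex_on_diff_diff[OF F p refl x] by (simp add: y_def)
  have h1: "h (i + 1 + 1) p \<one>\<^bsub>grp F (i + 1 + 1) p\<^esub> = \<one>\<^bsub>K2\<^esub>"
    using data_hom_one_eq[OF complex_on_abelian_data[OF F] complex_on_abelian_data[OF G]
        Hom_group_data_hom[OF h, of "i + 1 + 1"] p]
    by (simp add: K2_def add_ac)
  have hx: "h i p x \<in> carrier (grp G (i + n) p)"
    using h p x by (simp add: Hom_group_closed)
  have hy: "h (i + 1) p y \<in> carrier K1"
    unfolding K1_def using Hom_group_closed[OF h _ p y] by (simp add: add_ac)
  define z where "z = diff G (i + (n + 1)) p (h (i + 1) p y)"
  have z: "z \<in> carrier K2"
    unfolding z_def K2_def using hy p G by (intro complex_on_diff_closed) (simp_all add: K1_def)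
  have dhx: "diff G (i + n) p (h i p x) \<in> carrier K1"
    unfolding K1_def using hx p G by (intro complex_on_diff_closed) simp_all
  have ddhx: "diff G (i + (n + 1)) p (diff G (i + n) p (h i p x)) = \<one>\<^bsub>K2\<^esub>"
    using complex_on_diff_diff[OF G p _ hx, of "i + (n + 1)"] by (simp add: K2_def add_ac)
  have G': "i + (n + 1) + 1 = i + (n + 1 + 1)" "i + 1 + n = i + (n + 1)" "i + 1 + (n + 1) = i + (n + 1 + 1)"
    by simp_all
  have 1: "Hom_diff X F G n h i p x = diff G (i + n) p (h i p x) \<otimes>\<^bsub>K1\<^esub> sign_pow K1 (n + 1) (h (i + 1) p y)"
    using Hom_diff_apply[OF p x] by (simp only: K1_def y_def)
  \<comment> \<open>Since y is d x, the term of h at d y is h at the unit and drops out.\<close>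
  have 2: "Hom_diff X F G n h (i + 1) p y = z"
    using Hom_diff_apply[OF p y, where n = n and h = h and G = G] z
    by (simp only: G' K2_def[symmetric] dy h1 K2.sign_pow_one z_def[symmetric] K2.r_one)
  have "Hom_diff X F G (n + 1) (Hom_diff X F G n h) i p x =
      diff G (i + (n + 1)) p (diff G (i + n) p (h i p x) \<otimes>\<^bsub>K1\<^esub> sign_pow K1 (n + 1) (h (i + 1) p y))
      \<otimes>\<^bsub>K2\<^esub> sign_pow K2 (n + 1 + 1) z"
    using Hom_diff_apply[OF p x, where n = "n + 1" and h = "Hom_diff X F G n h" and G = G]
    by (simp only: 1 2 K2_def[symmetric] y_def[symmetric])
  also have "\<dots> = sign_pow K2 (n + 1) z \<otimes>\<^bsub>K2\<^esub> sign_pow K2 (n + 1 + 1) z"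
    using complex_on_diff_mult[OF G p refl, of "diff G (i + n) p (h i p x)" "i + (n + 1)" "sign_pow K1 (n + 1) (h (i + 1) p y)"]
      complex_on_diff_sign_pow[OF G p refl, of "h (i + 1) p y" "i + (n + 1)" "n + 1"]
      dhx hy ddhx z
    by (simp only: K1_def[symmetric] G' K2_def[symmetric] z_def[symmetric] K1.sign_pow_closed
        K2.sign_pow_closed K2.l_one)
  also have "\<dots> = \<one>\<^bsub>K2\<^esub>"
    using z by (rule K2.sign_pow_cancel)
  finally show "Hom_diff X F G (n + 1) (Hom_diff X F G n h) i p x = \<one>\<^bsub>Hom_group X F G (n + 1 + 1)\<^esub> i p x"
    using p x by (simp add: one_Hom_group K2_def)
qed (intro Hom_diff_closed Hom_group_one_closed h)+

end

lemma grp_Hom_complex [simp]: "grp (Hom_complex X F G) n u = Hom_group X F G n"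
  by (simp add: Hom_complex_def)

lemma diff_Hom_complex [simp]: "diff (Hom_complex X F G) n u = Hom_diff X F G n"
  by (simp add: Hom_complex_def)

lemma res_Hom_complex [simp]: "res (deg (Hom_complex X F G) n) u v h = h"
  by (simp add: Hom_complex_def)

lemma complex_on_pt_iff:
  assumes "\<And>n u v x. res (deg K n) u v x = x"
  shows "complex_on pt K \<longleftrightarrow> (\<forall>n. comm_group (grp K n ())) \<and>
     (\<forall>n. diff K n () \<in> hom (grp K n ()) (grp K (n + 1) ())) \<and>
     (\<forall>n. \<forall>x\<in>carrier (grp K n ()). diff K (n + 1) () (diff K n () x) = \<one>\<^bsub>grp K (n + 1 + 1) ()\<^esub>)"
proof -
  have all: "(\<forall>u :: unit. P u) \<longleftrightarrow> P ()" for P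
    by (metis unit.exhaust)
  show ?thesis
    by (auto simp: complex_on_def abelian_data_def data_hom_def assms hom_def Pi_iff all)
qed

lemma complex_on_Hom_complex:
  assumes "complex_on X F" "complex_on X G"
  shows "complex_on pt (Hom_complex X F G)"
  using assms by (simp add: complex_on_pt_iff comm_group_Hom_group Hom_diff_hom Hom_diff_Hom_diff)

lemma grp_stalk [simp]: "grp (stalk K p) n u = grp K n p"
  and diff_stalk [simp]: "diff (stalk K p) n u = diff K n p"
  and res_stalk [simp]: "res (deg (stalk K p) n) u v x = x"
  by (simp_all add: stalk_def)

lemma complex_on_stalk:
  assumes "complex_on X K" "p \<in> topspace X"
  shows "complex_on pt (stalk K p)"
  using assms data_hom_hom[OF complex_on_diff_hom[OF assms(1) refl] assms(2)]
  by (simp add: complex_on_pt_iff complex_on_comm_group[OF assms] complex_on_diff_diff)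

section \<open>Functoriality of Hom complexes\<close>

lemma Hom_map_apply:
  "p \<in> topspace X \<Longrightarrow> x \<in> carrier (grp F i p) \<Longrightarrow>
     Hom_map X F a b n u h i p x = b (i + n) p (h i p (a i p x))"
  by (simp add: Hom_map_def)

lemma Hom_map_closed:
  assumes F: "complex_on X F" and a: "a \<in> chain_maps X F F'" and b: "b \<in> chain_maps X G G'"
    and h: "h \<in> carrier (Hom_group X F' G n)"
  shows "Hom_map X F a b n u h \<in> carrier (Hom_group X F G' n)"
  unfolding Hom_map_def
  using data_hom_compose[OF data_hom_compose[OF chain_maps_data_hom[OF a] Hom_group_data_hom[OF h]]
      chain_maps_data_hom[OF b]]
  by (intro Hom_restrict_in_Hom_group F)

text \<open>Both \<open>a\<close> and \<open>b\<close> have degree 0, so no new sign appears when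
  they pass the differentials; \<open>b\<close> respects the existing sign because it is
  additive.\<close>

lemma Hom_map_chain_maps:
  assumes F: "complex_on X F" and F': "complex_on X F'" and G: "complex_on X G" and G': "complex_on X G'"
    and a: "a \<in> chain_maps X F F'" and b: "b \<in> chain_maps X G G'"
  shows "Hom_map X F a b \<in> chain_maps pt (Hom_complex X F' G) (Hom_complex X F G')"
proof (rule chain_mapsI)
  fix n
  show "Hom_map X F a b n \<in> data_hom pt (deg (Hom_complex X F' G) n) (deg (Hom_complex X F G') n)"
  proof (rule data_homI)
    fix u
    show "Hom_map X F a b n u \<in> hom (grp (Hom_complex X F' G) n u) (grp (Hom_complex X F G') n u)"
    proof (rule homI)
      fix h k assume "h \<in> carrier (grp (Hom_complex X F' G) n u)" "k \<in> carrier (grp (Hom_complex X F' G) n u)"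
      then have h: "h \<in> carrier (Hom_group X F' G n)" and k: "k \<in> carrier (Hom_group X F' G n)"
        by simp_all
      have "Hom_map X F a b n u (h \<otimes>\<^bsub>Hom_group X F' G n\<^esub> k) =
          Hom_map X F a b n u h \<otimes>\<^bsub>Hom_group X F G' n\<^esub> Hom_map X F a b n u k"
      proof (rule Hom_group_eqI[where G = G' and n = n])
        fix i p x assume p: "p \<in> topspace X" and x: "x \<in> carrier (grp F i p)"
        then have ax: "a i p x \<in> carrier (grp F' i p)"
          by (rule chain_maps_closed[OF a])
        show "Hom_map X F a b n u (h \<otimes>\<^bsub>Hom_group X F' G n\<^esub> k) i p x =
          (Hom_map X F a b n u h \<otimes>\<^bsub>Hom_group X F G' n\<^esub> Hom_map X F a b n u k) i p x"
          using p x ax chain_maps_mult[OF b p Hom_group_closed[OF h refl p ax] Hom_group_closed[OF k refl p ax]]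
          by (simp add: mult_Hom_group Hom_map_apply)
      qed (use F F' G G' h k a b in \<open>simp_all add: Hom_map_closed[OF F a b] Hom_group_mult_closed\<close>)
      then show "Hom_map X F a b n u (h \<otimes>\<^bsub>grp (Hom_complex X F' G) n u\<^esub> k) =
          Hom_map X F a b n u h \<otimes>\<^bsub>grp (Hom_complex X F G') n u\<^esub> Hom_map X F a b n u k"
        by simp
    qed (use Hom_map_closed[OF F a b] in simp)
  qed (simp add: Hom_map_def)
next
  fix n u h assume "h \<in> carrier (grp (Hom_complex X F' G) n u)"
  then have h: "h \<in> carrier (Hom_group X F' G n)"
    by simp
  have "Hom_map X F a b (n + 1) u (Hom_diff X F' G n h) = Hom_diff X F G' n (Hom_map X F a b n u h)"
  proof (rule Hom_group_eqI[where G = G' and n = "n + 1"])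
    fix i p x assume p: "p \<in> topspace X" and x: "x \<in> carrier (grp F i p)"
    have ax: "a i p x \<in> carrier (grp F' i p)" and dx: "diff F i p x \<in> carrier (grp F (i + 1) p)"
      using p x a F by (auto intro: chain_maps_closed complex_on_diff_closed)
    have dax: "a (i + 1) p (diff F i p x) = diff F' i p (a i p x)"
      using chain_maps_diff[OF a p refl x] by simp
    have dax': "diff F' i p (a i p x) \<in> carrier (grp F' (i + 1) p)"
      using complex_on_diff_closed[OF F' p refl ax] .
    have c1: "h i p (a i p x) \<in> carrier (grp G (i + n) p)"
      "diff G (i + n) p (h i p (a i p x)) \<in> carrier (grp G (i + (n + 1)) p)"
      using Hom_group_closed[OF h refl p ax] complex_on_diff_closed[OF G p, of "i + (n + 1)" "i + n"] by auto
    have c2: "h (i + 1) p (diff F' i p (a i p x)) \<in> carrier (grp G (i + (n + 1)) p)"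
      using Hom_group_closed[OF h _ p dax'] by (simp add: add_ac)
    have d: "b (i + (n + 1)) p (diff G (i + n) p (h i p (a i p x))) = diff G' (i + n) p (b (i + n) p (h i p (a i p x)))"
      using chain_maps_diff[OF b p _ c1(1), of "i + (n + 1)"] by simp
    have e: "i + 1 + n = i + (n + 1)"
      by simp
    show "Hom_map X F a b (n + 1) u (Hom_diff X F' G n h) i p x
        = Hom_diff X F G' n (Hom_map X F a b n u h) i p x"
      by (simp only: Hom_map_apply[OF p x] Hom_map_apply[OF p dx] Hom_diff_apply[OF p x] Hom_diff_apply[OF p ax]
          dax d e chain_maps_mult[OF b p c1(2) complex_on_sign_pow_closed[OF G p c2]]
          chain_maps_sign_pow[OF G G' b p c2])
  qed (use F F' G G' h a b in \<open>simp_all add: Hom_map_closed[OF F a b] Hom_diff_closed\<close>)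
  then show "Hom_map X F a b (n + 1) u (diff (Hom_complex X F' G) n u h) =
      diff (Hom_complex X F G') n u (Hom_map X F a b n u h)"
    by simp
qed

section \<open>Locally constant data and the dual space\<close>

lemma abelian_data_res_id:
  "abelian_data X F \<Longrightarrow> p \<in> topspace X \<Longrightarrow> x \<in> carrier (sec F p) \<Longrightarrow> res F p p x = x"
  by (simp add: abelian_data_def)

lemma abelian_data_res_res:
  "abelian_data X F \<Longrightarrow> spec_le X p q \<Longrightarrow> spec_le X q r \<Longrightarrow> x \<in> carrier (sec F p) \<Longrightarrow>
     res F q r (res F p q x) = res F p r x"
  by (simp add: abelian_data_def)

lemma spec_le_refl: "p \<in> topspace X \<Longrightarrow> spec_le X p p"
  by (simp add: spec_le_def)

lemma spec_le_trans: "spec_le X p q \<Longrightarrow> spec_le X q r \<Longrightarrow> spec_le X p r"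
  by (auto simp: spec_le_def)

lemma sec_dual_data [simp]: "sec (dual_data L) p = sec L p"
  by (simp add: dual_data_def)

lemma deg_dual_complex [simp]: "deg (dual_complex L) n = dual_data (deg L n)"
  by (simp add: dual_complex_def)

lemma diff_dual_complex [simp]: "diff (dual_complex L) = diff L"
  by (simp add: dual_complex_def)

lemma stalk_dual_complex [simp]: "stalk (dual_complex L) p = stalk L p"
  by (simp add: stalk_def)

context
  fixes X :: "'x topology" and L :: "('x, 'c) ab_data"
  assumes L: "locally_constant X L"
begin

lemma locally_constant_abelian_data: "abelian_data X L"
  using L by (simp add: locally_constant_def)

lemma locally_constant_iso: "spec_le X p q \<Longrightarrow> res L p q \<in> iso (sec L p) (sec L q)"
  using L by (simp add: locally_constant_def)

lemma dual_data_res_iso: "spec_le X p q \<Longrightarrow> res (dual_data L) q p \<in> iso (sec L q) (sec L p)"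
  using locally_constant_iso[of p q] abelian_data_comm_group[OF locally_constant_abelian_data, of p]
    spec_le_in_topspace(1)[of X p q]
  by (simp add: dual_data_def group.iso_set_sym comm_group_def)

lemma dual_data_res_closed:
  "spec_le X p q \<Longrightarrow> x \<in> carrier (sec L q) \<Longrightarrow> res (dual_data L) q p x \<in> carrier (sec L p)"
  using dual_data_res_iso[of p q] by (auto simp: iso_def hom_def)

lemma res_dual_data_res:
  "spec_le X p q \<Longrightarrow> x \<in> carrier (sec L q) \<Longrightarrow> res L p q (res (dual_data L) q p x) = x"
  using locally_constant_iso[of p q] by (auto simp: dual_data_def iso_def bij_betw_def f_inv_into_f)

lemma dual_data_res_res:
  "spec_le X p q \<Longrightarrow> x \<in> carrier (sec L p) \<Longrightarrow> res (dual_data L) q p (res L p q x) = x"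
  using locally_constant_iso[of p q] by (auto simp: dual_data_def iso_def bij_betw_def inv_into_f_f)

lemma dual_data_res_eqI:
  "spec_le X p q \<Longrightarrow> y \<in> carrier (sec L p) \<Longrightarrow> res L p q y = x \<Longrightarrow> res (dual_data L) q p x = y"
  using dual_data_res_res by blast

text \<open>An inverse of an inverse taken with \<open>inv_into\<close> is determined on the carrier
  only, so the double dual need not be the record one started with.\<close>

lemma dual_dual_data_res:
  assumes "spec_le X p q" "x \<in> carrier (sec L p)"
  shows "res (dual_data (dual_data L)) p q x = res L p q x"
proof -
  have "bij_betw (res (dual_data L) q p) (carrier (sec L q)) (carrier (sec L p))"
    using dual_data_res_iso[OF assms(1)] by (simp add: iso_def)
  moreover have "res L p q x \<in> carrier (sec L q)"
    using abelian_data_res_closed[OF locally_constant_abelian_data assms] .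
  ultimately show ?thesis
    using dual_data_res_res[OF assms]
    by (simp add: dual_data_def[of "dual_data L"] bij_betw_def inv_into_f_eq)
qed

lemma locally_constant_dual_data:
  assumes fin: "finite (topspace X)"
  shows "locally_constant (dual_space X) (dual_data L)"
proof -
  note ab = locally_constant_abelian_data
  have "abelian_data (dual_space X) (dual_data L)"
    unfolding abelian_data_def
  proof (intro conjI allI ballI impI)
    fix p q r x assume "spec_le (dual_space X) p q" "spec_le (dual_space X) q r"
      and x: "x \<in> carrier (sec (dual_data L) p)"
    then have qp: "spec_le X q p" and rq: "spec_le X r q"
      using spec_le_dual_space[OF fin] by auto
    \<comment> \<open>Both sides are preimages of x under the isomorphism from the stalk at r to the
      stalk at p, and such a preimage is unique.\<close>
    have "res (dual_data L) p r x = res (dual_data L) q r (res (dual_data L) p q x)"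
      using x qp rq abelian_data_res_res[OF ab rq qp]
      by (intro dual_data_res_eqI spec_le_trans[OF rq qp])
        (simp_all add: dual_data_res_closed res_dual_data_res flip: abelian_data_res_res[OF ab rq qp])
    then show "res (dual_data L) q r (res (dual_data L) p q x) = res (dual_data L) p r x" ..
  qed (use fin ab abelian_data_comm_group[OF ab] dual_data_res_iso in
      \<open>auto simp: topspace_dual_space spec_le_dual_space iso_def spec_le_refl
        intro!: dual_data_res_eqI abelian_data_res_id[OF ab]\<close>)
  then show ?thesis
    using fin dual_data_res_iso by (simp add: locally_constant_def spec_le_dual_space)
qed

end

text \<open>A map commuting with isomorphisms commutes with their inverses.\<close>

lemma data_hom_dual_data:
  assumes fin: "finite (topspace X)" and L: "locally_constant X L" and M: "locally_constant X M"
    and f: "f \<in> data_hom X L M"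
  shows "f \<in> data_hom (dual_space X) (dual_data L) (dual_data M)"
proof (rule data_homI)
  show "f p \<in> hom (sec (dual_data L) p) (sec (dual_data M) p)" if "p \<in> topspace (dual_space X)" for p
    using that f fin by (simp add: topspace_dual_space data_hom_hom)
  fix p q x assume "spec_le (dual_space X) p q" and x: "x \<in> carrier (sec (dual_data L) p)"
  then have qp: "spec_le X q p"
    using fin by (simp add: spec_le_dual_space)
  have y: "res (dual_data L) p q x \<in> carrier (sec L q)"
    using dual_data_res_closed[OF L qp] x by simp
  have "res (dual_data M) p q (f p x) = f q (res (dual_data L) p q x)"
    using x data_hom_res[OF f qp y] data_hom_closed[OF f _ y] spec_le_in_topspace[OF qp]
    by (intro dual_data_res_eqI[OF M qp]) (simp_all add: res_dual_data_res[OF L qp])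
  then show "f q (res (dual_data L) p q x) = res (dual_data M) p q (f p x)" ..
qed

lemma locally_constant_complex_deg: "locally_constant_complex X L \<Longrightarrow> locally_constant X (deg L n)"
  and locally_constant_complex_on: "locally_constant_complex X L \<Longrightarrow> complex_on X L"
  by (simp_all add: locally_constant_complex_def)

lemma locally_constant_dual_complex:
  assumes fin: "finite (topspace X)" and L: "locally_constant_complex X L"
  shows "locally_constant_complex (dual_space X) (dual_complex L)"
proof -
  note lc = locally_constant_complex_deg[OF L] and LX = locally_constant_complex_on[OF L]
  have "complex_on (dual_space X) (dual_complex L)"
    unfolding complex_on_def
    using locally_constant_dual_data[OF lc fin] data_hom_dual_data[OF fin lc lc complex_on_diff_hom[OF LX]]
      complex_on_diff_diff[OF LX]
    by (auto simp: locally_constant_def topspace_dual_space[OF fin])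
  then show ?thesis
    using locally_constant_dual_data[OF lc fin] by (simp add: locally_constant_complex_def)
qed

lemma chain_maps_dual_complex:
  assumes fin: "finite (topspace X)" and L: "locally_constant_complex X L"
    and M: "locally_constant_complex X M" and l: "l \<in> chain_maps X L M"
  shows "l \<in> chain_maps (dual_space X) (dual_complex L) (dual_complex M)"
  using data_hom_dual_data[OF fin locally_constant_complex_deg[OF L] locally_constant_complex_deg[OF M]
      chain_maps_data_hom[OF l]] chain_maps_diff[OF l _ refl]
  by (intro chain_mapsI) (auto simp: topspace_dual_space[OF fin])

section \<open>Stalks and the complex of stalkwise Homs on the dual space\<close>

lemma chain_maps_stalkI:
  assumes "\<And>n. f n () \<in> hom (grp A n p) (grp B n q)"
    and "\<And>n x. x \<in> carrier (grp A n p) \<Longrightarrow> f (n + 1) () (diff A n p x) = diff B n q (f n () x)"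
  shows "f \<in> chain_maps pt (stalk A p) (stalk B q)"
  using assms by (intro chain_mapsI data_homI) auto

lemma stalk_chain_maps:
  assumes "f \<in> chain_maps X A B" "p \<in> topspace X"
  shows "(\<lambda>i _. f i p) \<in> chain_maps pt (stalk A p) (stalk B p)"
  using assms chain_maps_diff[OF assms refl]
  by (intro chain_maps_stalkI) (simp_all add: data_hom_hom[OF chain_maps_data_hom])

lemma stalk_res_chain_maps:
  assumes K: "complex_on X K" and pq: "spec_le X p q"
  shows "(\<lambda>i _. res (deg K i) p q) \<in> chain_maps pt (stalk K p) (stalk K q)"
  using abelian_data_res_hom[OF complex_on_abelian_data[OF K] pq]
    data_hom_res[OF complex_on_diff_hom[OF K refl] pq]
  by (intro chain_maps_stalkI) simp_all

lemma grp_Hom_hat [simp]: "grp (Hom_hat P L) n p = Hom_group pt (stalk P p) (stalk L p) n"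
  by (simp add: Hom_hat_def)

lemma diff_Hom_hat [simp]: "diff (Hom_hat P L) n p = Hom_diff pt (stalk P p) (stalk L p) n"
  by (simp add: Hom_hat_def)

text \<open>Presents the restriction as the map induced on stalkwise Hom complexes by a restriction
  of \<open>P\<close> and one of the dual of \<open>L\<close>, so that its compatibility with group
  structure and differentials comes from functoriality of Hom.\<close>

lemma res_Hom_hat:
  "res (deg (Hom_hat P L) n) p q =
     Hom_map pt (stalk P q) (\<lambda>i _. res (deg P i) q p) (\<lambda>i _. res (deg (dual_complex L) i) p q) n ()"
  by (simp add: Hom_hat_def Hom_map_def dual_data_def fun_eq_iff)

lemma res_Hom_hat_apply:
  "x \<in> carrier (grp P j q) \<Longrightarrow> res (deg (Hom_hat P L) n) p q h j u x =
     res (dual_data (deg L (j + n))) p q (h j u (res (deg P j) q p x))"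
  by (simp add: res_Hom_hat Hom_map_apply)

lemma Hom_hat_map_apply:
  "x \<in> carrier (grp P j p) \<Longrightarrow> Hom_hat_map P a b n p h j u x = b (j + n) p (h j u (a j p x))"
  by (simp add: Hom_hat_map_def Hom_map_apply)

lemma Hom_hat_res_chain_maps:
  assumes fin: "finite (topspace X)" and P: "complex_on X P" and L: "locally_constant_complex X L"
    and pq: "spec_le (dual_space X) p q"
  shows "(\<lambda>n _. res (deg (Hom_hat P L) n) p q) \<in>
    chain_maps pt (Hom_complex pt (stalk P p) (stalk L p)) (Hom_complex pt (stalk P q) (stalk L q))"
proof -
  have qp: "spec_le X q p"
    using pq fin by (simp add: spec_le_dual_space)
  note LX = locally_constant_complex_on[OF L]
    and dL = locally_constant_complex_on[OF locally_constant_dual_complex[OF fin L]]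
  have "(\<lambda>i _. res (deg (dual_complex L) i) p q) \<in> chain_maps pt (stalk L p) (stalk L q)"
    using stalk_res_chain_maps[OF dL pq] by simp
  then have "Hom_map pt (stalk P q) (\<lambda>i _. res (deg P i) q p) (\<lambda>i _. res (deg (dual_complex L) i) p q) \<in>
    chain_maps pt (Hom_complex pt (stalk P p) (stalk L p)) (Hom_complex pt (stalk P q) (stalk L q))"
    using P LX stalk_res_chain_maps[OF P qp] spec_le_in_topspace[OF qp]
    by (intro Hom_map_chain_maps complex_on_stalk)
  moreover have "Hom_map pt (stalk P q) (\<lambda>i _. res (deg P i) q p) (\<lambda>i _. res (deg (dual_complex L) i) p q) =
      (\<lambda>n _. res (deg (Hom_hat P L) n) p q)"
    by (simp add: res_Hom_hat fun_eq_iff)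
  ultimately show ?thesis
    by simp
qed

text \<open>Restriction in \<open>P\<close> enters contravariantly and restriction in the dual of
  \<open>L\<close> covariantly, so the functor laws of both combine to those over the opposite
  preorder.\<close>

lemma complex_on_Hom_hat:
  assumes fin: "finite (topspace X)" and P: "complex_on X P" and L: "locally_constant_complex X L"
  shows "complex_on (dual_space X) (Hom_hat P L)"
proof -
  note LX = locally_constant_complex_on[OF L]
  have Px: "complex_on pt (stalk P p)" and Lx: "complex_on pt (stalk L p)" if "p \<in> topspace (dual_space X)" for p
    using that P LX fin by (auto simp: topspace_dual_space intro: complex_on_stalk)
  note dL = complex_on_abelian_data[OF locally_constant_complex_on[OF locally_constant_dual_complex[OF fin L]]]
  note PX = complex_on_abelian_data[OF P]
  have res_hom: "res (deg (Hom_hat P L) n) p q \<in> hom (grp (Hom_hat P L) n p) (grp (Hom_hat P L) n q)"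
    if pq: "spec_le (dual_space X) p q" for n p q
    using data_hom_hom[OF chain_maps_data_hom[OF Hom_hat_res_chain_maps[OF fin P L pq], of n], of "()"]
    by simp
  have "abelian_data (dual_space X) (deg (Hom_hat P L) n)" for n
    unfolding abelian_data_def
  proof (intro conjI allI ballI impI)
    fix p assume p: "p \<in> topspace (dual_space X)"
    show "comm_group (grp (Hom_hat P L) n p)"
      using Px[OF p] Lx[OF p] by (simp add: comm_group_Hom_group)
    fix h assume "h \<in> carrier (grp (Hom_hat P L) n p)"
    then have h: "h \<in> carrier (Hom_group pt (stalk P p) (stalk L p) n)"
      by simp
    show "res (deg (Hom_hat P L) n) p p h = h"
    proof (rule Hom_group_eqI[OF _ h])
      show "res (deg (Hom_hat P L) n) p p h \<in> carrier (Hom_group pt (stalk P p) (stalk L p) n)"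
        using res_hom[OF spec_le_refl[OF p]] h by (auto simp: hom_def)
      fix j u y assume y: "y \<in> carrier (grp (stalk P p) j u)"
      show "res (deg (Hom_hat P L) n) p p h j u y = h j u y"
        using y p fin abelian_data_res_id[OF PX] abelian_data_res_id[OF dL p] Hom_group_closed[OF h refl, of u y j]
        by (simp add: res_Hom_hat_apply topspace_dual_space)
    qed
  next
    fix p q r h assume pq: "spec_le (dual_space X) p q" and qr: "spec_le (dual_space X) q r"
      and "h \<in> carrier (grp (Hom_hat P L) n p)"
    then have h: "h \<in> carrier (Hom_group pt (stalk P p) (stalk L p) n)"
      by simp
    have qp: "spec_le X q p" and rq: "spec_le X r q"
      using pq qr fin by (simp_all add: spec_le_dual_space)
    show "res (deg (Hom_hat P L) n) q r (res (deg (Hom_hat P L) n) p q h) = res (deg (Hom_hat P L) n) p r h"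
    proof (rule Hom_group_eqI[where G = "stalk L r" and n = n])
      fix j u y assume "y \<in> carrier (grp (stalk P r) j u)"
      then have y: "y \<in> carrier (grp P j r)"
        by simp
      have ry: "res (deg P j) r q y \<in> carrier (grp P j q)"
        using abelian_data_res_closed[OF PX rq y] .
      have rry: "res (deg P j) r p y \<in> carrier (grp P j p)"
        using abelian_data_res_closed[OF PX spec_le_trans[OF rq qp] y] .
      have hy: "h j u (res (deg P j) r p y) \<in> carrier (grp L (j + n) p)"
        using Hom_group_closed[OF h refl, of u "res (deg P j) r p y" j] rry by simp
      show "res (deg (Hom_hat P L) n) q r (res (deg (Hom_hat P L) n) p q h) j u y
          = res (deg (Hom_hat P L) n) p r h j u y"
        using y ry hy abelian_data_res_res[OF PX rq qp y] abelian_data_res_res[OF dL pq qr, of _ "j + n"]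
        by (simp add: res_Hom_hat_apply)
    qed (use h res_hom[OF pq, of n] res_hom[OF qr, of n] res_hom[OF spec_le_trans[OF pq qr], of n] in
        \<open>auto simp: hom_def Pi_iff\<close>)
  qed (rule res_hom)
  moreover have "diff (Hom_hat P L) n \<in> data_hom (dual_space X) (deg (Hom_hat P L) n) (deg (Hom_hat P L) (n + 1))" for n
  proof (rule data_homI)
    show "diff (Hom_hat P L) n p \<in> hom (grp (Hom_hat P L) n p) (grp (Hom_hat P L) (n + 1) p)"
      if "p \<in> topspace (dual_space X)" for p
      using Hom_diff_hom[OF Px[OF that] Lx[OF that]] by simp
    show "diff (Hom_hat P L) n q (res (deg (Hom_hat P L) n) p q h) =
        res (deg (Hom_hat P L) (n + 1)) p q (diff (Hom_hat P L) n p h)"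
      if "spec_le (dual_space X) p q" "h \<in> carrier (grp (Hom_hat P L) n p)" for p q h
      using chain_maps_diff[OF Hom_hat_res_chain_maps[OF fin P L that(1)], of "()" "n + 1" n h] that(2)
      by simp
  qed
  ultimately show ?thesis
    unfolding complex_on_def using Hom_diff_Hom_diff[OF Px Lx] by simp
qed

text \<open>On each stalk this is functoriality of Hom. Across stalks, \<open>f\<close> commutes
  with the restrictions of \<open>P\<close>, and \<open>l\<close> with the inverted ones of
  \<open>L\<close> by \<open>chain_maps_dual_complex\<close>.\<close>

lemma Hom_hat_map_chain_maps:
  assumes fin: "finite (topspace X)" and P: "complex_on X P" and P': "complex_on X P'"
    and L: "locally_constant_complex X L" and L': "locally_constant_complex X L'"
    and f: "f \<in> chain_maps X P P'" and l: "l \<in> chain_maps X L L'"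
  shows "Hom_hat_map P f l \<in> chain_maps (dual_space X) (Hom_hat P' L) (Hom_hat P L')"
proof -
  note LX = locally_constant_complex_on[OF L] and LX' = locally_constant_complex_on[OF L']
  have ch: "(\<lambda>n _. Hom_hat_map P f l n p) \<in>
      chain_maps pt (Hom_complex pt (stalk P' p) (stalk L p)) (Hom_complex pt (stalk P p) (stalk L' p))"
    if "p \<in> topspace X" for p
  proof -
    have "Hom_map pt (stalk P p) (\<lambda>i _. f i p) (\<lambda>i _. l i p) \<in>
      chain_maps pt (Hom_complex pt (stalk P' p) (stalk L p)) (Hom_complex pt (stalk P p) (stalk L' p))"
      using that P P' LX LX' f l by (intro Hom_map_chain_maps complex_on_stalk stalk_chain_maps)
    moreover have "Hom_map pt (stalk P p) (\<lambda>i _. f i p) (\<lambda>i _. l i p) = (\<lambda>n _. Hom_hat_map P f l n p)"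
      by (simp add: Hom_hat_map_def fun_eq_iff)
    ultimately show ?thesis
      by simp
  qed
  have hom: "Hom_hat_map P f l n p \<in> hom (grp (Hom_hat P' L) n p) (grp (Hom_hat P L') n p)"
    if "p \<in> topspace X" for n p
    using data_hom_hom[OF chain_maps_data_hom[OF ch[OF that], of n], of "()"] by simp
  note H = complex_on_abelian_data[OF complex_on_Hom_hat[OF fin P' L]]
    and H' = complex_on_abelian_data[OF complex_on_Hom_hat[OF fin P L']]
  show ?thesis
  proof (intro chain_mapsI data_homI)
    fix n p q h assume pq: "spec_le (dual_space X) p q" and h: "h \<in> carrier (grp (Hom_hat P' L) n p)"
    then have qp: "spec_le X q p"
      using fin by (simp add: spec_le_dual_space)
    note pX = spec_le_in_topspace[OF qp]
    have h': "h \<in> carrier (Hom_group pt (stalk P' p) (stalk L p) n)"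
      using h by simp
    show "Hom_hat_map P f l n q (res (deg (Hom_hat P' L) n) p q h) =
        res (deg (Hom_hat P L') n) p q (Hom_hat_map P f l n p h)"
    proof (rule Hom_group_eqI[where G = "stalk L' q" and n = n])
      fix j u y assume "y \<in> carrier (grp (stalk P q) j u)"
      then have y: "y \<in> carrier (grp P j q)"
        by simp
      have c: "f j q y \<in> carrier (grp P' j q)" "res (deg P j) q p y \<in> carrier (grp P j p)"
        using chain_maps_closed[OF f pX(1) y] abelian_data_res_closed[OF complex_on_abelian_data[OF P] qp y] .
      have c': "res (deg P' j) q p (f j q y) \<in> carrier (grp P' j p)"
        using abelian_data_res_closed[OF complex_on_abelian_data[OF P'] qp c(1)] .
      have hc: "h j u (res (deg P' j) q p (f j q y)) \<in> carrier (grp L (j + n) p)"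
        using Hom_group_closed[OF h' refl, of u _ j] c' by simp
      show "Hom_hat_map P f l n q (res (deg (Hom_hat P' L) n) p q h) j u y =
        res (deg (Hom_hat P L') n) p q (Hom_hat_map P f l n p h) j u y"
        using y c hc data_hom_res[OF chain_maps_data_hom[OF f] qp y]
          data_hom_res[OF chain_maps_data_hom[OF chain_maps_dual_complex[OF fin L L' l]] pq]
        by (simp add: Hom_hat_map_apply res_Hom_hat_apply)
    next
      show "Hom_hat_map P f l n q (res (deg (Hom_hat P' L) n) p q h) \<in> carrier (Hom_group pt (stalk P q) (stalk L' q) n)"
        using hom[OF pX(1), of n] abelian_data_res_closed[OF H pq h] by (auto simp: hom_def Pi_iff)
      show "res (deg (Hom_hat P L') n) p q (Hom_hat_map P f l n p h) \<in> carrier (Hom_group pt (stalk P q) (stalk L' q) n)"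
        using hom[OF pX(2), of n] h abelian_data_res_closed[OF H' pq, of _ n] by (auto simp: hom_def Pi_iff)
    qed
  next
    fix n p h assume "p \<in> topspace (dual_space X)" "h \<in> carrier (grp (Hom_hat P' L) n p)"
    then show "Hom_hat_map P f l (n + 1) p (diff (Hom_hat P' L) n p h) =
        diff (Hom_hat P L') n p (Hom_hat_map P f l n p h)"
      using chain_maps_diff[OF ch, of p "()" "n + 1" n h] by (simp add: topspace_dual_space[OF fin])
  qed (use hom in \<open>simp add: topspace_dual_space[OF fin]\<close>)
qed

section \<open>The exchange isomorphism\<close>

text \<open>The elements of the iterated Hom complexes form nested function types ending in an
  infinite type; the calculus of roofs asks for such types to be infinite. Constant functions show
  that they are.\<close>

instance "fun" :: (type, infinite) infinite
proof
  have "inj (\<lambda>(b :: 'b) (a :: 'a). b)"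
    by (rule injI) (metis)
  then have "infinite (range (\<lambda>(b :: 'b) (a :: 'a). b))"
    by (simp add: finite_image_iff infinite_UNIV)
  then show "infinite (UNIV :: ('a \<Rightarrow> 'b) set)"
    using finite_subset subset_UNIV by blast
qed

text \<open>The restrictions yield the extensional representative at the outer and at the inner
  level; \<open>v\<close> needs none, as every element of \<open>unit\<close> is a point of
  \<open>pt\<close>.\<close>

definition Hom_swap ::
  "'x topology \<Rightarrow> ('x, 'a) data_complex \<Rightarrow> ('x, 'b) data_complex \<Rightarrow> ('x, 'c) data_complex \<Rightarrow>
     int \<Rightarrow> unit \<Rightarrow> (int \<Rightarrow> 'x \<Rightarrow> 'b \<Rightarrow> int \<Rightarrow> unit \<Rightarrow> 'a \<Rightarrow> 'c) \<Rightarrow>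
     (int \<Rightarrow> 'x \<Rightarrow> 'a \<Rightarrow> int \<Rightarrow> unit \<Rightarrow> 'b \<Rightarrow> 'c)" where
  "Hom_swap X P Q L n u h = (\<lambda>j. \<lambda>p\<in>topspace X. \<lambda>y\<in>carrier (grp P j p). \<lambda>i v. \<lambda>x\<in>carrier (grp Q i p).
     sign_pow (grp L (i + j + n) p) (i * j) (h i p x j () y))"

lemma Hom_swap_apply:
  "p \<in> topspace X \<Longrightarrow> y \<in> carrier (grp P j p) \<Longrightarrow> x \<in> carrier (grp Q i p) \<Longrightarrow>
     Hom_swap X P Q L n u h j p y i v x = sign_pow (grp L (i + j + n) p) (i * j) (h i p x j () y)"
  by (simp add: Hom_swap_def)

lemma complex_on_Hom_hat_dual_complex:
  assumes fin: "finite (topspace X)" and Q: "complex_on (dual_space X) Q"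
    and L: "locally_constant_complex X L"
  shows "complex_on X (Hom_hat Q (dual_complex L))"
  using complex_on_Hom_hat[OF _ Q locally_constant_dual_complex[OF fin L]] fin
  by (simp add: topspace_dual_space dual_space_dual_space)

text \<open>Extensionality at the outer and then at the inner level: an element of an iterated Hom
  complex is determined by its values on pairs of stalk elements.\<close>

lemma Hom_Hom_hat_eqI:
  assumes h: "h \<in> carrier (Hom_group X P (Hom_hat Q L) n)" and k: "k \<in> carrier (Hom_group X P (Hom_hat Q L) n)"
    and eq: "\<And>j p y i x. p \<in> topspace X \<Longrightarrow> y \<in> carrier (grp P j p) \<Longrightarrow> x \<in> carrier (grp Q i p) \<Longrightarrow>
      h j p y i () x = k j p y i () x"
  shows "h = k"
proof (rule Hom_group_eqI[OF h k])
  fix j p y assume py: "p \<in> topspace X" "y \<in> carrier (grp P j p)"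
  show "h j p y = k j p y"
    using Hom_group_closed[OF h refl py] Hom_group_closed[OF k refl py] eq[OF py]
    by (intro Hom_group_eqI[where X = pt and F = "stalk Q p" and G = "stalk L p" and n = "j + n"]) auto
qed

section \<open>Elements of the iterated Hom complex as pairings of stalks\<close>

context
  fixes X :: "'x topology" and P :: "('x, 'a) data_complex" and Q :: "('x, 'b) data_complex"
    and L :: "('x, 'c) data_complex"
  assumes fin: "finite (topspace X)" and P: "complex_on X P" and Q: "complex_on (dual_space X) Q"
    and L: "locally_constant_complex X L"
begin

context
  fixes h n
  assumes h: "h \<in> carrier (Hom_group (dual_space X) Q (Hom_hat P L) n)"
begin

lemma Hom_Hom_hat_inner:
  "p \<in> topspace X \<Longrightarrow> x \<in> carrier (grp Q i p) \<Longrightarrow>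
     h i p x \<in> carrier (Hom_group pt (stalk P p) (stalk L p) (i + n))"
  using Hom_group_closed[OF h refl, of p x i] by (simp add: topspace_dual_space[OF fin])

lemma Hom_Hom_hat_closed:
  assumes "p \<in> topspace X" "x \<in> carrier (grp Q i p)" "y \<in> carrier (grp P j p)" "m = i + j + n"
  shows "h i p x j u y \<in> carrier (grp L m p)"
  using Hom_group_closed[OF Hom_Hom_hat_inner[OF assms(1,2)], of m j u y] assms(3,4)
  by (simp add: add_ac)

lemma Hom_Hom_hat_mult_left:
  assumes "p \<in> topspace X" "x \<in> carrier (grp Q i p)" "x' \<in> carrier (grp Q i p)" "y \<in> carrier (grp P j p)"
    "m = i + j + n"
  shows "h i p (x \<otimes>\<^bsub>grp Q i p\<^esub> x') j u y = h i p x j u y \<otimes>\<^bsub>grp L m p\<^esub> h i p x' j u y"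
  using data_hom_mult[OF Hom_group_data_hom[OF h, of i], of p x x'] assms
  by (simp add: topspace_dual_space[OF fin] mult_Hom_group add_ac)

lemma Hom_Hom_hat_mult_right:
  assumes "p \<in> topspace X" "x \<in> carrier (grp Q i p)" "y \<in> carrier (grp P j p)" "y' \<in> carrier (grp P j p)"
    "m = i + j + n"
  shows "h i p x j u (y \<otimes>\<^bsub>grp P j p\<^esub> y') = h i p x j u y \<otimes>\<^bsub>grp L m p\<^esub> h i p x j u y'"
  using data_hom_mult[OF Hom_group_data_hom[OF Hom_Hom_hat_inner[OF assms(1,2)], of j], of u y y'] assms
  by (simp add: add_ac)

text \<open>Compatibility of \<open>h\<close> with restrictions is an equation with an inverse of
  \<open>res (deg L m) p q\<close> on one side; applying this isomorphism clears the inverse and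
  leaves a condition that treats both arguments alike.\<close>

lemma Hom_Hom_hat_res:
  assumes pq: "spec_le X p q" and x: "x \<in> carrier (grp Q i q)" and y: "y \<in> carrier (grp P j p)"
    and m: "m = i + j + n"
  shows "h i q x j u (res (deg P j) p q y) = res (deg L m) p q (h i p (res (deg Q i) q p x) j u y)"
proof -
  have qp: "spec_le (dual_space X) q p"
    using pq fin by (simp add: spec_le_dual_space)
  note pX = spec_le_in_topspace[OF pq]
  have m': "j + (i + n) = m"
    using m by simp
  have ry: "res (deg P j) p q y \<in> carrier (grp P j q)"
    using abelian_data_res_closed[OF complex_on_abelian_data[OF P] pq y] .
  have "h i p (res (deg Q i) q p x) = res (deg (Hom_hat P L) (i + n)) q p (h i q x)"
    using data_hom_res[OF Hom_group_data_hom[OF h] qp x] .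
  then have "h i p (res (deg Q i) q p x) j u y = res (dual_data (deg L m)) q p (h i q x j u (res (deg P j) p q y))"
    using y by (simp add: res_Hom_hat_apply m')
  then show ?thesis
    using res_dual_data_res[OF locally_constant_complex_deg[OF L] pq Hom_Hom_hat_closed[OF pX(2) x ry m]]
    by simp
qed

text \<open>The inner differential acts on \<open>h i p x\<close>, which has degree i + n, and so
  contributes the exponent i + n + 1; the outer one contributes n + 1.\<close>

lemma Hom_Hom_hat_diff:
  assumes p: "p \<in> topspace X" and x: "x \<in> carrier (grp Q i p)" and y: "y \<in> carrier (grp P j p)"
    and m: "m = i + j + n"
  shows "Hom_diff (dual_space X) Q (Hom_hat P L) n h i p x j u y =
    (diff L m p (h i p x j u y) \<otimes>\<^bsub>grp L (m + 1) p\<^esub>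
      sign_pow (grp L (m + 1) p) (i + n + 1) (h i p x (j + 1) u (diff P j p y))) \<otimes>\<^bsub>grp L (m + 1) p\<^esub>
      sign_pow (grp L (m + 1) p) (n + 1) (h (i + 1) p (diff Q i p x) j u y)"
proof -
  have pY: "p \<in> topspace (dual_space X)"
    using p by (simp add: topspace_dual_space[OF fin])
  note LX = locally_constant_complex_on[OF L]
  note Px = complex_on_stalk[OF P p] and Lx = complex_on_stalk[OF LX p]
  have ys: "y \<in> carrier (grp (stalk P p) j u)"
    using y by simp
  have dx: "diff Q i p x \<in> carrier (grp Q (i + 1) p)"
    using Q pY x by (simp add: complex_on_diff_closed)
  have e: "i + (n + 1) = i + n + 1" "i + 1 + n = i + n + 1" "j + (i + n) = m" "j + (i + n + 1) = m + 1"
    using m by simp_all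
  have hdx: "h (i + 1) p (diff Q i p x) \<in> carrier (Hom_group pt (stalk P p) (stalk L p) (i + n + 1))"
    using Hom_Hom_hat_inner[OF p dx] by (simp only: e)
  have "Hom_diff (dual_space X) Q (Hom_hat P L) n h i p x =
    Hom_diff pt (stalk P p) (stalk L p) (i + n) (h i p x) \<otimes>\<^bsub>Hom_group pt (stalk P p) (stalk L p) (i + n + 1)\<^esub>
      sign_pow (Hom_group pt (stalk P p) (stalk L p) (i + n + 1)) (n + 1) (h (i + 1) p (diff Q i p x))"
    using Hom_diff_apply[OF pY x, where n = n and h = h and G = "Hom_hat P L"]
    by (simp only: grp_Hom_hat diff_Hom_hat e)
  then have "Hom_diff (dual_space X) Q (Hom_hat P L) n h i p x j u y =
      Hom_diff pt (stalk P p) (stalk L p) (i + n) (h i p x) j u y \<otimes>\<^bsub>grp L (m + 1) p\<^esub>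
      sign_pow (Hom_group pt (stalk P p) (stalk L p) (i + n + 1)) (n + 1) (h (i + 1) p (diff Q i p x)) j u y"
    using y by (simp add: mult_Hom_group e(4)[simplified add.assoc] add.assoc)
  also have "sign_pow (Hom_group pt (stalk P p) (stalk L p) (i + n + 1)) (n + 1) (h (i + 1) p (diff Q i p x)) j u y
      = sign_pow (grp L (m + 1) p) (n + 1) (h (i + 1) p (diff Q i p x) j u y)"
    using sign_pow_Hom_group[OF Px Lx hdx _ ys] by (simp only: e grp_stalk topspace_pt UNIV_I)
  also have "Hom_diff pt (stalk P p) (stalk L p) (i + n) (h i p x) j u y =
      diff L m p (h i p x j u y) \<otimes>\<^bsub>grp L (m + 1) p\<^esub>
      sign_pow (grp L (m + 1) p) (i + n + 1) (h i p x (j + 1) u (diff P j p y))"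
    using Hom_diff_apply[OF _ ys, where n = "i + n" and h = "h i p x" and G = "stalk L p"]
    by (simp only: e grp_stalk diff_stalk topspace_pt UNIV_I)
  finally show ?thesis .
qed

text \<open>Additivity in x makes the inner families morphisms, additivity in y the outer ones, and
  the symmetric condition of \<open>Hom_Hom_hat_res\<close> is the compatibility with restrictions
  required on the other side.\<close>

lemma Hom_swap_closed: "Hom_swap X P Q L n u h \<in> carrier (Hom_group X P (Hom_hat Q (dual_complex L)) n)"
proof -
  note LX = locally_constant_complex_on[OF L]
  \<comment> \<open>The exchanged pairing, cut off at the inner level only; the outer cut-off is
    added by \<open>Hom_restrict_in_Hom_group\<close> at the end.\<close>
  define \<kappa> where "\<kappa> j p y = Hom_restrict pt (stalk Q p)
      (\<lambda>i v x. sign_pow (grp L (i + j + n) p) (i * j) (h i p x j () y))" for j p y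
  have \<kappa>: "\<kappa> j p y i v x = sign_pow (grp L (i + j + n) p) (i * j) (h i p x j () y)"
    if "x \<in> carrier (grp Q i p)" for j p y i v x
    using that by (simp add: \<kappa>_def)
  have Qp: "complex_on pt (stalk Q p)" and Lp: "complex_on pt (stalk L p)" if "p \<in> topspace X" for p
    using that Q LX by (auto simp: topspace_dual_space[OF fin] intro: complex_on_stalk)
  have cl: "\<kappa> j p y \<in> carrier (Hom_group pt (stalk Q p) (stalk L p) (j + n))"
    if p: "p \<in> topspace X" and y: "y \<in> carrier (grp P j p)" for j p y
    unfolding \<kappa>_def
  proof (rule Hom_restrict_in_Hom_group[OF Qp[OF p]])
    fix i
    interpret comm_group "grp L (i + j + n) p" using LX p by (rule complex_on_comm_group)
    show "(\<lambda>v x. sign_pow (grp L (i + j + n) p) (i * j) (h i p x j () y))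
        \<in> data_hom pt (deg (stalk Q p) i) (deg (stalk L p) (i + (j + n)))"
      using Hom_Hom_hat_closed[OF p _ y refl] Hom_Hom_hat_mult_left[OF p _ _ y refl]
      by (intro data_homI homI) (simp_all add: sign_pow_closed sign_pow_mult add.assoc[symmetric])
  qed
  have "\<kappa> j \<in> data_hom X (deg P j) (deg (Hom_hat Q (dual_complex L)) (j + n))" for j
  proof (rule data_homI)
    fix p assume p: "p \<in> topspace X"
    show "\<kappa> j p \<in> hom (grp P j p) (grp (Hom_hat Q (dual_complex L)) (j + n) p)"
    proof (rule homI)
      fix y y' assume y: "y \<in> carrier (grp P j p)" "y' \<in> carrier (grp P j p)"
      interpret PC: comm_group "grp P j p" using P p by (rule complex_on_comm_group)
      have "\<kappa> j p (y \<otimes>\<^bsub>grp P j p\<^esub> y') = \<kappa> j p y \<otimes>\<^bsub>Hom_group pt (stalk Q p) (stalk L p) (j + n)\<^esub> \<kappa> j p y'"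
      proof (rule Hom_group_eqI[where X = pt and G = "stalk L p" and n = "j + n"])
        fix i v x assume "x \<in> carrier (grp (stalk Q p) i v)"
        then have x: "x \<in> carrier (grp Q i p)"
          by simp
        interpret comm_group "grp L (i + j + n) p" using LX p by (rule complex_on_comm_group)
        show "\<kappa> j p (y \<otimes>\<^bsub>grp P j p\<^esub> y') i v x
            = (\<kappa> j p y \<otimes>\<^bsub>Hom_group pt (stalk Q p) (stalk L p) (j + n)\<^esub> \<kappa> j p y') i v x"
          using x y Hom_Hom_hat_closed[OF p x _ refl] Hom_Hom_hat_mult_right[OF p x y refl]
          by (simp add: \<kappa> mult_Hom_group sign_pow_mult add.assoc[symmetric])
      qed (use p y Qp Lp cl in \<open>simp_all add: Hom_group_mult_closed\<close>)
      then show "\<kappa> j p (y \<otimes>\<^bsub>grp P j p\<^esub> y')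
          = \<kappa> j p y \<otimes>\<^bsub>grp (Hom_hat Q (dual_complex L)) (j + n) p\<^esub> \<kappa> j p y'"
        by simp
    qed (use cl[OF p] in simp)
  next
    fix p q y assume pq: "spec_le X p q" and y: "y \<in> carrier (grp P j p)"
    note pX = spec_le_in_topspace[OF pq]
    have qp: "spec_le (dual_space X) q p"
      using pq fin by (simp add: spec_le_dual_space)
    have ry: "res (deg P j) p q y \<in> carrier (grp P j q)"
      using abelian_data_res_closed[OF complex_on_abelian_data[OF P] pq y] .
    note QL = complex_on_Hom_hat_dual_complex[OF fin Q L]
    show "\<kappa> j q (res (deg P j) p q y) = res (deg (Hom_hat Q (dual_complex L)) (j + n)) p q (\<kappa> j p y)"
    proof (rule Hom_group_eqI[where X = pt and G = "stalk L q" and n = "j + n"])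
      show "\<kappa> j q (res (deg P j) p q y) \<in> carrier (Hom_group pt (stalk Q q) (stalk L q) (j + n))"
        using cl[OF pX(2) ry] .
      show "res (deg (Hom_hat Q (dual_complex L)) (j + n)) p q (\<kappa> j p y)
          \<in> carrier (Hom_group pt (stalk Q q) (stalk L q) (j + n))"
        using abelian_data_res_closed[OF complex_on_abelian_data[OF QL, of "j + n"] pq, of "\<kappa> j p y"]
          cl[OF pX(1) y] by simp
      fix i v x assume "x \<in> carrier (grp (stalk Q q) i v)"
      then have x: "x \<in> carrier (grp Q i q)"
        by simp
      have rx: "res (deg Q i) q p x \<in> carrier (grp Q i p)"
        using abelian_data_res_closed[OF complex_on_abelian_data[OF Q] qp x] .
      let ?z = "h i p (res (deg Q i) q p x) j () y"
      have z: "?z \<in> carrier (grp L (i + j + n) p)"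
        using Hom_Hom_hat_closed[OF pX(1) rx y refl] .
      have "\<kappa> j q (res (deg P j) p q y) i v x
          = sign_pow (grp L (i + j + n) q) (i * j) (res (deg L (i + j + n)) p q ?z)"
        using x Hom_Hom_hat_res[OF pq x y refl] by (simp add: \<kappa>)
      also have "\<dots> = res (deg L (i + j + n)) p q (sign_pow (grp L (i + j + n) p) (i * j) ?z)"
        using hom_sign_pow[OF _ _ abelian_data_res_hom[OF complex_on_abelian_data[OF LX] pq] z]
          complex_on_comm_group[OF LX] pX by simp
      \<comment> \<open>On \<open>X\<close> the inner complex is formed with the dual of L, whose
        restrictions are inverted once more; on the carrier this gives back the original
        ones.\<close>
      also have "\<dots> = res (dual_data (dual_data (deg L (i + j + n)))) p q
          (sign_pow (grp L (i + j + n) p) (i * j) ?z)"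
        using dual_dual_data_res[OF locally_constant_complex_deg[OF L] pq]
          complex_on_sign_pow_closed[OF LX pX(1) z] by simp
      also have "\<dots> = res (deg (Hom_hat Q (dual_complex L)) (j + n)) p q (\<kappa> j p y) i v x"
        using x rx by (simp add: res_Hom_hat_apply \<kappa> add.assoc)
      finally show "\<kappa> j q (res (deg P j) p q y) i v x
          = res (deg (Hom_hat Q (dual_complex L)) (j + n)) p q (\<kappa> j p y) i v x" .
    qed
  qed
  then have "Hom_restrict X P \<kappa> \<in> carrier (Hom_group X P (Hom_hat Q (dual_complex L)) n)"
    by (rule Hom_restrict_in_Hom_group[OF P])
  then show ?thesis
    by (simp add: Hom_swap_def \<kappa>_def restrict_def)
qed

end

end

text \<open>
  The differentials of the two sides differ by exchanging \<open>i\<close> and \<open>j\<close> in the sign in front of the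
  inner differentials; the factor \<open>(-1)\<^sup>i\<^sup>j\<close> in \<open>Hom_swap\<close> compensates for this.
\<close>

lemma Hom_swap_chain_maps:
  assumes fin: "finite (topspace X)" and P: "complex_on X P" and Q: "complex_on (dual_space X) Q"
    and L: "locally_constant_complex X L"
  shows "Hom_swap X P Q L \<in> chain_maps pt (Hom_complex (dual_space X) Q (Hom_hat P L))
    (Hom_complex X P (Hom_hat Q (dual_complex L)))"
proof (rule chain_mapsI)
  note LX = locally_constant_complex_on[OF L] and dL = locally_constant_dual_complex[OF fin L]
  note HX = complex_on_Hom_hat_dual_complex[OF fin Q L] and HY = complex_on_Hom_hat[OF fin P L]
  note fin' = fin[folded topspace_dual_space[OF fin]]
  note cl = Hom_swap_closed[OF fin P Q L]
  fix n
  show "Hom_swap X P Q L n \<in> data_hom pt (deg (Hom_complex (dual_space X) Q (Hom_hat P L)) n)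
      (deg (Hom_complex X P (Hom_hat Q (dual_complex L))) n)"
  proof (rule data_homI)
    fix u
    have "Hom_swap X P Q L n u \<in> hom (Hom_group (dual_space X) Q (Hom_hat P L) n)
      (Hom_group X P (Hom_hat Q (dual_complex L)) n)"
    proof (rule homI)
      fix h k assume h: "h \<in> carrier (Hom_group (dual_space X) Q (Hom_hat P L) n)"
        and k: "k \<in> carrier (Hom_group (dual_space X) Q (Hom_hat P L) n)"
      note hk = Hom_group_mult_closed[OF Q HY h k]
      show "Hom_swap X P Q L n u (h \<otimes>\<^bsub>Hom_group (dual_space X) Q (Hom_hat P L) n\<^esub> k) =
         Hom_swap X P Q L n u h \<otimes>\<^bsub>Hom_group X P (Hom_hat Q (dual_complex L)) n\<^esub> Hom_swap X P Q L n u k"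
      proof (rule Hom_Hom_hat_eqI[OF cl[OF hk] Hom_group_mult_closed[OF P HX cl[OF h] cl[OF k]]])
        fix j p y i x assume p: "p \<in> topspace X" and y: "y \<in> carrier (grp P j p)" and x: "x \<in> carrier (grp Q i p)"
        interpret comm_group "grp L (i + j + n) p" using LX p by (rule complex_on_comm_group)
        have e: "j + (i + n) = i + j + n" "i + (j + n) = i + j + n"
          by simp_all
        show "Hom_swap X P Q L n u (h \<otimes>\<^bsub>Hom_group (dual_space X) Q (Hom_hat P L) n\<^esub> k) j p y i () x =
          (Hom_swap X P Q L n u h \<otimes>\<^bsub>Hom_group X P (Hom_hat Q (dual_complex L)) n\<^esub> Hom_swap X P Q L n u k) j p y i () x"
          using p x y Hom_Hom_hat_closed[OF fin P Q L h p x y refl] Hom_Hom_hat_closed[OF fin P Q L k p x y refl]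
          by (simp add: Hom_swap_apply mult_Hom_group topspace_dual_space[OF fin] e sign_pow_mult)
      qed
    qed (rule cl)
    then show "Hom_swap X P Q L n u \<in> hom (grp (Hom_complex (dual_space X) Q (Hom_hat P L)) n u)
      (grp (Hom_complex X P (Hom_hat Q (dual_complex L))) n u)"
      by simp
  qed simp
  fix u h assume "h \<in> carrier (grp (Hom_complex (dual_space X) Q (Hom_hat P L)) n u)"
  then have h: "h \<in> carrier (Hom_group (dual_space X) Q (Hom_hat P L) n)"
    by simp
  note dh = Hom_diff_closed[OF Q HY h]
  have "Hom_swap X P Q L (n + 1) u (Hom_diff (dual_space X) Q (Hom_hat P L) n h) =
      Hom_diff X P (Hom_hat Q (dual_complex L)) n (Hom_swap X P Q L n u h)"
  proof (rule Hom_Hom_hat_eqI[OF cl[OF dh] Hom_diff_closed[OF P HX cl[OF h]]])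
    fix j p y i x assume p: "p \<in> topspace X" and y: "y \<in> carrier (grp P j p)" and x: "x \<in> carrier (grp Q i p)"
    have pY: "p \<in> topspace (dual_space X)"
      using p by (simp add: topspace_dual_space[OF fin])
    define m where "m = i + j + n"
    let ?M = "grp L (m + 1) p"
    interpret comm_group ?M using LX p by (rule complex_on_comm_group)
    have dx: "diff Q i p x \<in> carrier (grp Q (i + 1) p)"
      using Q pY x by (simp add: complex_on_diff_closed)
    have dy: "diff P j p y \<in> carrier (grp P (j + 1) p)"
      using P p y by (simp add: complex_on_diff_closed)
    define a b c where "a = h i p x j () y" and "b = h i p x (j + 1) () (diff P j p y)"
      and "c = h (i + 1) p (diff Q i p x) j () y"
    have a: "a \<in> carrier (grp L m p)" and b: "b \<in> carrier ?M" and c: "c \<in> carrier ?M"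
      unfolding a_def b_def c_def m_def using p x y dx dy
      by (auto intro: Hom_Hom_hat_closed[OF fin P Q L h])
    have da: "diff L m p a \<in> carrier ?M"
      using complex_on_diff_closed[OF LX p refl a] .
    have "Hom_swap X P Q L (n + 1) u (Hom_diff (dual_space X) Q (Hom_hat P L) n h) j p y i () x =
        sign_pow ?M (i * j) ((diff L m p a \<otimes>\<^bsub>?M\<^esub> sign_pow ?M (i + n + 1) b) \<otimes>\<^bsub>?M\<^esub> sign_pow ?M (n + 1) c)"
      unfolding Hom_swap_apply[OF p y x] Hom_Hom_hat_diff[OF fin P Q L h p x y m_def]
      by (simp add: m_def a_def b_def c_def add.assoc)
    also have "\<dots> = (diff L m p (sign_pow (grp L m p) (i * j) a) \<otimes>\<^bsub>?M\<^esub>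
        sign_pow ?M (j + n + 1) (sign_pow ?M ((i + 1) * j) c)) \<otimes>\<^bsub>?M\<^esub>
        sign_pow ?M (n + 1) (sign_pow ?M (i * (j + 1)) b)"
    proof -
      \<comment> \<open>For each of the two inner differentials the exponent before the exchange and
        the one after it have an even sum, hence equal signs. This is the check that i j is the
        right exponent.\<close>
      have "i * j + (i + n + 1) + (n + 1 + i * (j + 1)) = 2 * (i * j + i + n + 1)"
        "i * j + (n + 1) + (j + n + 1 + (i + 1) * j) = 2 * (i * j + j + n + 1)"
        by (simp_all add: algebra_simps)
      then have "sign_pow ?M (i * j + (i + n + 1)) b = sign_pow ?M (n + 1 + i * (j + 1)) b"
        "sign_pow ?M (i * j + (n + 1)) c = sign_pow ?M (j + n + 1 + (i + 1) * j) c"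
        by (metis dvd_triv_left sign_pow_cong)+
      then show ?thesis
        using a b c da complex_on_diff_sign_pow[OF LX p refl a]
        by (simp only: sign_pow_mult sign_pow_sign_pow sign_pow_closed m_closed m_ac)
    qed
    also have "\<dots> = Hom_diff X P (Hom_hat Q (dual_complex L)) n (Hom_swap X P Q L n u h) j p y i () x"
    proof -
      have "Hom_swap X P Q L n u h j p y i () x = sign_pow (grp L m p) (i * j) a"
        using p x y by (simp add: Hom_swap_apply m_def a_def)
      moreover have "Hom_swap X P Q L n u h j p y (i + 1) () (diff Q i p x) = sign_pow ?M ((i + 1) * j) c"
        unfolding Hom_swap_apply[OF p y dx] by (simp add: m_def c_def add_ac)
      moreover have "Hom_swap X P Q L n u h (j + 1) p (diff P j p y) i () x = sign_pow ?M (i * (j + 1)) b"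
        unfolding Hom_swap_apply[OF p dy x] by (simp add: m_def b_def add_ac)
      moreover have "m = j + i + n"
        by (simp add: m_def)
      ultimately show ?thesis
        \<comment> \<open>The same expansion on the dual space, with \<open>P\<close> and
          \<open>Q\<close> interchanged and L replaced by its dual.\<close>
        using Hom_Hom_hat_diff[OF fin' Q _ dL, unfolded dual_space_dual_space[OF fin], OF P cl[OF h] pY y x]
        by simp
    qed
    finally show "Hom_swap X P Q L (n + 1) u (Hom_diff (dual_space X) Q (Hom_hat P L) n h) j p y i () x =
      Hom_diff X P (Hom_hat Q (dual_complex L)) n (Hom_swap X P Q L n u h) j p y i () x" .
  qed
  then show "Hom_swap X P Q L (n + 1) u (diff (Hom_complex (dual_space X) Q (Hom_hat P L)) n u h) =
      diff (Hom_complex X P (Hom_hat Q (dual_complex L))) n u (Hom_swap X P Q L n u h)"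
    by simp
qed

text \<open>Restrictions enter a Hom complex only through the condition in \<open>data_hom\<close>,
  which evaluates them on carriers, where double dualisation changes nothing. Hence the exchange
  performed from the other side lands in the original complex literally.\<close>

lemma Hom_complex_Hom_hat_dual_dual:
  assumes fin: "finite (topspace X)" and P: "complex_on X P" and L: "locally_constant_complex X L"
  shows "Hom_complex (dual_space X) Q (Hom_hat P (dual_complex (dual_complex L))) =
    Hom_complex (dual_space X) Q (Hom_hat P L)"
proof -
  note lc = locally_constant_complex_deg[OF L]
  note lcd = locally_constant_complex_deg[OF locally_constant_dual_complex[OF fin L]]
  have res: "res (deg (Hom_hat P (dual_complex (dual_complex L))) m) p q h = res (deg (Hom_hat P L) m) p q h"
    if pq: "spec_le (dual_space X) p q" and h: "h \<in> carrier (grp (Hom_hat P L) m p)" for m p q h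
  proof -
    have qp: "spec_le X q p"
      using pq fin by (simp add: spec_le_dual_space)
    \<comment> \<open>\<open>dual_dual_data_res\<close> on the dual space, for the dual of L: a
      triple dual restricts like a single one.\<close>
    have "res (dual_data (dual_data (dual_data (deg L (j + m))))) p q (h j u (res (deg P j) q p y)) =
        res (dual_data (deg L (j + m))) p q (h j u (res (deg P j) q p y))"
      if y: "y \<in> carrier (grp P j q)" for j u y
    proof (rule dual_dual_data_res[OF _ pq])
      show "locally_constant (dual_space X) (dual_data (deg L (j + m)))"
        using lcd[of "j + m"] by simp
      show "h j u (res (deg P j) q p y) \<in> carrier (sec (dual_data (deg L (j + m))) p)"
        using Hom_group_closed[of h pt "stalk P p" "stalk L p" m "j + m" j u] h
          abelian_data_res_closed[OF complex_on_abelian_data[OF P] qp y] by simp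
    qed
    then show ?thesis
      by (simp add: res_Hom_hat Hom_map_def fun_eq_iff restrict_def)
  qed
  have "data_hom (dual_space X) (deg Q i) (deg (Hom_hat P (dual_complex (dual_complex L))) m) =
      data_hom (dual_space X) (deg Q i) (deg (Hom_hat P L) m)" for i m
  proof -
    have "(\<forall>p q. spec_le (dual_space X) p q \<longrightarrow> (\<forall>x\<in>carrier (grp Q i p).
          f q (res (deg Q i) p q x) = res (deg (Hom_hat P (dual_complex (dual_complex L))) m) p q (f p x))) \<longleftrightarrow>
        (\<forall>p q. spec_le (dual_space X) p q \<longrightarrow> (\<forall>x\<in>carrier (grp Q i p).
          f q (res (deg Q i) p q x) = res (deg (Hom_hat P L) m) p q (f p x)))"
      if f: "\<forall>p\<in>topspace (dual_space X). f p \<in> hom (grp Q i p) (grp (Hom_hat P L) m p)" for f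
    proof -
      have "res (deg (Hom_hat P (dual_complex (dual_complex L))) m) p q (f p x) = res (deg (Hom_hat P L) m) p q (f p x)"
        if "spec_le (dual_space X) p q" "x \<in> carrier (grp Q i p)" for p q x
        using that f spec_le_in_topspace(1)[OF that(1)] by (intro res) (auto simp: hom_def)
      then show ?thesis
        by simp
    qed
    then have "f \<in> data_hom (dual_space X) (deg Q i) (deg (Hom_hat P (dual_complex (dual_complex L))) m) \<longleftrightarrow>
        f \<in> data_hom (dual_space X) (deg Q i) (deg (Hom_hat P L) m)" for f
      unfolding data_hom_def mem_Collect_eq grp_Hom_hat stalk_dual_complex by blast
    then show ?thesis
      by blast
  qed
  then show ?thesis
    by (simp add: Hom_complex_def Hom_group_def Hom_diff_def fun_eq_iff)
qed

text \<open>The arguments return to their places and the total exponent is 2 i j.\<close>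

lemma Hom_swap_swap:
  assumes fin: "finite (topspace X)" and P: "complex_on X P" and Q: "complex_on (dual_space X) Q"
    and L: "locally_constant_complex X L" and h: "h \<in> carrier (Hom_group (dual_space X) Q (Hom_hat P L) n)"
  shows "Hom_swap (dual_space X) Q P (dual_complex L) n u (Hom_swap X P Q L n v h) = h"
proof -
  note LX = locally_constant_complex_on[OF L] and dL = locally_constant_dual_complex[OF fin L]
  note fin' = fin[folded topspace_dual_space[OF fin]]
  have "carrier (Hom_group (dual_space X) Q (Hom_hat P (dual_complex (dual_complex L))) n) =
      carrier (Hom_group (dual_space X) Q (Hom_hat P L) n)"
    using arg_cong[OF Hom_complex_Hom_hat_dual_dual[OF fin P L], where f = "\<lambda>K. carrier (grp K n ())" for Q]
    by simp
  then have c: "Hom_swap (dual_space X) Q P (dual_complex L) n u (Hom_swap X P Q L n v h)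
      \<in> carrier (Hom_group (dual_space X) Q (Hom_hat P L) n)"
    using Hom_swap_closed[OF fin' Q _ dL, unfolded dual_space_dual_space[OF fin], OF P Hom_swap_closed[OF fin P Q L h]]
    by simp
  show ?thesis
  proof (rule Hom_Hom_hat_eqI[OF c h])
    fix i p x j y assume pY: "p \<in> topspace (dual_space X)" and x: "x \<in> carrier (grp Q i p)"
      and y: "y \<in> carrier (grp P j p)"
    have p: "p \<in> topspace X"
      using pY by (simp add: topspace_dual_space[OF fin])
    interpret comm_group "grp L (i + j + n) p" using LX p by (rule complex_on_comm_group)
    have hc: "h i p x j () y \<in> carrier (grp L (i + j + n) p)"
      using Hom_Hom_hat_closed[OF fin P Q L h p x y refl] .
    have "Hom_swap X P Q L n v h j p y i () x = sign_pow (grp L (i + j + n) p) (i * j) (h i p x j () y)"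
      using Hom_swap_apply[OF p y x] .
    moreover have "Hom_swap (dual_space X) Q P (dual_complex L) n u (Hom_swap X P Q L n v h) i p x j () y =
        sign_pow (grp (dual_complex L) (j + i + n) p) (j * i) (Hom_swap X P Q L n v h j p y i () x)"
      using Hom_swap_apply[OF pY x y] .
    ultimately show "Hom_swap (dual_space X) Q P (dual_complex L) n u (Hom_swap X P Q L n v h) i p x j () y = h i p x j () y"
      using sign_pow_sign_pow[OF hc, of "i * j" "i * j"]
      by (simp add: add.commute[of j i] mult.commute[of j i]) (simp add: sign_pow_def)
  qed
qed

text \<open>Compares the element types of the two sides of the theorem; by symmetry in
  \<open>'a\<close> and \<open>'b\<close> it serves in both directions.\<close>

lemma lepoll_swap_args:
  "(UNIV :: (int \<Rightarrow> 'x \<Rightarrow> 'a \<Rightarrow> int \<Rightarrow> unit \<Rightarrow> 'b \<Rightarrow> 'c) set) \<lesssim>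
     (UNIV :: (int \<Rightarrow> 'x \<Rightarrow> 'b \<Rightarrow> int \<Rightarrow> unit \<Rightarrow> 'a \<Rightarrow> 'c) set)"
  unfolding lepoll_def
proof (intro exI conjI)
  show "inj (\<lambda>(h :: int \<Rightarrow> 'x \<Rightarrow> 'a \<Rightarrow> int \<Rightarrow> unit \<Rightarrow> 'b \<Rightarrow> 'c) j p y i u x. h i p x j u y)"
    by (rule injI) (metis ext)
qed simp

text \<open>The inverse is the same exchange, performed on the dual space with the dual of
  L.\<close>

lemma D_iso_Hom_swap:
  fixes P :: "('x, 'a) data_complex" and Q :: "('x, 'b) data_complex" and L :: "('x, 'c::infinite) data_complex"
  assumes fin: "finite (topspace X)" and P: "complex_on X P" and Q: "complex_on (dual_space X) Q"
    and L: "locally_constant_complex X L"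
  defines "A \<equiv> Hom_complex (dual_space X) Q (Hom_hat P L)"
    and "B \<equiv> Hom_complex X P (Hom_hat Q (dual_complex L))"
  shows "D_iso pt A B (D_of_map pt A B (Hom_swap X P Q L))"
proof -
  note dL = locally_constant_dual_complex[OF fin L]
  note fin' = fin[folded topspace_dual_space[OF fin]]
  have A: "complex_on pt A" and B: "complex_on pt B"
    unfolding A_def B_def
    using complex_on_Hom_complex[OF Q complex_on_Hom_hat[OF fin P L]]
      complex_on_Hom_complex[OF P complex_on_Hom_hat_dual_complex[OF fin Q L]] .
  have swap: "Hom_swap X P Q L \<in> chain_maps pt A B"
    unfolding A_def B_def by (rule Hom_swap_chain_maps[OF fin P Q L])
  have swap': "Hom_swap (dual_space X) Q P (dual_complex L) \<in> chain_maps pt B A"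
    using Hom_swap_chain_maps[OF fin' Q _ dL, unfolded dual_space_dual_space[OF fin], OF P]
    unfolding A_def B_def Hom_complex_Hom_hat_dual_dual[OF fin P L] .
  show ?thesis
  proof (rule D_iso_D_of_map[OF lepoll_swap_args lepoll_swap_args A B swap swap'])
    show "Hom_swap (dual_space X) Q P (dual_complex L) n p (Hom_swap X P Q L n p h) = h"
      if "h \<in> carrier (grp A n p)" for n p h
      using Hom_swap_swap[OF fin P Q L, of h n] that by (simp add: A_def)
    show "Hom_swap X P Q L n p (Hom_swap (dual_space X) Q P (dual_complex L) n p k) = k"
      if "k \<in> carrier (grp B n p)" for n p k
    proof -
      have "Hom_swap (dual_space (dual_space X)) P Q (dual_complex (dual_complex L)) n p
          (Hom_swap (dual_space X) Q P (dual_complex L) n p k) = k"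
        using Hom_swap_swap[OF fin' Q _ dL, of P k n] P that
        by (simp add: B_def dual_space_dual_space[OF fin])
      \<comment> \<open>\<open>Hom_swap\<close> depends on the space only through its points and on
        L only through its groups, so both double duals disappear.\<close>
      then show ?thesis
        by (simp add: Hom_swap_def dual_space_dual_space[OF fin])
    qed
  qed
qed

text \<open>\<open>f\<close> and \<open>t\<close> act on separate arguments and preserve degrees, so
  i j is unaffected, and the additive map \<open>l\<close> commutes with signs. The square therefore
  commutes strictly, before passing to the derived category.\<close>

lemma Hom_swap_natural:
  assumes fin: "finite (topspace X)"
    and P: "complex_on X P" and P': "complex_on X P'"
    and Q: "complex_on (dual_space X) Q" and Q': "complex_on (dual_space X) Q'"
    and L: "locally_constant_complex X L" and L': "locally_constant_complex X L'"
    and f: "f \<in> chain_maps X P P'" and t: "t \<in> chain_maps (dual_space X) Q Q'"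
    and l: "l \<in> chain_maps X L L'"
    and h: "h \<in> carrier (Hom_group (dual_space X) Q' (Hom_hat P' L) n)"
  shows "Hom_swap X P Q L' n u (Hom_map (dual_space X) Q t (Hom_hat_map P f l) n u h) =
    Hom_map X P f (Hom_hat_map Q t l) n u (Hom_swap X P' Q' L n u h)"
proof -
  note LX = locally_constant_complex_on[OF L] and LX' = locally_constant_complex_on[OF L']
  have Hl: "Hom_hat_map Q t l \<in> chain_maps X (Hom_hat Q' (dual_complex L)) (Hom_hat Q (dual_complex L'))"
    using Hom_hat_map_chain_maps[OF _ Q Q' locally_constant_dual_complex[OF fin L]
        locally_constant_dual_complex[OF fin L'] t chain_maps_dual_complex[OF fin L L' l]] fin
    by (simp add: topspace_dual_space dual_space_dual_space)
  have Hr: "Hom_map (dual_space X) Q t (Hom_hat_map P f l) n u h \<in> carrier (Hom_group (dual_space X) Q (Hom_hat P L') n)"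
    using Hom_map_closed[OF Q t Hom_hat_map_chain_maps[OF fin P P' L L' f l] h] .
  show ?thesis
  proof (rule Hom_Hom_hat_eqI)
    show "Hom_swap X P Q L' n u (Hom_map (dual_space X) Q t (Hom_hat_map P f l) n u h)
        \<in> carrier (Hom_group X P (Hom_hat Q (dual_complex L')) n)"
      using Hom_swap_closed[OF fin P Q L' Hr] .
    show "Hom_map X P f (Hom_hat_map Q t l) n u (Hom_swap X P' Q' L n u h)
        \<in> carrier (Hom_group X P (Hom_hat Q (dual_complex L')) n)"
      using Hom_map_closed[OF P f Hl Hom_swap_closed[OF fin P' Q' L h]] .
    fix j p y i x assume p: "p \<in> topspace X" and y: "y \<in> carrier (grp P j p)" and x: "x \<in> carrier (grp Q i p)"
    have pY: "p \<in> topspace (dual_space X)"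
      using p by (simp add: topspace_dual_space[OF fin])
    have c: "f j p y \<in> carrier (grp P' j p)" "t i p x \<in> carrier (grp Q' i p)"
      using chain_maps_closed[OF f p y] chain_maps_closed[OF t pY x] .
    have hc: "h i p (t i p x) j () (f j p y) \<in> carrier (grp L (i + j + n) p)"
      using Hom_Hom_hat_closed[OF fin P' Q' L h p c(2,1) refl] .
    have e: "j + (i + n) = i + j + n" "i + (j + n) = i + j + n"
      by simp_all
    show "Hom_swap X P Q L' n u (Hom_map (dual_space X) Q t (Hom_hat_map P f l) n u h) j p y i () x =
        Hom_map X P f (Hom_hat_map Q t l) n u (Hom_swap X P' Q' L n u h) j p y i () x"
      using p pY x y c chain_maps_sign_pow[OF LX LX' l p hc]
      by (simp add: Hom_swap_apply Hom_map_apply Hom_hat_map_apply e)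
  qed
qed

section \<open>The theorem for the chosen resolutions\<close>

lemma lifts_chain_maps: "lifts X R F F' \<phi> f \<Longrightarrow> f \<in> chain_maps X (fst (R F)) (fst (R F'))"
  by (simp add: lifts_def)

lemma K_projective_resolution_complex_on:
  "K_projective_resolution X R \<Longrightarrow> complex_on X F \<Longrightarrow> complex_on X (fst (R F))"
  by (simp add: K_projective_resolution_def K_projective_def)

theorem theorem4p2p5:
  fixes X :: "'x topology"
    and R :: "('x, 'a::infinite) resolution"
    and S :: "('x, 'b::infinite) resolution"
  assumes fin: "finite (topspace X)"
    and R: "K_projective_resolution X R"
    and S: "K_projective_resolution (dual_space X) S"
  shows "\<exists>\<eta> :: ('x, 'a) data_complex \<Rightarrow> ('x, 'b) data_complex \<Rightarrow> ('x, 'c::infinite) data_complex \<Rightarrow> _.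
    (\<forall>F T L. complex_on X F \<longrightarrow> complex_on (dual_space X) T \<longrightarrow> locally_constant_complex X L \<longrightarrow>
       D_iso pt (RHom (dual_space X) S T (LHom_hat R F L))
                (RHom X R F (LHom_hat S T (dual_complex L)))
                (\<eta> F T L)) \<and>
    (\<forall>F F' T T' L L' \<phi> \<tau> f t l.
       complex_on X F \<longrightarrow> complex_on X F' \<longrightarrow>
       complex_on (dual_space X) T \<longrightarrow> complex_on (dual_space X) T' \<longrightarrow>
       locally_constant_complex X L \<longrightarrow> locally_constant_complex X L' \<longrightarrow>
       \<phi> \<in> D_hom X F F' \<longrightarrow> lifts X R F F' \<phi> f \<longrightarrow>
       \<tau> \<in> D_hom (dual_space X) T T' \<longrightarrow> lifts (dual_space X) S T T' \<tau> t \<longrightarrow>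
       l \<in> chain_maps X L L' \<longrightarrow>
       D_comp pt
         (RHom (dual_space X) S T' (LHom_hat R F' L))
         (RHom (dual_space X) S T (LHom_hat R F L'))
         (RHom X R F (LHom_hat S T (dual_complex L')))
         (\<eta> F T L')
         (D_of_map pt
            (RHom (dual_space X) S T' (LHom_hat R F' L))
            (RHom (dual_space X) S T (LHom_hat R F L'))
            (RHom_map (dual_space X) S T t (LHom_hat_map R F f l))) =
       D_comp pt
         (RHom (dual_space X) S T' (LHom_hat R F' L))
         (RHom X R F' (LHom_hat S T' (dual_complex L)))
         (RHom X R F (LHom_hat S T (dual_complex L')))
         (D_of_map pt
            (RHom X R F' (LHom_hat S T' (dual_complex L)))
            (RHom X R F (LHom_hat S T (dual_complex L')))
            (RHom_map X R F f (LHom_hat_map S T t l)))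
         (\<eta> F' T' L))"
\<comment> \<open>\<open>\<eta>\<close> is the class of the exchange for the chosen resolutions. The
  lifts are chain maps between these resolutions, so both ways around the naturality square are
  composites of chain maps.\<close>
proof (intro exI[of _ "\<lambda>F T L. D_of_map pt (RHom (dual_space X) S T (LHom_hat R F L))
      (RHom X R F (LHom_hat S T (dual_complex L))) (Hom_swap X (fst (R F)) (fst (S T)) L)"] conjI allI impI)
  fix F :: "('x, 'a) data_complex" and T :: "('x, 'b) data_complex" and L :: "('x, 'c) data_complex"
  assume F: "complex_on X F" and T: "complex_on (dual_space X) T" and L: "locally_constant_complex X L"
  show "D_iso pt (RHom (dual_space X) S T (LHom_hat R F L)) (RHom X R F (LHom_hat S T (dual_complex L)))
      (D_of_map pt (RHom (dual_space X) S T (LHom_hat R F L))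
        (RHom X R F (LHom_hat S T (dual_complex L))) (Hom_swap X (fst (R F)) (fst (S T)) L))"
    unfolding RHom_def LHom_hat_def
    using K_projective_resolution_complex_on[OF R F] K_projective_resolution_complex_on[OF S T]
    by (intro D_iso_Hom_swap fin L)
next
  fix F F' :: "('x, 'a) data_complex" and T T' :: "('x, 'b) data_complex"
    and L L' :: "('x, 'c) data_complex" and \<phi> \<tau> f t l
  assume F: "complex_on X F" and F': "complex_on X F'"
    and T: "complex_on (dual_space X) T" and T': "complex_on (dual_space X) T'"
    and L: "locally_constant_complex X L" and L': "locally_constant_complex X L'"
    and f: "lifts X R F F' \<phi> f" and t: "lifts (dual_space X) S T T' \<tau> t"
    and l: "l \<in> chain_maps X L L'"
  note P = K_projective_resolution_complex_on[OF R F] and P' = K_projective_resolution_complex_on[OF R F']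
    and Q = K_projective_resolution_complex_on[OF S T] and Q' = K_projective_resolution_complex_on[OF S T']
  note cf = lifts_chain_maps[OF f] and ct = lifts_chain_maps[OF t]
  let ?A = "RHom (dual_space X) S T' (LHom_hat R F' L)"
  let ?B = "RHom (dual_space X) S T (LHom_hat R F L')"
  let ?B' = "RHom X R F' (LHom_hat S T' (dual_complex L))"
  let ?C = "RHom X R F (LHom_hat S T (dual_complex L'))"
  let ?a = "RHom_map (dual_space X) S T t (LHom_hat_map R F f l)"
  let ?b = "RHom_map X R F f (LHom_hat_map S T t l)"
  let ?s = "Hom_swap X (fst (R F)) (fst (S T)) L'"
  let ?s' = "Hom_swap X (fst (R F')) (fst (S T')) L"
  have A: "complex_on pt ?A" and B: "complex_on pt ?B"
    unfolding RHom_def LHom_hat_def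
    using complex_on_Hom_complex[OF Q' complex_on_Hom_hat[OF fin P' L]]
      complex_on_Hom_complex[OF Q complex_on_Hom_hat[OF fin P L']] .
  have B': "complex_on pt ?B'" and C: "complex_on pt ?C"
    unfolding RHom_def LHom_hat_def
    using complex_on_Hom_complex[OF P' complex_on_Hom_hat_dual_complex[OF fin Q' L]]
      complex_on_Hom_complex[OF P complex_on_Hom_hat_dual_complex[OF fin Q L']] .
  have a: "?a \<in> chain_maps pt ?A ?B"
    unfolding RHom_def LHom_hat_def RHom_map_def LHom_hat_map_def
    by (intro Hom_map_chain_maps complex_on_Hom_hat Hom_hat_map_chain_maps fin P P' Q Q' L L' cf ct l)
  have Hl: "LHom_hat_map S T t l \<in> chain_maps X (LHom_hat S T' (dual_complex L)) (LHom_hat S T (dual_complex L'))"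
    unfolding LHom_hat_def LHom_hat_map_def
    using Hom_hat_map_chain_maps[OF _ Q Q' locally_constant_dual_complex[OF fin L]
        locally_constant_dual_complex[OF fin L'] ct chain_maps_dual_complex[OF fin L L' l]] fin
    by (simp add: topspace_dual_space dual_space_dual_space)
  have b: "?b \<in> chain_maps pt ?B' ?C"
    using Hl unfolding RHom_def LHom_hat_def RHom_map_def
    by (intro Hom_map_chain_maps complex_on_Hom_hat_dual_complex fin P P' Q Q' L L' cf)
  have s: "?s \<in> chain_maps pt ?B ?C" and s': "?s' \<in> chain_maps pt ?A ?B'"
    unfolding RHom_def LHom_hat_def
    using Hom_swap_chain_maps[OF fin P Q L'] Hom_swap_chain_maps[OF fin P' Q' L] .
  have "D_comp pt ?A ?B ?C (D_of_map pt ?B ?C ?s) (D_of_map pt ?A ?B ?a) = D_of_map pt ?A ?C (?s \<circ>\<^sub>c ?a)"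
    using D_comp_D_of_map[OF lepoll_refl A B C a s] .
  also have "\<dots> = D_of_map pt ?A ?C (?b \<circ>\<^sub>c ?s')"
  \<comment> \<open>Strict commutativity of the square on carriers suffices here.\<close>
  proof (rule D_of_map_cong[OF A C chain_maps_comp[OF s' b]])
    fix n u h assume "h \<in> carrier (grp ?A n u)"
    then show "(?s \<circ>\<^sub>c ?a) n u h = (?b \<circ>\<^sub>c ?s') n u h"
      using Hom_swap_natural[OF fin P P' Q Q' L L' cf ct l, of h n u]
      by (simp add: RHom_def LHom_hat_def RHom_map_def LHom_hat_map_def comp_map_def)
  qed
  also have "\<dots> = D_comp pt ?A ?B' ?C (D_of_map pt ?B' ?C ?b) (D_of_map pt ?A ?B' ?s')"
    \<comment> \<open>This path passes through a complex over the other element type, in contrast to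
      the first one, where source and middle term share their type.\<close>
    using D_comp_D_of_map[OF lepoll_swap_args A B' C s' b] by simp
  finally show "D_comp pt ?A ?B ?C (D_of_map pt ?B ?C ?s) (D_of_map pt ?A ?B ?a) =
      D_comp pt ?A ?B' ?C (D_of_map pt ?B' ?C ?b) (D_of_map pt ?A ?B' ?s')" .
qed

end
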